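(* Let $\mathcal T_0$ be an initial AMP marked mesh. For every $\mathtt{RefineAMP}$ call on a descendant mesh of $\mathcal T_0$, each horizontal block of a causal chain of that call has at most $$H_{\mathrm{AMP}}:=\max\{448\,\#\mathcal T_0,\;630\,\nu\}$$ events, where $\nu=\sup_{q\ge0}\sup_{z\in\mathcal V(\mathcal U_q)}\#\{K\in\mathcal U_q:z\in\mathcal V(K)\}$ is the (finite) uniform macro-vertex valence.
   Context: **Notation.** Tetrahedra are closed and nondegenerate in $\mathbb R^3$; $[v_0,v_1,\dots]$ is the convex hull; $\mathcal V(X),\mathcal E(X),\mathcal F(X)$ are the sets of vertices, edges, triangular faces of a tetrahedron or mesh $X$; $\operatorname{mid}(e)$ is the midpoint of $e$. **Marked tetrahedron.** A tetrahedron $K$ with a refinement edge $e(K)\in\mathcal E(K)$, a marked edge $\mu_F\in\mathcal E(F)$ for every $F\in\mathcal F(K)$, and a Boolean flag, such that the two faces containing $e(K)$ (refinement faces) have mark $e(K)$; the flag may be set only if the four face marks are coplanar. The other two faces are the nonrefinement faces. Types: $P$ if all face marks are coplanar ($P_u$ flag unset, $P_f$ flag set); $A$ if the marks of both nonrefinement faces meet $e(K)$ but the four marks are not coplanar; $O$ if neither of these two marks meets $e(K)$; $M$ if exactly one does. **Bisection.** For $K=[v_0,v_1,v_2,v_3]$ with $e(K)=[v_0,v_1]$ and $m=\operatorname{mid}([v_0,v_1])$, the children are $K_0=[v_0,m,v_2,v_3]$ and $K_1=[m,v_1,v_2,v_3]$, marked as follows: (B1) the inherited face of a child (a face of $K$)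 keeps its mark, and this mark is the refinement edge of the child; (B2) a cut face (a proper subtriangle of a face of $K$) is marked by its edge opposite $m$; (B3) the common new face $[m,v_2,v_3]$ is marked by $[v_2,v_3]$, except if $K$ has type $P_f$, when it is marked by $[m,w]$ with $w\in\{v_2,v_3\}$ the common old endpoint of the two child refinement edges; (B4) the child flags are set iff $K$ has type $P_u$. **Meshes.** A tetrahedral mesh of a polyhedral domain $\Omega\subset\mathbb R^3$ is a finite collection of tetrahedra with pairwise disjoint interiors and union $\overline\Omega$. It is conforming if two distinct elements intersect in the empty set, a common vertex, a common edge or a common face. An AMP marked mesh is a mesh of marked tetrahedra; it is conformingly marked if it is conforming and any shared face gets the same mark from both sides. An *initial AMP marked mesh* is a finite conformingly marked AMP mesh with all flags unset. Repeated bisection generates a binary tree below each $K\in\mathcal T_0$; its nodes are the AMP descendants, and $\operatorname{gen}(K)$ is the depth of $K$. A descendant mesh of $\mathcal T_0$ is the mesh of leaves after finitely many bisections starting from $\mathcal T_0$. **RefineAMP.** A hanging vertex of an element $K$ of a current mesh $\mathcal T$ is a vertex $z\in\mathcal V(\mathcal T)$ with $z\in\partial K\setminus\mathcal V(K)$. $\mathtt{RefineAMP}(\mathcal T,\mathcal M)$, for a conformingly marked AMP mesh $\mathcal T$ and $\mathcal M\subseteq\mathcal T$: batch zero bisects all elements of $\mathcal M$; then, as long as some elements of the current mesh have hanging vertices, the next batch simultaneously bisects all of them; return the resulting mesh. (Known: calls terminate with a conformingly marked mesh.) **Macro-generation.** $\mathcal U_q$ is the mesh obtained by bisecting uniformly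 $3q$ times every element of $\mathcal T_0$ (conformingly marked and unflagged). The geometric edges occurring in the uniform refinement tree are partitioned into the sets $\mathcal E(\mathcal U_q)$, $q\ge0$; $\operatorname{mgen}(e)=q$ iff $e\in\mathcal E(\mathcal U_q)$. **Causal forest.** Fix one call. Every bisection performed is an event (identified with the tetrahedron bisected); the events of batch zero are the roots. For every non-root event, bisecting $K$, there exist an edge $e\in\mathcal E(K)$ such that $\operatorname{mid}(e)$ is a hanging vertex of $K$ immediately before the event, and an earlier event of the same call that bisected exactly the geometric edge $e$ (i.e. whose tetrahedron $K'$ has $e(K')=e$), creating $\operatorname{mid}(e)$. Choose one such earlier event for each non-root event and call it the parent. The resulting directed graph is a causal forest of the call, and a causal chain is a directed path in it. For a causal chain with event tetrahedra $K_0,\dots,K_J$, put $q_j=\operatorname{mgen}(e(K_j))$; a *horizontal block* is a maximal consecutive subsequence $K_r,\dots,K_s$ with $q_r=q_{r+1}=\cdots=q_s$. *)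

theory Defs
  imports "HOL-Analysis.Analysis"
begin

(* Vertices, edges, faces and tetrahedra are encoded by their vertex sets; the
   geometric object is the convex hull of that set.  The definitions of edges and
   faces apply both to tetrahedra and (edges) to triangles. *)

type_synonym point = "real^3"

definition edges :: "point set \<Rightarrow> point set set" where
  "edges X = {e. e \<subseteq> X \<and> card e = 2}"

definition faces :: "point set \<Rightarrow> point set set" where
  "faces X = {F. F \<subseteq> X \<and> card F = 3}"

definition tetrahedron :: "point set \<Rightarrow> bool" where
  "tetrahedron X \<longleftrightarrow> card X = 4 \<and> \<not> affine_dependent X"

definition mid :: "point set \<Rightarrow> point" where
  "mid e = (THE m. \<exists>a b. e = {a, b} \<and> m = midpoint a b)"

lemma mid_pair: "mid {a, b} = midpoint a b"
  unfolding mid_def by (rule the_equality) (auto simp: doubleton_eq_iff midpoint_sym)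


record mtet =
  verts :: "point set"
  redge :: "point set"
  fmark :: "point set \<Rightarrow> point set"
  flag :: bool

definition body :: "mtet \<Rightarrow> point set" where
  "body K = convex hull (verts K)"

definition marks_coplanar :: "mtet \<Rightarrow> bool" where
  "marks_coplanar K \<longleftrightarrow> coplanar (\<Union>F\<in>faces (verts K). fmark K F)"

definition type_Pu :: "mtet \<Rightarrow> bool" where
  "type_Pu K \<longleftrightarrow> marks_coplanar K \<and> \<not> flag K"

definition type_Pf :: "mtet \<Rightarrow> bool" where
  "type_Pf K \<longleftrightarrow> marks_coplanar K \<and> flag K"

(* fmark is extensional (undefined off the faces), so that equality of records is
   equality of marked tetrahedra. *)
definition marked_tet :: "mtet \<Rightarrow> bool" where
  "marked_tet K \<longleftrightarrow>
     tetrahedron (verts K) \<and>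
     redge K \<in> edges (verts K) \<and>
     fmark K \<in> (\<Pi>\<^sub>E F\<in>faces (verts K). edges F) \<and>
     (\<forall>F\<in>faces (verts K). redge K \<subseteq> F \<longrightarrow> fmark K F = redge K) \<and>
     (flag K \<longrightarrow> marks_coplanar K)"

definition nonref_faces :: "mtet \<Rightarrow> point set set" where
  "nonref_faces K = {F \<in> faces (verts K). \<not> redge K \<subseteq> F}"

(* The child of K keeping the endpoint v of the refinement edge; the other endpoint
   is replaced by m.  Its inherited face is V - {m}.  A face of the child through m
   is a cut face iff it contains v; otherwise it is the new face.  In type Pf the
   marks of the two nonrefinement faces (the refinement edges of the two children)
   intersect in exactly {w}, so the mark of the new face is {m, w}. *)
definition child :: "mtet \<Rightarrow> point \<Rightarrow> mtet" where
  "child K v =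
     (let m = mid (redge K);
          V = insert m (verts K - (redge K - {v}))
      in \<lparr> verts = V,
           redge = fmark K (V - {m}),
           fmark = (\<lambda>F\<in>faces V.
             if m \<notin> F then fmark K F
             else if v \<in> F then F - {m}
             else if type_Pf K then insert m (\<Inter>F'\<in>nonref_faces K. fmark K F')
             else F - {m}),
           flag = type_Pu K \<rparr>)"

definition children :: "mtet \<Rightarrow> mtet set" where
  "children K = child K ` redge K"


definition polyhedral_domain :: "point set \<Rightarrow> bool" where
  "polyhedral_domain \<Omega> \<longleftrightarrow>
     open \<Omega> \<and> connected \<Omega> \<and> \<Omega> \<noteq> {} \<and>
     (\<exists>\<P>. finite \<P> \<and> (\<forall>P\<in>\<P>. polytope P) \<and> closure \<Omega> = \<Union>\<P>)"

definition AMP_mesh :: "point set \<Rightarrow> mtet set \<Rightarrow> bool" where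
  "AMP_mesh \<Omega> \<T> \<longleftrightarrow>
     finite \<T> \<and> (\<forall>K\<in>\<T>. marked_tet K) \<and>
     (\<forall>K\<in>\<T>. \<forall>L\<in>\<T>. K \<noteq> L \<longrightarrow> interior (body K) \<inter> interior (body L) = {}) \<and>
     (\<Union>K\<in>\<T>. body K) = closure \<Omega>"

definition mesh_verts :: "mtet set \<Rightarrow> point set" where
  "mesh_verts \<T> = (\<Union>K\<in>\<T>. verts K)"

definition mesh_edges :: "mtet set \<Rightarrow> point set set" where
  "mesh_edges \<T> = (\<Union>K\<in>\<T>. edges (verts K))"

definition conforming :: "mtet set \<Rightarrow> bool" where
  "conforming \<T> \<longleftrightarrow> (\<forall>K\<in>\<T>. \<forall>L\<in>\<T>. K \<noteq> L \<longrightarrow>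
     body K \<inter> body L = {} \<or>
     (\<exists>z \<in> verts K \<inter> verts L. body K \<inter> body L = {z}) \<or>
     (\<exists>e \<in> edges (verts K) \<inter> edges (verts L). body K \<inter> body L = convex hull e) \<or>
     (\<exists>F \<in> faces (verts K) \<inter> faces (verts L). body K \<inter> body L = convex hull F))"

definition conformingly_marked :: "mtet set \<Rightarrow> bool" where
  "conformingly_marked \<T> \<longleftrightarrow> conforming \<T> \<and>
     (\<forall>K\<in>\<T>. \<forall>L\<in>\<T>. \<forall>F \<in> faces (verts K) \<inter> faces (verts L). fmark K F = fmark L F)"

definition initial_AMP_mesh :: "point set \<Rightarrow> mtet set \<Rightarrow> bool" where
  "initial_AMP_mesh \<Omega> \<T> \<longleftrightarrow>
     AMP_mesh \<Omega> \<T> \<and> conformingly_marked \<T> \<and> (\<forall>K\<in>\<T>. \<not> flag K)"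

definition bisect :: "mtet set \<Rightarrow> mtet set \<Rightarrow> mtet set" where
  "bisect \<T> \<S> = (\<T> - \<S>) \<union> (\<Union>K\<in>\<S>. children K)"

inductive descendant_mesh :: "mtet set \<Rightarrow> mtet set \<Rightarrow> bool" for \<T>\<^sub>0 where
  initial: "descendant_mesh \<T>\<^sub>0 \<T>\<^sub>0"
| step: "descendant_mesh \<T>\<^sub>0 \<T> \<Longrightarrow> K \<in> \<T> \<Longrightarrow> descendant_mesh \<T>\<^sub>0 (bisect \<T> {K})"


definition hanging :: "mtet set \<Rightarrow> mtet \<Rightarrow> point set" where
  "hanging \<T> K = {z \<in> mesh_verts \<T>. z \<in> frontier (body K) - verts K}"

definition pending :: "mtet set \<Rightarrow> mtet set" where
  "pending \<T> = {K \<in> \<T>. hanging \<T> K \<noteq> {}}"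

(* run \<T> \<M> n is the mesh of the call RefineAMP(\<T>, \<M>) just before batch n.  It is
   stationary, with empty batches, once no hanging vertices are left. *)
primrec run :: "mtet set \<Rightarrow> mtet set \<Rightarrow> nat \<Rightarrow> mtet set" where
  "run \<T> \<M> 0 = \<T>"
| "run \<T> \<M> (Suc n) =
     bisect (run \<T> \<M> n) (if n = 0 then \<M> else pending (run \<T> \<M> n))"

definition batch :: "mtet set \<Rightarrow> mtet set \<Rightarrow> nat \<Rightarrow> mtet set" where
  "batch \<T> \<M> n = (if n = 0 then \<M> else pending (run \<T> \<M> n))"


definition uniform_mesh :: "mtet set \<Rightarrow> nat \<Rightarrow> mtet set" where
  "uniform_mesh \<T>\<^sub>0 q = ((\<lambda>\<T>. bisect \<T> \<T>) ^^ (3 * q)) \<T>\<^sub>0"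

definition mgen :: "mtet set \<Rightarrow> point set \<Rightarrow> nat" where
  "mgen \<T>\<^sub>0 e = (THE q. e \<in> mesh_edges (uniform_mesh \<T>\<^sub>0 q))"

definition macro_valence :: "mtet set \<Rightarrow> enat" where
  "macro_valence \<T>\<^sub>0 =
     (SUP q. SUP z\<in>mesh_verts (uniform_mesh \<T>\<^sub>0 q).
        enat (card {K \<in> uniform_mesh \<T>\<^sub>0 q. z \<in> verts K}))"


definition events :: "mtet set \<Rightarrow> mtet set \<Rightarrow> mtet set" where
  "events \<T> \<M> = (\<Union>n. batch \<T> \<M> n)"

definition nonroot_events :: "mtet set \<Rightarrow> mtet set \<Rightarrow> mtet set" where
  "nonroot_events \<T> \<M> = (\<Union>n\<in>{1..}. batch \<T> \<M> n)"

definition admissible_parent :: "mtet set \<Rightarrow> mtet set \<Rightarrow> mtet \<Rightarrow> mtet \<Rightarrow> bool" where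
  "admissible_parent \<T> \<M> K' K \<longleftrightarrow>
     (\<exists>n i. \<exists>e\<in>edges (verts K).
        1 \<le> n \<and> K \<in> batch \<T> \<M> n \<and> mid e \<in> hanging (run \<T> \<M> n) K \<and>
        i < n \<and> K' \<in> batch \<T> \<M> i \<and> redge K' = e)"

(* A forest is given by its arcs, directed from parent to child. *)
definition causal_forest :: "mtet set \<Rightarrow> mtet set \<Rightarrow> (mtet \<times> mtet) set \<Rightarrow> bool" where
  "causal_forest \<T> \<M> G \<longleftrightarrow>
     (\<exists>par. (\<forall>K\<in>nonroot_events \<T> \<M>. admissible_parent \<T> \<M> (par K) K) \<and>
            G = {(par K, K) | K. K \<in> nonroot_events \<T> \<M>})"

definition causal_chain :: "mtet set \<Rightarrow> mtet set \<Rightarrow> (mtet \<times> mtet) set \<Rightarrow> mtet list \<Rightarrow> bool" where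
  "causal_chain \<T> \<M> G Ks \<longleftrightarrow>
     Ks \<noteq> [] \<and> set Ks \<subseteq> events \<T> \<M> \<and>
     (\<forall>j. Suc j < length Ks \<longrightarrow> (Ks ! j, Ks ! Suc j) \<in> G)"

(* The block consists of the entries with indices r, ..., s (0-based, inclusive). *)
definition horizontal_block :: "mtet set \<Rightarrow> mtet list \<Rightarrow> nat \<Rightarrow> nat \<Rightarrow> bool" where
  "horizontal_block \<T>\<^sub>0 Ks r s \<longleftrightarrow>
     (let q = (\<lambda>j. mgen \<T>\<^sub>0 (redge (Ks ! j))) in
       r \<le> s \<and> s < length Ks \<and> (\<forall>j\<in>{r..s}. q j = q r) \<and>
       (r = 0 \<or> q (r - 1) \<noteq> q r) \<and>
       (Suc s = length Ks \<or> q (Suc s) \<noteq> q r))"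

end

theory Submission
  imports Defs
begin

text \<open>
  Call the elements of the uniform meshes \<open>U\<^sub>q\<close> macros.  Three bisections of a macro \<open>P\<close> cut only
  edges of \<open>P\<close> and leave each great-grandchild \<open>A\<close> exactly one vertex of \<open>P\<close>, its old vertex.
  The refinement edge of \<open>A\<close> and the marks of the faces of \<open>A\<close> at the old vertex contain that
  vertex, and the mark of the opposite face contains the midpoint of the refinement edge of \<open>P\<close>.

  All edges bisected in a horizontal block belong to one \<open>U\<^sub>q\<close>.  Let \<open>q > 2\<close>.  If such an edge
  contains a vertex \<open>o\<close> of the previous mesh \<open>U\<^sub>q\<^sub>-\<^sub>1\<close>, so do all later ones.  As long as the edges
  contain no vertex of \<open>U\<^sub>q\<^sub>-\<^sub>1\<close>, each is either the same as the one before or contains the midpoint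
  of the refinement edge of a parent macro; this refinement edge contains the old vertex \<open>o'\<close> of
  the parent, which does not change along the chain.  So every event of the block lies in a macro
  at an endpoint of the first edge, in a macro at \<open>o\<close>, or in a child macro of one at \<open>o'\<close>: at most
  \<open>7 (\<nu> + \<nu> + 8 \<nu>) = 70 \<nu>\<close> events.  For \<open>q \<le> 2\<close> there are at most \<open>7 \<cdot> 8\<^sup>q #T\<^sub>0 \<le> 448 #T\<^sub>0\<close> events
  in all.

  Conformity of \<open>U\<^sub>q\<close> enters as injectivity of the realisation map on barycentric coordinates:
  the coordinates in \<open>U\<^sub>q\<^sub>+\<^sub>1\<close> arise from those in \<open>U\<^sub>q\<close> by edge cuts whose effective part depends
  only on the marks of the carrier.
\<close>

section \<open>Barycentric coordinates\<close>

text \<open>A causal arc says only that the edge cut by one event is an edge of the next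
  tetrahedron. To follow a fixed vertex along a chain, an edge must be recovered from its midpoint
  even when consecutive events lie in different macros: in U_q distinct edges need distinct
  midpoints, and no midpoint may be a vertex of another element. This is where conformity is needed.
  Both facts are immediate once \<open>pt\<close> is injective, and injectivity passes from U_q to
  the next mesh by comparing cuts of coordinate vectors, without intersecting convex hulls.
  Agreement of marks is carried along because the mark of a shared face decides how both neighbours
  cut it. The factor 7 = 1 + 2 + 4 counts a macro, its children and its grandchildren, all of which
  have an edge of the macro as refinement edge; the count 70 \<nu> lies below 630 \<nu>. Tetrahedra
  may be counted instead of positions in a block, because an element once bisected never returns in
  the same call. Finiteness of \<nu> rests on the cycle of types: up to one halving per macro step,
  the edge vectors come from a finite stock fixed by the initial mesh.\<close>

definition supp :: "(point \<Rightarrow> real) \<Rightarrow> point set" where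
  "supp u = {v. u v \<noteq> 0}"

text \<open>Coordinate vectors are total functions that vanish off S, so those of different
  tetrahedra can be compared by plain equality.\<close>

definition coords :: "point set \<Rightarrow> (point \<Rightarrow> real) set" where
  "coords S = {u. (\<forall>v. 0 \<le> u v) \<and> supp u \<subseteq> S \<and> sum u S = 1}"

text \<open>Summing over the support instead of a vertex set makes this one map for all tetrahedra;
  its injectivity across elements is then meaningful.\<close>

definition pt :: "(point \<Rightarrow> real) \<Rightarrow> point" where
  "pt u = (\<Sum>v\<in>supp u. u v *\<^sub>R v)"

text \<open>The barycentric coordinates of a point after the bisection of \<open>e\<close>, given those before it.\<close>

definition bcut :: "point set \<Rightarrow> (point \<Rightarrow> real) \<Rightarrow> point \<Rightarrow> real" where
  "bcut e u = (\<lambda>v. if v \<in> e then u v - Min (u ` e)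
                  else if v = mid e then u v + 2 * Min (u ` e) else u v)"

lemma pt_sum:
  assumes "finite S" "supp u \<subseteq> S"
  shows "pt u = (\<Sum>v\<in>S. u v *\<^sub>R v)"
  unfolding pt_def using assms by (intro sum.mono_neutral_left) (auto simp: supp_def)

lemma coordsD:
  assumes "u \<in> coords S"
  shows "0 \<le> u v" "supp u \<subseteq> S" "sum u S = 1" "v \<notin> S \<Longrightarrow> u v = 0"
  using assms by (auto simp: coords_def supp_def)

lemma coords_mono:
  assumes "S \<subseteq> S'" "finite S'"
  shows "coords S \<subseteq> coords S'"
proof
  fix u assume u: "u \<in> coords S"
  have "sum u S' = sum u S"
    using assms coordsD(4)[OF u] by (intro sum.mono_neutral_right) auto
  then show "u \<in> coords S'"
    using u assms by (auto simp: coords_def)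
qed

lemma inj_on_pt_coords:
  assumes "finite S" "\<not> affine_dependent S"
  shows "inj_on pt (coords S)"
proof (rule inj_onI)
  fix u w assume u: "u \<in> coords S" and w: "w \<in> coords S" and eq: "pt u = pt w"
  have "(\<Sum>v\<in>S. (u v - w v) *\<^sub>R v) = 0"
    using eq coordsD(2)[OF u] coordsD(2)[OF w] assms(1)
    by (simp add: pt_sum scaleR_left_diff_distrib sum_subtractf)
  moreover have "(\<Sum>v\<in>S. u v - w v) = 0"
    using coordsD(3)[OF u] coordsD(3)[OF w] by (simp add: sum_subtractf)
  ultimately have "\<forall>v\<in>S. u v - w v = 0"
    using assms unfolding affine_dependent_explicit_finite[OF assms(1)]
    by (smt (verit) sum.cong)
  then show "u = w"
    using coordsD(4)[OF u] coordsD(4)[OF w] by (intro ext) (metis eq_iff_diff_eq_0)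
qed

lemma body_coords:
  assumes "finite S"
  shows "convex hull S = pt ` coords S"
proof -
  have "x \<in> convex hull S \<longleftrightarrow> x \<in> pt ` coords S" for x
  proof
    assume "x \<in> convex hull S"
    then obtain u where u: "\<forall>v\<in>S. 0 \<le> u v" "sum u S = 1" "(\<Sum>v\<in>S. u v *\<^sub>R v) = x"
      unfolding convex_hull_finite[OF assms] by auto
    define w where "w = (\<lambda>v. if v \<in> S then u v else 0)"
    have "w \<in> coords S"
      using u by (auto simp: coords_def supp_def w_def)
    moreover have "pt w = x"
      using u(3) assms coordsD(2)[OF \<open>w \<in> coords S\<close>] by (simp add: pt_sum w_def)
    with \<open>w \<in> coords S\<close> show "x \<in> pt ` coords S" by blast
  next
    assume "x \<in> pt ` coords S"
    then obtain u where u: "u \<in> coords S" "x = pt u" by auto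
    then show "x \<in> convex hull S"
      using coordsD[OF u(1)] assms unfolding convex_hull_finite[OF assms]
      by (auto simp: pt_sum)
  qed
  then show ?thesis by blast
qed

lemma bcut_pair:
  "bcut {a, b} u = (\<lambda>v. if v \<in> {a, b} then u v - min (u a) (u b)
     else if v = midpoint a b then u v + 2 * min (u a) (u b) else u v)"
  by (auto simp: bcut_def mid_pair fun_eq_iff)

lemma card2E:
  assumes "card e = 2" obtains a b where "e = {a, b}" "a \<noteq> b"
  using assms by (auto simp: card_2_iff)

text \<open>The minimum over an edge with an endpoint off the support is 0, so the cut moves
  nothing. Most cuts in the conformity proof are discarded in this way.\<close>

lemma bcut_eq_self:
  assumes "card e = 2" "\<And>v. 0 \<le> u v" "\<not> e \<subseteq> supp u"
  shows "bcut e u = u"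
proof -
  obtain a b where e: "e = {a, b}" using assms(1) by (rule card2E)
  have "u a = 0 \<or> u b = 0" using assms(3) by (auto simp: e supp_def)
  then have "min (u a) (u b) = 0" using assms(2)[of a] assms(2)[of b] by auto
  then show ?thesis by (auto simp: e bcut_pair fun_eq_iff)
qed

text \<open>The endpoint with the smaller coordinate is emptied.\<close>

lemma supp_bcut:
  assumes "card e = 2" "\<And>v. 0 \<le> u v"
  obtains x where "x \<in> e" "supp (bcut e u) \<subseteq> insert (mid e) (supp u - {x})"
proof -
  obtain a b where e: "e = {a, b}" "a \<noteq> b" using assms(1) by (rule card2E)
  show ?thesis
  proof (cases "u a \<le> u b")
    case True
    then show ?thesis using assms(2)[of a] e
      by (intro that[of a]) (auto simp: e bcut_pair supp_def mid_pair split: if_splits)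
  next
    case False
    then show ?thesis using assms(2)[of b] e
      by (intro that[of b]) (auto simp: e bcut_pair supp_def mid_pair split: if_splits)
  qed
qed

lemma bcut_nonneg:
  assumes "card e = 2" "\<And>v. 0 \<le> u v"
  shows "0 \<le> bcut e u v"
proof -
  obtain a b where e: "e = {a, b}" "a \<noteq> b" using assms(1) by (rule card2E)
  show ?thesis using assms(2)[of a] assms(2)[of b] assms(2)[of v] by (auto simp: e bcut_pair)
qed

lemma four_distinct:
  "card {a, b, c, d} = 4 \<longleftrightarrow> a \<noteq> b \<and> a \<noteq> c \<and> a \<noteq> d \<and> b \<noteq> c \<and> b \<noteq> d \<and> c \<noteq> d"
  by (auto simp: card_insert_if)

lemma eq_midpoint_iff: "a = midpoint a b \<longleftrightarrow> a = b" "b = midpoint a b \<longleftrightarrow> a = b"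
  for a b :: point
  by (metis midpoint_eq_endpoint)+

lemma midpoint_notin_tetrahedron:
  assumes "tetrahedron {a, b, c, d}"
  shows "midpoint a b \<notin> {a, b, c, d}"
proof -
  have ab: "a \<noteq> b" "a \<noteq> c" "a \<noteq> d" "b \<noteq> c" "b \<noteq> d" "c \<noteq> d"
    and ind: "\<not> affine_dependent {a, b, c, d}"
    using assms by (auto simp: tetrahedron_def four_distinct)
  have mem: "midpoint a b \<in> affine hull {a, b}"
    unfolding affine_hull_2 midpoint_def
    by (auto intro!: exI[of _ "1/2"] simp: scaleR_add_right)
  have "x \<noteq> midpoint a b" if "x \<in> {c, d}" for x
  proof
    assume x: "x = midpoint a b"
    have "x \<in> affine hull ({a, b, c, d} - {x})"
      using mem that ab x hull_mono[of "{a, b}" "{a, b, c, d} - {x}" affine] by auto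
    then show False using ind that unfolding affine_dependent_def by blast
  qed
  moreover have "midpoint a b \<noteq> a" "midpoint a b \<noteq> b" using ab by (metis midpoint_eq_endpoint(1,2))+
  ultimately show ?thesis by auto
qed

text \<open>Since b = 2 m - a for the midpoint m, the affine hull does not shrink, and four points
  of affine dimension 3 are independent.\<close>

lemma tetrahedron_halve:
  assumes "tetrahedron {a, b, c, d}"
  shows "tetrahedron {a, midpoint a b, c, d}"
proof -
  have card: "card {a, b, c, d} = 4" "\<not> affine_dependent {a, b, c, d}"
    using assms by (auto simp: tetrahedron_def)
  have m: "midpoint a b \<notin> {a, b, c, d}" by (rule midpoint_notin_tetrahedron[OF assms])
  then have card': "card {a, midpoint a b, c, d} = 4"
    using card(1) unfolding four_distinct by (auto simp: eq_midpoint_iff)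
  let ?S = "{a, midpoint a b, c, d}"
  have "b = (-1) *\<^sub>R a + 2 *\<^sub>R midpoint a b"
    by (simp add: midpoint_def scaleR_2)
  then have "b \<in> affine hull {a, midpoint a b}"
    unfolding affine_hull_2 by (intro CollectI exI[of _ "-1"] exI[of _ 2]) simp
  then have "b \<in> affine hull ?S" using hull_mono[of "{a, midpoint a b}" ?S affine] by auto
  then have "{a, b, c, d} \<subseteq> affine hull ?S" by (auto intro: hull_inc)
  then have "aff_dim {a, b, c, d} \<le> aff_dim ?S"
    by (metis aff_dim_affine_hull aff_dim_subset)
  moreover have "aff_dim {a, b, c, d} = 3"
    using card affine_independent_iff_card[of "{a, b, c, d}"] by simp
  moreover have "aff_dim ?S \<le> 3" using aff_dim_le_card[of ?S] card' by simp
  ultimately have "aff_dim ?S = int (card ?S) - 1" using card' by simp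
  then show ?thesis using card' affine_independent_iff_card[of ?S] by (simp add: tetrahedron_def)
qed

text \<open>Barycentric coordinates in the child of \<open>[a, b, c, d]\<close> that keeps \<open>a\<close> are those in the parent
  after the coordinate of \<open>b\<close>, which is then the smaller one, has been moved to the midpoint.\<close>

lemma coords_halve:
  assumes t: "tetrahedron {a, b, c, d}" and w: "w \<in> coords {a, midpoint a b, c, d}"
  obtains u where "u \<in> coords {a, b, c, d}" "pt u = pt w" "bcut {a, b} u = w"
    "(\<forall>v\<in>{a, midpoint a b, c, d}. 0 < w v) \<longrightarrow> (\<forall>v\<in>{a, b, c, d}. 0 < u v)"
proof -
  define m where "m = midpoint a b"
  have card: "a \<noteq> b" "a \<noteq> c" "a \<noteq> d" "b \<noteq> c" "b \<noteq> d" "c \<noteq> d"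
    using t by (auto simp: tetrahedron_def four_distinct)
  have m: "m \<noteq> a" "m \<noteq> b" "m \<noteq> c" "m \<noteq> d" using midpoint_notin_tetrahedron[OF t]
    by (auto simp: m_def)
  have w: "w \<in> coords {a, m, c, d}" using w by (simp add: m_def)
  have nn: "0 \<le> w v" for v using coordsD(1)[OF w] .
  have wb: "w b = 0" using coordsD(4)[OF w, of b] card m by auto
  have wz: "w v = 0" if "v \<notin> {a, m, c, d}" for v using coordsD(4)[OF w that] .
  \<comment> \<open>The weight of m is returned in equal halves to a and b. The minimum over the
    edge is then \<open>w m / 2\<close>, exactly what \<open>bcut\<close> takes away again.\<close>
  define u where "u = (\<lambda>v. if v = a then w a + w m / 2 else if v = b then w m / 2 else if v = m then 0 else w v)"
  have su: "supp u \<subseteq> {a, b, c, d}" using wz by (auto simp: supp_def u_def split: if_splits)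
  have sw: "supp w \<subseteq> {a, m, c, d}" using wz by (auto simp: supp_def)
  have "u \<in> coords {a, b, c, d}"
    using su nn coordsD(3)[OF w] card m by (auto simp: coords_def u_def)
  moreover have "pt u = pt w"
  proof -
    have "pt u = (w a + w m / 2) *\<^sub>R a + (w m / 2) *\<^sub>R b + w c *\<^sub>R c + w d *\<^sub>R d"
      using pt_sum[OF _ su] card m by (auto simp: u_def algebra_simps)
    also have "\<dots> = w a *\<^sub>R a + w m *\<^sub>R m + w c *\<^sub>R c + w d *\<^sub>R d"
      by (simp add: m_def midpoint_def algebra_simps)
    also have "\<dots> = pt w" using pt_sum[OF _ sw] card m by (auto simp: algebra_simps)
    finally show ?thesis .
  qed
  moreover have "bcut {a, b} u = w"
    using card m nn[of a] nn[of m] wb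
    by (auto simp: bcut_pair u_def fun_eq_iff m_def[symmetric])
  moreover have "(\<forall>v\<in>{a, m, c, d}. 0 < w v) \<longrightarrow> (\<forall>v\<in>{a, b, c, d}. 0 < u v)"
    using card m by (auto simp: u_def)
  ultimately show ?thesis by (intro that[of u]) (auto simp: m_def)
qed

lemma coords_edge:
  assumes "e \<in> edges S" "finite S"
  shows "(\<lambda>v. of_bool (v \<in> e) / 2) \<in> coords S" "pt (\<lambda>v. of_bool (v \<in> e) / 2) = mid e"
proof -
  obtain a b where ab: "e = {a, b}" "a \<noteq> b" "{a, b} \<subseteq> S" using assms(1)
    by (auto simp: edges_def card_2_iff)
  have s: "supp (\<lambda>v. of_bool (v \<in> e) / 2) = {a, b}" by (auto simp: supp_def ab)
  then have "(\<lambda>v. of_bool (v \<in> e) / 2) \<in> coords {a, b}" using ab by (auto simp: coords_def)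
  then show "(\<lambda>v. of_bool (v \<in> e) / 2) \<in> coords S" using coords_mono[OF ab(3) assms(2)] by blast
  show "pt (\<lambda>v. of_bool (v \<in> e) / 2) = mid e"
    unfolding pt_def s using ab by (simp add: mid_pair midpoint_def scaleR_right_distrib)
qed

lemma coords_vertex:
  assumes "v \<in> S" "finite S"
  shows "(\<lambda>x. of_bool (x = v)) \<in> coords S" "pt (\<lambda>x. of_bool (x = v)) = v"
proof -
  have "supp (\<lambda>x. of_bool (x = v) :: real) = {v}" by (auto simp: supp_def)
  then show "(\<lambda>x. of_bool (x = v)) \<in> coords S" "pt (\<lambda>x. of_bool (x = v)) = v"
    using coords_mono[of "{v}" S] assms by (auto simp: coords_def pt_def)
qed

text \<open>The coordinates of a midpoint are half the indicator function of its edge, so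
  injectivity of \<open>pt\<close> recovers the edge from the midpoint.\<close>

lemma mid_inj_on:
  assumes inj: "inj_on pt (\<Union>S\<in>\<S>. coords S)" and fin: "\<And>S. S \<in> \<S> \<Longrightarrow> finite S"
    and e: "e \<in> edges S" "S \<in> \<S>" "e' \<in> edges S'" "S' \<in> \<S>" "mid e = mid e'"
  shows "e = e'"
proof -
  have "(\<lambda>v. of_bool (v \<in> e) / 2 :: real) = (\<lambda>v. of_bool (v \<in> e') / 2)"
    using e fin coords_edge[of e S] coords_edge[of e' S'] by (intro inj_onD[OF inj]) auto
  then have "(of_bool (v \<in> e) :: real) = of_bool (v \<in> e')" for v
    by (metis divide_cancel_right zero_neq_numeral)
  then show ?thesis by (intro set_eqI) (simp only: of_bool_eq_iff)
qed

text \<open>A vertex has a coordinate equal to 1, whereas the coordinates of a midpoint only take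
  the values 0 and 1/2.\<close>

lemma mid_notin:
  assumes inj: "inj_on pt (\<Union>S\<in>\<S>. coords S)" and fin: "\<And>S. S \<in> \<S> \<Longrightarrow> finite S"
    and e: "e \<in> edges S" "S \<in> \<S>" "S' \<in> \<S>"
  shows "mid e \<notin> S'"
proof
  assume m: "mid e \<in> S'"
  have "(\<lambda>v. of_bool (v \<in> e) / 2 :: real) = (\<lambda>v. of_bool (v = mid e))"
    using e fin m coords_edge[of e S] coords_vertex[of "mid e" S'] by (intro inj_onD[OF inj]) auto
  then have "of_bool (mid e \<in> e) / 2 = (of_bool (mid e = mid e) :: real)" by (rule fun_cong)
  then show False by (cases "mid e \<in> e") auto
qed

section \<open>Marked tetrahedra in ordered form\<close>

text \<open>The refinement edge is listed first. The marking rules can then be read by position,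
  with the freedom to swap a with b and c with d.\<close>

definition tet4 :: "mtet \<Rightarrow> point \<Rightarrow> point \<Rightarrow> point \<Rightarrow> point \<Rightarrow> bool" where
  "tet4 K a b c d \<longleftrightarrow> verts K = {a, b, c, d} \<and> tetrahedron {a, b, c, d} \<and> redge K = {a, b}"

lemma tet4_card: "tet4 K a b c d \<Longrightarrow> card {a, b, c, d} = 4"
  by (simp add: tet4_def tetrahedron_def)

lemma tet4_distinct:
  "tet4 K a b c d \<Longrightarrow> a \<noteq> b \<and> a \<noteq> c \<and> a \<noteq> d \<and> b \<noteq> c \<and> b \<noteq> d \<and> c \<noteq> d"
  using tet4_card unfolding four_distinct .

lemma tet4_swap: "tet4 K a b c d \<longleftrightarrow> tet4 K b a c d" "tet4 K a b c d \<longleftrightarrow> tet4 K a b d c"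
  by (auto simp: tet4_def insert_commute)

lemma faces_four:
  assumes "card {a, b, c, d} = 4"
  shows "faces {a, b, c, d} = {{a, b, c}, {a, b, d}, {a, c, d}, {b, c, d}}"
proof -
  have d: "a \<noteq> b" "a \<noteq> c" "a \<noteq> d" "b \<noteq> c" "b \<noteq> d" "c \<noteq> d" using assms unfolding four_distinct
    by auto
  have iff: "F \<in> faces {a, b, c, d} \<longleftrightarrow> (\<exists>x\<in>{a, b, c, d}. F = {a, b, c, d} - {x})" for F
  proof
    assume F: "F \<in> faces {a, b, c, d}"
    then have sub: "F \<subseteq> {a, b, c, d}" "card F = 3" by (auto simp: faces_def)
    then have "card ({a, b, c, d} - F) = 1" using assms
      by (subst card_Diff_subset) (auto intro: finite_subset)
    then obtain x where "{a, b, c, d} - F = {x}" by (auto simp: card_1_singleton_iff)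
    then show "\<exists>x\<in>{a, b, c, d}. F = {a, b, c, d} - {x}" using sub by blast
  next
    assume "\<exists>x\<in>{a, b, c, d}. F = {a, b, c, d} - {x}"
    then obtain x where "x \<in> {a, b, c, d}" "F = {a, b, c, d} - {x}" by blast
    then show "F \<in> faces {a, b, c, d}" using assms card_Diff_singleton[of x "{a, b, c, d}"]
      by (simp only: faces_def) auto
  qed
  have eq: "faces {a, b, c, d} = (\<lambda>x. {a, b, c, d} - {x}) ` {a, b, c, d}"
    by (rule set_eqI) (simp only: iff image_iff)
  have "{a, b, c, d} - {a} = {b, c, d}" "{a, b, c, d} - {b} = {a, c, d}"
     "{a, b, c, d} - {c} = {a, b, d}" "{a, b, c, d} - {d} = {a, b, c}" using d by blast+
  then have "faces {a, b, c, d} = {{b, c, d}, {a, c, d}, {a, b, d}, {a, b, c}}"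
    unfolding eq by (simp only: image_insert image_empty)
  then show ?thesis by blast
qed

text \<open>The bisection rules by position. Only the child keeping a is treated; the other one
  follows by swapping a and b.\<close>

lemma child_tet4:
  assumes K: "tet4 K a b c d" and m: "m = midpoint a b"
  shows "verts (child K a) = {a, m, c, d}"
    and "tetrahedron {a, m, c, d}"
    and "redge (child K a) = fmark K {a, c, d}"
    and "fmark (child K a) {a, c, d} = fmark K {a, c, d}"
    and "fmark (child K a) {a, m, c} = {a, c}"
    and "fmark (child K a) {a, m, d} = {a, d}"
    and "fmark (child K a) {m, c, d} =
      (if type_Pf K then insert m (fmark K {a, c, d} \<inter> fmark K {b, c, d}) else {c, d})"
    and "flag (child K a) = type_Pu K"
proof -
  have d: "a \<noteq> b" "a \<noteq> c" "a \<noteq> d" "b \<noteq> c" "b \<noteq> d" "c \<noteq> d" using tet4_distinct[OF K] by auto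
  have t: "tetrahedron {a, b, c, d}" and v: "verts K = {a, b, c, d}" and r: "redge K = {a, b}"
    using K by (auto simp: tet4_def)
  have m': "m \<noteq> a" "m \<noteq> b" "m \<noteq> c" "m \<noteq> d" using midpoint_notin_tetrahedron[OF t] by (auto simp: m)
  show t': "tetrahedron {a, m, c, d}" using tetrahedron_halve[OF t] by (simp add: m)
  have V: "insert (mid (redge K)) (verts K - (redge K - {a})) = {a, m, c, d}"
    using d by (auto simp: v r mid_pair m)
  have md: "mid (redge K) = m" by (simp add: r mid_pair m)
  have Vm: "{a, m, c, d} - {m} = {a, c, d}" using m' by auto
  have nr: "nonref_faces K = {{a, c, d}, {b, c, d}}"
    using d unfolding nonref_faces_def v faces_four[OF tet4_card[OF K]] r by auto
  have f: "F \<in> faces {a, m, c, d}" if "F \<in> {{a, m, c}, {a, m, d}, {a, c, d}, {m, c, d}}" for F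
    using that t' faces_four[of a m c d] by (auto simp: tetrahedron_def)
  note ch = child_def[of K a, unfolded Let_def md V[unfolded md] Vm]
  show "verts (child K a) = {a, m, c, d}" "redge (child K a) = fmark K {a, c, d}"
    "flag (child K a) = type_Pu K"
    by (simp_all add: ch)
  show "fmark (child K a) {a, c, d} = fmark K {a, c, d}" using f m' by (simp add: ch)
  have "{a, m, c} - {m} = {a, c}" using m' by auto
  then show "fmark (child K a) {a, m, c} = {a, c}" using f m' by (simp add: ch)
  have "{a, m, d} - {m} = {a, d}" using m' by auto
  then show "fmark (child K a) {a, m, d} = {a, d}" using f m' by (simp add: ch)
  have "{m, c, d} - {m} = {c, d}" using m' by auto
  then show "fmark (child K a) {m, c, d} =
      (if type_Pf K then insert m (fmark K {a, c, d} \<inter> fmark K {b, c, d}) else {c, d})"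
    using f m' d by (simp add: ch nr)
qed

lemma coplanar_card_3:
  assumes "card S = 3" "T \<subseteq> S"
  shows "coplanar (T :: point set)"
proof -
  obtain x y z where "S = {x, y, z}" using assms(1) by (auto simp: card_3_iff)
  then show ?thesis using assms(2) hull_subset[of S affine] unfolding coplanar_def by blast
qed

lemma not_coplanar_tetrahedron:
  assumes "tetrahedron S" shows "\<not> coplanar S"
proof
  assume "coplanar S"
  then obtain u v w where "S \<subseteq> affine hull {u, v, w}" unfolding coplanar_def by blast
  then have "aff_dim S \<le> aff_dim {u, v, w}" by (metis aff_dim_affine_hull aff_dim_subset)
  also have "\<dots> \<le> int (card {u, v, w}) - 1" by (rule aff_dim_le_card) simp
  also have "\<dots> \<le> 2" using card_insert_le_m1[of 3 "{v, w}" u] card_insert_le_m1[of 2 "{w}" v] by simp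
  finally show False using assms affine_independent_iff_card[of S]
    by (auto simp: tetrahedron_def intro: card_ge_0_finite)
qed

text \<open>Types \<open>P\<^sub>u\<close>, \<open>P\<^sub>f\<close> and \<open>A\<close> in ordered form.  In type \<open>A\<close> the refinement edge joins the ends of the
  path \<open>w\<^sub>0 w\<^sub>1 w\<^sub>2 w\<^sub>3\<close>.\<close>

definition P_form :: "bool \<Rightarrow> mtet \<Rightarrow> point \<Rightarrow> point \<Rightarrow> point \<Rightarrow> point \<Rightarrow> bool" where
  "P_form f K a b c d \<longleftrightarrow> tet4 K a b c d \<and> fmark K {a, b, c} = {a, b} \<and> fmark K {a, b, d} = {a, b} \<and>
     fmark K {a, c, d} = {a, c} \<and> fmark K {b, c, d} = {b, c} \<and> flag K = f"

definition A_form :: "mtet \<Rightarrow> point \<Rightarrow> point \<Rightarrow> point \<Rightarrow> point \<Rightarrow> bool" where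
  "A_form K w0 w1 w2 w3 \<longleftrightarrow> tet4 K w0 w3 w1 w2 \<and>
     fmark K {w0, w3, w1} = {w0, w3} \<and> fmark K {w0, w3, w2} = {w0, w3} \<and>
     fmark K {w0, w1, w2} = {w0, w2} \<and> fmark K {w3, w1, w2} = {w3, w1} \<and> \<not> flag K"

text \<open>An arbitrary unflagged marked tetrahedron: the nonrefinement faces may carry any of
  their edges, which admits types M and O. These occur only in the initial mesh, since every later
  macro has type Pu or A.\<close>

definition U_form :: "mtet \<Rightarrow> point \<Rightarrow> point \<Rightarrow> point \<Rightarrow> point \<Rightarrow> bool" where
  "U_form K a b c d \<longleftrightarrow> tet4 K a b c d \<and> fmark K {a, b, c} = {a, b} \<and> fmark K {a, b, d} = {a, b} \<and>
     fmark K {a, c, d} \<in> {{a, c}, {a, d}, {c, d}} \<and> fmark K {b, c, d} \<in> {{b, c}, {b, d}, {c, d}}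
       \<and> \<not> flag K"

lemma form_tet4:
  "P_form f K a b c d \<Longrightarrow> tet4 K a b c d"
  "A_form K w0 w1 w2 w3 \<Longrightarrow> tet4 K w0 w3 w1 w2"
  "U_form K a b c d \<Longrightarrow> tet4 K a b c d"
  unfolding P_form_def A_form_def U_form_def by iprover+

lemma P_form_swap: "P_form f K a b c d \<longleftrightarrow> P_form f K b a c d"
  by (auto simp: P_form_def tet4_swap insert_commute)

lemma A_form_rev: "A_form K w0 w1 w2 w3 \<longleftrightarrow> A_form K w3 w2 w1 w0"
  by (auto simp: A_form_def tet4_swap insert_commute)

lemma U_form_swap: "U_form K a b c d \<longleftrightarrow> U_form K b a c d" "U_form K a b c d \<longleftrightarrow> U_form K a b d c"
  by (auto simp: U_form_def tet4_swap insert_commute)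

lemma P_form_U: "P_form False K a b c d \<Longrightarrow> U_form K a b c d"
  by (auto simp: P_form_def U_form_def)

lemma A_form_U: "A_form K w0 w1 w2 w3 \<Longrightarrow> U_form K w0 w3 w1 w2"
  by (auto simp: A_form_def U_form_def insert_commute)

lemma marks_union:
  assumes "tet4 K a b c d"
  shows "(\<Union>F\<in>faces (verts K). fmark K F) =
    fmark K {a, b, c} \<union> fmark K {a, b, d} \<union> fmark K {a, c, d} \<union> fmark K {b, c, d}"
proof -
  have "faces (verts K) = {{a, b, c}, {a, b, d}, {a, c, d}, {b, c, d}}"
    using assms faces_four[OF tet4_card[OF assms]] by (simp add: tet4_def)
  then show ?thesis by (simp add: Un_assoc)
qed

lemma marks_coplanar_P:
  assumes "P_form f K a b c d" shows "marks_coplanar K"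
proof -
  have t: "tet4 K a b c d" using assms by (rule form_tet4)
  have "card {a, b, c} = 3" using tet4_distinct[OF t] by auto
  moreover have "(\<Union>F\<in>faces (verts K). fmark K F) \<subseteq> {a, b, c}"
    unfolding marks_union[OF t] using assms by (auto simp: P_form_def)
  ultimately show ?thesis unfolding marks_coplanar_def by (rule coplanar_card_3)
qed

text \<open>The marks together contain all four vertices of a nondegenerate tetrahedron.\<close>

lemma marks_coplanar_A:
  assumes "A_form K w0 w1 w2 w3" shows "\<not> marks_coplanar K"
proof -
  have t: "tet4 K w0 w3 w1 w2" using assms by (rule form_tet4)
  have "(\<Union>F\<in>faces (verts K). fmark K F) = {w0, w3, w1, w2}"
    unfolding marks_union[OF t] using assms by (auto simp: A_form_def)
  then show ?thesis using t not_coplanar_tetrahedron unfolding marks_coplanar_def tet4_def by metis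
qed

lemma P_form_flag: "P_form f K a b c d \<Longrightarrow> flag K = f"
  by (simp add: P_form_def)

text \<open>One step of the cycle Pu, Pf, A, Pu of types. All marks of the child lie in the
  inherited face {a, c, d}, and the new midpoint goes to the last position.\<close>

lemma child_Pu:
  assumes "P_form False K a b c d"
  shows "P_form True (child K a) a c d (midpoint a b)"
proof -
  have t: "tet4 K a b c d" using assms by (rule form_tet4)
  have "type_Pu K" "\<not> type_Pf K"
    using marks_coplanar_P[OF assms] P_form_flag[OF assms] by (auto simp: type_Pu_def type_Pf_def)
  then show ?thesis
    using child_tet4[OF t refl] assms by (simp add: P_form_def tet4_def insert_commute)
qed

text \<open>The exceptional mark {m, c} of the new face, caused by the flag, is what takes the marks
  out of a common plane and gives type A, with path a, m, d, c.\<close>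

lemma child_Pf:
  assumes "P_form True K a b c d"
  shows "A_form (child K a) a (midpoint a b) d c"
proof -
  have t: "tet4 K a b c d" using assms by (rule form_tet4)
  have "type_Pf K" "\<not> type_Pu K"
    using marks_coplanar_P[OF assms] P_form_flag[OF assms] by (auto simp: type_Pu_def type_Pf_def)
  moreover have "{a, c} \<inter> {b, c} = {c}" using tet4_distinct[OF t] by auto
  ultimately show ?thesis
    using child_tet4[OF t refl] assms by (simp add: P_form_def A_form_def tet4_def insert_commute)
qed

lemma child_A:
  assumes "A_form K w0 w1 w2 w3"
  shows "P_form False (child K w0) w0 w2 w1 (midpoint w0 w3)"
proof -
  have t: "tet4 K w0 w3 w1 w2" using assms by (rule form_tet4)
  have "\<not> type_Pf K" "\<not> type_Pu K"
    using marks_coplanar_A[OF assms] by (auto simp: type_Pu_def type_Pf_def)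
  then show ?thesis
    using child_tet4[OF t refl] assms by (simp add: P_form_def A_form_def tet4_def insert_commute)
qed

text \<open>Coplanar marks cannot contain all four vertices, so they miss c or d; this fixes type
  Pu. Otherwise neither exception of the marking rules applies: the new face and the cut faces are
  marked opposite the new midpoint, so all marks of each child lie in its inherited face and the
  child has type Pu.\<close>

lemma U_form_cases:
  assumes U: "U_form K a b c d"
  obtains (P) c' d' where "{c', d'} = {c, d}" "P_form False K a b c' d'"
  | (nP) "\<And>x o'. {x, o'} = {a, b} \<Longrightarrow>
      \<exists>p q r. {p, q, r} = {x, c, d} \<and> P_form False (child K x) p q r (midpoint a b)"
proof (cases "marks_coplanar K")
  case True
  have t: "tet4 K a b c d" using U by (rule form_tet4)
  have "(\<Union>F\<in>faces (verts K). fmark K F) \<noteq> {a, b, c, d}"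
    using t not_coplanar_tetrahedron True unfolding marks_coplanar_def tet4_def by metis
  then consider "c \<notin> (\<Union>F\<in>faces (verts K). fmark K F)" | "d \<notin> (\<Union>F\<in>faces (verts K). fmark K F)"
    using U unfolding marks_union[OF t] by (auto simp: U_form_def)
  then show ?thesis
  proof cases
    case 1
    then have "P_form False K a b d c"
      using U unfolding marks_union[OF t]
        by (auto simp: U_form_def P_form_def tet4_swap insert_commute)
    then show ?thesis using P[of d c] by auto
  next
    case 2
    then have "P_form False K a b c d"
      using U unfolding marks_union[OF t]
        by (auto simp: U_form_def P_form_def tet4_swap insert_commute)
    then show ?thesis using P[of c d] by auto
  qed
next
  case False
  have *: "\<exists>p q r. {p, q, r} = {x, c, d} \<and> P_form False (child K x) p q r (midpoint x y)"
    if U: "U_form K x y c d" for x y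
  proof -
    have t: "tet4 K x y c d" using U by (rule form_tet4)
    have "\<not> type_Pf K" "\<not> type_Pu K" using False by (auto simp: type_Pu_def type_Pf_def)
    note ch = child_tet4[OF t refl, unfolded \<open>(\<not> type_Pf K)\<close>[THEN if_not_P]]
    have *: "P_form False (child K x) p q r (midpoint x y)"
      if "{p, q, r} = {x, c, d}" "fmark K {x, c, d} = {p, q}"
         "(p, q, r) \<in> {(x, c, d), (x, d, c), (c, d, x)}" for p q r
      using that ch \<open>\<not> type_Pu K\<close> by (auto simp: P_form_def tet4_def insert_commute)
    have "fmark K {x, c, d} \<in> {{x, c}, {x, d}, {c, d}}" using U unfolding U_form_def by iprover
    then consider "fmark K {x, c, d} = {x, c}" | "fmark K {x, c, d} = {x, d}"
      | "fmark K {x, c, d} = {c, d}" by blast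
    then show ?thesis
    proof cases
      case 1 then show ?thesis using *[of x c d] by blast
    next
      case 2 then show ?thesis using *[of x d c] by blast
    next
      case 3 then show ?thesis using *[of c d x] by blast
    qed
  qed
  show ?thesis
  proof (rule nP)
    fix x o' assume "{x, o'} = {a, b}"
    then consider "x = a" "o' = b" | "x = b" "o' = a" by (auto simp: doubleton_eq_iff)
    then show "\<exists>p q r. {p, q, r} = {x, c, d} \<and> P_form False (child K x) p q r (midpoint a b)"
      using *[OF U] *[of b a] U by cases (auto simp: U_form_swap midpoint_sym)
  qed
qed

lemma marked_U_form:
  assumes "marked_tet K" "\<not> flag K"
  obtains a b c d where "U_form K a b c d"
proof -
  have K: "tetrahedron (verts K)" "redge K \<in> edges (verts K)"
    "fmark K \<in> (\<Pi>\<^sub>E F\<in>faces (verts K). edges F)"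
    "\<And>F. F\<in>faces (verts K) \<Longrightarrow> redge K \<subseteq> F \<Longrightarrow> fmark K F = redge K" using assms
      by (auto simp: marked_tet_def)
  have fin: "finite (verts K)" using K(1) by (auto simp: tetrahedron_def intro: card_ge_0_finite)
  obtain a b where ab: "redge K = {a, b}" "a \<noteq> b" "{a, b} \<subseteq> verts K"
    using K(2) by (auto simp: edges_def card_2_iff)
  have "card (verts K - {a, b}) = 2"
    using K(1) ab fin by (subst card_Diff_subset) (auto simp: tetrahedron_def)
  then obtain c d where cd: "verts K - {a, b} = {c, d}" "c \<noteq> d" by (auto simp: card_2_iff)
  have v: "verts K = {a, b, c, d}" using cd ab by auto
  have t: "tet4 K a b c d" using K v ab by (auto simp: tet4_def)
  have dist: "a \<noteq> b" "a \<noteq> c" "a \<noteq> d" "b \<noteq> c" "b \<noteq> d" "c \<noteq> d" using tet4_distinct[OF t] by auto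
  note F = faces_four[OF tet4_card[OF t]]
  have ed: "e \<in> edges {x, y, z} \<Longrightarrow> e \<in> {{x, y}, {x, z}, {y, z}}" for e :: "point set"
    and x y z :: point
    by (auto simp: edges_def card_2_iff)
  have "fmark K {a, c, d} \<in> edges {a, c, d}" "fmark K {b, c, d} \<in> edges {b, c, d}"
    using PiE_mem[OF K(3)] unfolding v F by auto
  then have "U_form K a b c d"
    using t K(4) assms(2) ed unfolding U_form_def v F ab by auto
  then show ?thesis by (rule that)
qed

section \<open>Three successive bisections of a macro\<close>

lemma mid_inj:
  assumes "tetrahedron S" "e \<in> edges S" "e' \<in> edges S" "mid e = mid e'"
  shows "e = e'"
proof (rule mid_inj_on[of "{S}"])
  have fin: "finite S" using assms(1) by (auto simp: tetrahedron_def intro: card_ge_0_finite)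
  show "inj_on pt (\<Union> (coords ` {S}))"
    using inj_on_pt_coords[OF fin] assms(1) by (simp add: tetrahedron_def)
  show "finite S'" if "S' \<in> {S}" for S' using fin that by simp
qed (use assms in auto)

text \<open>The part of the marking conditions common to all forms. It holds throughout the
  bisection tree, whatever the type and the flag.\<close>

definition node :: "mtet \<Rightarrow> bool" where
  "node K \<longleftrightarrow> (\<exists>a b c d. tet4 K a b c d \<and> fmark K {a, b, c} = {a, b} \<and> fmark K {a, b, d} = {a, b})"

lemma form_node:
  "P_form f K a b c d \<Longrightarrow> node K"
  "A_form K w0 w1 w2 w3 \<Longrightarrow> node K"
  "U_form K a b c d \<Longrightarrow> node K"
  unfolding node_def P_form_def A_form_def U_form_def by iprover+

lemma node_tet4:
  assumes "node K" obtains a b c d where "tet4 K a b c d"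
  using assms unfolding node_def by blast

lemma node_tet4_at:
  assumes "node K" "x \<in> redge K" obtains b c d where "tet4 K x b c d"
proof -
  obtain a b c d where t: "tet4 K a b c d" using assms(1) by (rule node_tet4)
  then have "x = a \<or> x = b" using assms(2) by (auto simp: tet4_def)
  then show ?thesis using that t tet4_swap(1) by blast
qed

lemma node_tetrahedron: "node K \<Longrightarrow> tetrahedron (verts K)" "node K \<Longrightarrow> finite (verts K)"
  and node_card: "node K \<Longrightarrow> card (verts K) = 4" "node K \<Longrightarrow> card (redge K) = 2"
  and node_redge: "node K \<Longrightarrow> redge K \<in> edges (verts K)" "node K \<Longrightarrow> redge K \<subseteq> verts K"
proof -
  assume "node K"
  then obtain a b c d where t: "tet4 K a b c d" by (rule node_tet4)
  have "a \<noteq> b" using tet4_distinct[OF t] by simp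
  then show "tetrahedron (verts K)" "finite (verts K)" "card (verts K) = 4" "card (redge K) = 2"
    "redge K \<in> edges (verts K)" "redge K \<subseteq> verts K"
    using t tet4_card[OF t] by (auto simp: tet4_def edges_def)
qed

lemma mid_notin_verts:
  assumes "tetrahedron S" "e \<in> edges S" shows "mid e \<notin> S"
proof (rule mid_notin[of "{S}"])
  have fin: "finite S" using assms(1) by (auto simp: tetrahedron_def intro: card_ge_0_finite)
  show "inj_on pt (\<Union> (coords ` {S}))"
    using inj_on_pt_coords[OF fin] assms(1) by (simp add: tetrahedron_def)
  show "finite S'" if "S' \<in> {S}" for S' using fin that by simp
qed (use assms in auto)

lemma node_face_mark:
  assumes "node K" "F \<in> faces (verts K)" "redge K \<subseteq> F"
  shows "fmark K F = redge K"
proof -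
  obtain a b c d where t: "tet4 K a b c d" and m: "fmark K {a, b, c} = {a, b}"
    "fmark K {a, b, d} = {a, b}"
    using assms(1) unfolding node_def by blast
  have v: "verts K = {a, b, c, d}" "redge K = {a, b}" using t by (auto simp: tet4_def)
  have "F \<in> {{a, b, c}, {a, b, d}, {a, c, d}, {b, c, d}}"
    using assms(2) unfolding v faces_four[OF tet4_card[OF t]] .
  then show ?thesis using assms(3) m tet4_distinct[OF t] unfolding v by auto
qed

text \<open>A face of K that survives in the child does not contain the new midpoint and so falls
  under the inheritance rule.\<close>

lemma node_child_inherit:
  assumes "node K" "x \<in> redge K" "F \<in> faces (verts K)" "F \<subseteq> verts (child K x)"
  shows "F \<in> faces (verts (child K x))" "fmark (child K x) F = fmark K F"
proof -
  show *: "F \<in> faces (verts (child K x))" using assms(3,4) by (auto simp: faces_def)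
  have "mid (redge K) \<notin> verts K"
    using mid_notin_verts node_tetrahedron(1) node_redge(1) assms(1) by blast
  then have "mid (redge K) \<notin> F" using assms(3) by (auto simp: faces_def)
  then show "fmark (child K x) F = fmark K F" using * by (simp add: child_def Let_def)
qed

definition macro :: "mtet \<Rightarrow> bool" where
  "macro K \<longleftrightarrow> (\<exists>a b c d. U_form K a b c d)"

lemma macro_node: "macro K \<Longrightarrow> node K"
  using form_node(3) unfolding macro_def by blast

text \<open>The points x, y, z are the endpoints kept in three successive bisections; they address
  one great-grandchild of P.\<close>

definition descent :: "mtet \<Rightarrow> point \<Rightarrow> point \<Rightarrow> point \<Rightarrow> bool" where
  "descent P x y z \<longleftrightarrow> x \<in> redge P \<and> y \<in> redge (child P x) \<and> z \<in> redge (child (child P x) y)"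

abbreviation child3 :: "mtet \<Rightarrow> point \<Rightarrow> point \<Rightarrow> point \<Rightarrow> mtet" where
  "child3 P x y z \<equiv> child (child (child P x) y) z"

lemma form_redge:
  "P_form f K a b c d \<Longrightarrow> redge K = {a, b}"
  "A_form K w0 w1 w2 w3 \<Longrightarrow> redge K = {w0, w3}"
  "U_form K a b c d \<Longrightarrow> redge K = {a, b}"
  using form_tet4 unfolding tet4_def by metis+

lemma form_verts:
  "P_form f K a b c d \<Longrightarrow> verts K = {a, b, c, d}"
  "A_form K w0 w1 w2 w3 \<Longrightarrow> verts K = {w0, w3, w1, w2}"
  "U_form K a b c d \<Longrightarrow> verts K = {a, b, c, d}"
  using form_tet4 unfolding tet4_def by metis+

text \<open>The cut edges are {a, b}, {x, c} and {y, d}. The two vertex orders for the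
  great-grandchild come from reading the path of the intermediate type A tetrahedron from either
  end.\<close>

lemma descent_Pu:
  assumes P: "P_form False P a b c d" and descent: "descent P x y z"
  defines "m \<equiv> midpoint a b" and "m2 \<equiv> midpoint x c" and "m3 \<equiv> midpoint y d"
  shows "x \<in> {a, b}" "y \<in> {x, c}"
    "P_form True (child P x) x c d m" "node (child (child P x) y)"
      "redge (child (child P x) y) = {y, d}"
    "z = y \<and> P_form False (child3 P x y z) y m m2 m3 \<or> z = d
      \<and> P_form False (child3 P x y z) d m2 m m3"
proof -
  show x: "x \<in> {a, b}" using descent form_redge(1)[OF P] by (auto simp: descent_def)
  then consider "x = a" | "x = b" by blast
  then show K1: "P_form True (child P x) x c d m"
  proof cases
    case 1 then show ?thesis using child_Pu[OF P] by (simp add: m_def)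
  next
    case 2 then show ?thesis using child_Pu[OF P[unfolded P_form_swap[of _ _ a]]]
      by (simp add: m_def midpoint_sym)
  qed
  show y: "y \<in> {x, c}" using descent form_redge(1)[OF K1] by (auto simp: descent_def)
  then consider "y = x" | "y = c" by blast
  then have K2: "A_form (child (child P x) y) y m2 m d"
  proof cases
    case 1 then show ?thesis using child_Pf[OF K1] by (simp add: m2_def)
  next
    case 2 then show ?thesis using child_Pf[OF K1[unfolded P_form_swap[of _ _ x]]]
      by (simp add: m2_def midpoint_sym)
  qed
  show "node (child (child P x) y)" "redge (child (child P x) y) = {y, d}"
    using form_node(2)[OF K2] form_redge(2)[OF K2] by auto
  have "z \<in> {y, d}" using descent form_redge(2)[OF K2] by (auto simp: descent_def)
  then consider "z = y" | "z = d" by blast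
  then show "z = y \<and> P_form False (child3 P x y z) y m m2 m3 \<or> z = d
    \<and> P_form False (child3 P x y z) d m2 m m3"
  proof cases
    case 1 then show ?thesis using child_A[OF K2] by (simp add: m3_def)
  next
    case 2 then show ?thesis using child_A[OF K2[unfolded A_form_rev[of _ y]]]
      by (simp add: m3_def midpoint_sym)
  qed
qed

text \<open>This serves every macro that is not of type Pu. Its child already has type Pu, so the
  cycle of types is shifted by one step and the third generation has type A.\<close>

lemma descent_A:
  assumes K1: "P_form False (child P x) p q r m" and descent: "descent P x y z"
  defines "m2 \<equiv> midpoint p q" and "m3 \<equiv> midpoint y r"
  shows "y \<in> {p, q}" "P_form True (child (child P x) y) y r m m2" "z \<in> {y, r}"
    "A_form (child3 P x y z) z m3 m2 m"
proof -
  show y: "y \<in> {p, q}" using descent form_redge(1)[OF K1] by (auto simp: descent_def)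
  then consider "y = p" | "y = q" by blast
  then show K2: "P_form True (child (child P x) y) y r m m2"
  proof cases
    case 1 then show ?thesis using child_Pu[OF K1] by (simp add: m2_def)
  next
    case 2 then show ?thesis using child_Pu[OF K1[unfolded P_form_swap[of _ _ p]]]
      by (simp add: m2_def midpoint_sym)
  qed
  show z: "z \<in> {y, r}" using descent form_redge(1)[OF K2] by (auto simp: descent_def)
  then consider "z = y" | "z = r" by blast
  then show "A_form (child3 P x y z) z m3 m2 m"
  proof cases
    case 1 then show ?thesis using child_Pf[OF K2] by (simp add: m3_def)
  next
    case 2 then show ?thesis using child_Pf[OF K2[unfolded P_form_swap[of _ _ y]]]
      by (simp add: m3_def midpoint_sym)
  qed
qed

lemma descent_cases:
  assumes mac: "macro P" and descent: "descent P x y z"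
  obtains (P) a b c d m m2 m3 where "P_form False P a b c d" "x \<in> {a, b}" "y \<in> {x, c}"
    "m = midpoint a b" "m2 = midpoint x c" "m3 = midpoint y d"
    "P_form True (child P x) x c d m" "node (child (child P x) y)"
      "redge (child (child P x) y) = {y, d}"
    "z = y \<and> P_form False (child3 P x y z) y m m2 m3 \<or> z = d
      \<and> P_form False (child3 P x y z) d m2 m m3"
  | (A) o' c d p q r m m2 m3 where "U_form P x o' c d" "{p, q, r} = {x, c, d}" "y \<in> {p, q}"
    "z \<in> {y, r}"
    "m = midpoint x o'" "m2 = midpoint p q" "m3 = midpoint y r"
    "P_form False (child P x) p q r m" "P_form True (child (child P x) y) y r m m2"
    "A_form (child3 P x y z) z m3 m2 m"
proof -
  obtain a b c d where U: "U_form P a b c d" using mac unfolding macro_def by blast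
  show ?thesis
  proof (cases rule: U_form_cases[OF U])
    case (1 c' d')
    show ?thesis using descent_Pu[OF 1(2) descent] 1(2) by (intro P) auto
  next
    case 2
    have "x \<in> {a, b}" using descent form_redge(3)[OF U] by (auto simp: descent_def)
    then obtain o' where xo: "{x, o'} = {a, b}" "U_form P x o' c d"
      using U U_form_swap(1) by blast
    obtain p q r where pqr: "{p, q, r} = {x, c, d}" "P_form False (child P x) p q r (midpoint a b)"
      using 2[OF xo(1)] by blast
    moreover have "midpoint a b = midpoint x o'" using xo(1) by (metis mid_pair)
    ultimately show ?thesis using descent_A[OF pqr(2) descent] xo by (intro A[OF xo(2) pqr(1)]) auto
  qed
qed

lemma descent_redge:
  assumes mac: "macro P" and descent: "descent P x y z"
  shows "node (child P x)" "node (child (child P x) y)" "macro (child3 P x y z)"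
    "redge (child P x) \<in> edges (verts P)" "redge (child (child P x) y) \<in> edges (verts P)"
proof -
  have "node (child P x) \<and> node (child (child P x) y) \<and> macro (child3 P x y z) \<and>
    redge (child P x) \<subseteq> verts P \<and> redge (child (child P x) y) \<subseteq> verts P"
  proof (cases rule: descent_cases[OF mac descent])
    case (1 a b c d m m2 m3)
    have "macro (child3 P x y z)" using 1(10) P_form_U unfolding macro_def by blast
    then show ?thesis using 1 form_node(1)[OF 1(7)] form_redge(1)[OF 1(7)] form_verts(1)[OF 1(1)]
      by auto
  next
    case (2 o' c d p q r m m2 m3)
    have "macro (child3 P x y z)" using A_form_U[OF 2(10)] unfolding macro_def by blast
    moreover have "{p, q, r} \<subseteq> verts P" using form_verts(3)[OF 2(1)] 2(2) by auto
    ultimately show ?thesis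
      using 2(3) form_node(1)[OF 2(8)] form_node(1)[OF 2(9)] form_redge(1)[OF 2(8)]
      form_redge(1)[OF 2(9)]
      by auto
  qed
  then show "node (child P x)" "node (child (child P x) y)" "macro (child3 P x y z)"
    "redge (child P x) \<in> edges (verts P)" "redge (child (child P x) y) \<in> edges (verts P)"
    using node_card(2) by (auto simp: edges_def)
qed

lemma tet4_faces:
  assumes "tet4 K a b c d"
  shows "faces (verts K) = {{a, b, c}, {a, b, d}, {a, c, d}, {b, c, d}}"
proof -
  have "verts K = {a, b, c, d}" using assms by (simp add: tet4_def)
  then show ?thesis using faces_four[OF tet4_card[OF assms]] by (simp only:)
qed

lemma form_faces:
  "P_form f K a b c d \<Longrightarrow> faces (verts K) = {{a, b, c}, {a, b, d}, {a, c, d}, {b, c, d}}"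
  "A_form K w0 w1 w2 w3 \<Longrightarrow>
    faces (verts K) = {{w0, w3, w1}, {w0, w3, w2}, {w0, w1, w2}, {w3, w1, w2}}"
  "U_form K a b c d \<Longrightarrow> faces (verts K) = {{a, b, c}, {a, b, d}, {a, c, d}, {b, c, d}}"
  by (rule tet4_faces, erule form_tet4)+

lemma form_distinct:
  "P_form f K a b c d \<Longrightarrow> a \<noteq> b \<and> a \<noteq> c \<and> a \<noteq> d \<and> b \<noteq> c \<and> b \<noteq> d \<and> c \<noteq> d"
  "A_form K w0 w1 w2 w3 \<Longrightarrow> w0 \<noteq> w1 \<and> w0 \<noteq> w2 \<and> w0 \<noteq> w3 \<and> w1 \<noteq> w2 \<and> w1 \<noteq> w3 \<and> w2 \<noteq> w3"
  "U_form K a b c d \<Longrightarrow> a \<noteq> b \<and> a \<noteq> c \<and> a \<noteq> d \<and> b \<noteq> c \<and> b \<noteq> d \<and> c \<noteq> d"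
  using tet4_distinct[OF form_tet4(1)] tet4_distinct[OF form_tet4(2)] tet4_distinct[OF form_tet4(3)]
    by blast+

lemma form_fmark:
  "P_form f K a b c d \<Longrightarrow> fmark K {a, b, c} = {a, b} \<and> fmark K {a, b, d} = {a, b}
    \<and> fmark K {a, c, d} = {a, c} \<and> fmark K {b, c, d} = {b, c}"
  "A_form K w0 w1 w2 w3 \<Longrightarrow> fmark K {w0, w3, w1} = {w0, w3} \<and> fmark K {w0, w3, w2} = {w0, w3} \<and>
     fmark K {w0, w1, w2} = {w0, w2} \<and> fmark K {w3, w1, w2} = {w3, w1}"
  unfolding P_form_def A_form_def by iprover+

text \<open>Read off the normal forms. The mark of the face opposite z is {n1, n2} when P has type
  Pu and {n1, n3} otherwise; n1 is what these have in common.\<close>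

lemma descent_old_vertex:
  assumes mac: "macro P" and descent: "descent P x y z"
  defines "n1 \<equiv> mid (redge P)" and "n2 \<equiv> mid (redge (child P x))"
    and "n3 \<equiv> mid (redge (child (child P x) y))"
  obtains "z \<in> verts P" "verts (child3 P x y z) = {z, n1, n2, n3}" "z \<in> redge (child3 P x y z)"
    "\<And>F. F \<in> faces (verts (child3 P x y z)) \<Longrightarrow> z \<in> F \<Longrightarrow> z \<in> fmark (child3 P x y z) F"
    "n1 \<in> fmark (child3 P x y z) {n1, n2, n3}"
proof (cases rule: descent_cases[OF mac descent])
  case (1 a b c d m m2 m3)
  have n: "n1 = m" "n2 = m2" "n3 = m3"
    using form_redge(1)[OF 1(1)] form_redge(1)[OF 1(7)] 1
      by (simp_all add: n1_def n2_def n3_def mid_pair)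
  have v: "verts P = {a, b, c, d}" using form_verts(1)[OF 1(1)] .
  from 1(10) show ?thesis
  proof
    assume K: "z = y \<and> P_form False (child3 P x y z) y m m2 m3"
    note K' = K[THEN conjunct2]
    show ?thesis
      by (rule that; use K 1(2,3) form_verts(1)[OF K'] form_redge(1)[OF K'] form_faces(1)[OF K']
        form_distinct(1)[OF K'] form_fmark(1)[OF K'] in \<open>auto simp: n v\<close>)
  next
    assume K: "z = d \<and> P_form False (child3 P x y z) d m2 m m3"
    note K' = K[THEN conjunct2]
    show ?thesis
      by (rule that; use K 1(2,3) form_verts(1)[OF K'] form_redge(1)[OF K'] form_faces(1)[OF K']
        form_distinct(1)[OF K'] form_fmark(1)[OF K'] in \<open>auto simp: n v insert_commute\<close>)
  qed
next
  case (2 o' c d p q r m m2 m3)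
  note K' = 2(10)
  have n: "n1 = m" "n2 = m2" "n3 = m3"
    using form_redge(3)[OF 2(1)] form_redge(1)[OF 2(8)] form_redge(1)[OF 2(9)] 2(5-7)
      by (simp_all add: n1_def n2_def n3_def mid_pair)
  have "{p, q, r} \<subseteq> verts P" using form_verts(3)[OF 2(1)] 2(2) by auto
  then have z: "z \<in> verts P" using 2(3,4) by auto
  have f: "{m, m2, m3} = {m, m3, m2}" by auto
  show ?thesis
    by (rule that; use z form_verts(2)[OF K'] form_redge(2)[OF K'] form_faces(2)[OF K']
      form_distinct(2)[OF K'] form_fmark(2)[OF K'] in \<open>auto simp: n f\<close>)
qed

section \<open>Marks on the faces of great-grandchildren\<close>

lemma edge_pair: "a \<noteq> b \<Longrightarrow> {a, b} \<subseteq> S \<Longrightarrow> {a, b} \<in> edges S"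
  by (auto simp: edges_def)

text \<open>The common shape of the faces through the old vertex z. The map \<open>car\<close> sends
  an old vertex to its singleton and a midpoint to its edge, so the union over F is the set of old
  vertices needed to span F.\<close>

lemma face_mark_carrier_aux:
  assumes "car z = {z}" "z \<in> V" "e1 \<subseteq> V" "e2 \<subseteq> V" "mid e1 \<notin> V" "mid e2 \<notin> V"
    "car (mid e1) = e1" "car (mid e2) = e2" "F = {z, mid e1, mid e2}"
    and "f F = {z, mid e1}"
      and "insert z (e1 \<union> e2) = V \<or> insert z (e1 \<union> e2) \<in> faces V \<and> g (insert z (e1 \<union> e2)) = e1"
  shows "(\<Union>v\<in>F. car v) \<subseteq> V \<and> ((\<Union>v\<in>F. car v) = V \<or>
     (\<Union>v\<in>F. car v) \<in> faces V \<and> V \<inter> F = {z} \<and> f F = {z, mid (g (\<Union>v\<in>F. car v))})"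
proof -
  have "(\<Union>v\<in>F. car v) = insert z (e1 \<union> e2)" using assms by simp
  moreover have "V \<inter> F = {z}" using assms by auto
  ultimately show ?thesis using assms by auto
qed

lemma node_superset:
  assumes K: "node K" and S: "redge K \<subseteq> S" "\<not> S \<subseteq> redge K" "S \<subseteq> verts K"
  shows "S = verts K \<or> S \<in> faces (verts K) \<and> fmark K S = redge K"
proof -
  have fin: "finite S" using S(3) node_tetrahedron(2)[OF K] by (rule finite_subset)
  have "2 < card S" using psubset_card_mono[OF fin, of "redge K"] S(1,2) node_card(2)[OF K] by simp
  moreover have "card S \<le> 4" using card_mono[OF node_tetrahedron(2)[OF K] S(3)] node_card(1)[OF K]
    by simp
  ultimately consider "card S = 3" | "card S = card (verts K)" using node_card(1)[OF K] by linarith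
  then show ?thesis
  proof cases
    case 1 then show ?thesis using node_face_mark[OF K, of S] S by (auto simp: faces_def)
  next
    case 2 then show ?thesis using card_subset_eq[OF node_tetrahedron(2)[OF K] S(3)] by simp
  qed
qed

text \<open>A face not spanned by all of P lies in a face of P, and its mark is computed from the
  mark of that face and z alone. This is what makes macros sharing the coarse face produce the same
  fine marks.\<close>

lemma face_mark_carrier:
  assumes mac: "macro P" and descent: "descent P x y z"
    and car: "\<And>v. v \<in> verts P \<Longrightarrow> car v = {v}" "\<And>e. e \<in> edges (verts P) \<Longrightarrow> car (mid e) = e"
    and F: "F \<in> faces (verts (child3 P x y z))"
  shows "(\<Union>v\<in>F. car v) \<subseteq> verts P \<and> ((\<Union>v\<in>F. car v) = verts P \<or>
     (\<Union>v\<in>F. car v) \<in> faces (verts P) \<and> verts P \<inter> F = {z} \<and>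
       fmark (child3 P x y z) F = {z, mid (fmark P (\<Union>v\<in>F. car v))})"
proof -
  have tet: "tetrahedron (verts P)" using macro_node[OF mac] node_tetrahedron(1) by blast
  show ?thesis
  proof (cases rule: descent_cases[OF mac descent])
    case (1 a b c d m m2 m3)
    have v: "verts P = {a, b, c, d}" using form_verts(1)[OF 1(1)] .
    have dist: "a \<noteq> b" "a \<noteq> c" "a \<noteq> d" "b \<noteq> c" "b \<noteq> d" "c \<noteq> d" using form_distinct(1)[OF 1(1)]
      by auto
    have mids: "mid {a, b} = m" "mid {x, c} = m2" "mid {y, d} = m3" using 1
      by (simp_all add: mid_pair)
    have e: "{a, b} \<in> edges (verts P)" "{x, c} \<in> edges (verts P)" "{y, d} \<in> edges (verts P)"
      using 1(2,3) dist v by (auto intro!: edge_pair)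
    have cm: "car m = {a, b}" "car m2 = {x, c}" "car m3 = {y, d}"
      using car(2)[OF e(1)] car(2)[OF e(2)] car(2)[OF e(3)] mids by auto
    have nm: "m \<notin> verts P" "m2 \<notin> verts P" "m3 \<notin> verts P"
      using mid_notin_verts[OF tet e(1)] mid_notin_verts[OF tet e(2)] mid_notin_verts[OF tet
        e(3)] mids by auto
    have cy: "car y = {y}" "car d = {d}" "y \<in> verts P" "d \<in> verts P" using car(1) 1(2,3) v by auto
    note aux = face_mark_carrier_aux[where V = "verts P" and g = "fmark P" and F = F
      and f = "fmark (child3 P x y z)" and car = car]
    \<comment> \<open>The face opposite the old vertex meets all three cut edges, which together
      contain every vertex of P.\<close>
    have full: "\<Union> (car ` {m, m2, m3}) = verts P" using 1(2,3) by (auto simp: cm v)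
    have r: "redge P = {a, b}" using form_redge(1)[OF 1(1)] .
    note super = node_superset[OF macro_node[OF mac], unfolded r]
    have xcd: "{x, c, d} \<in> faces (verts P)" "fmark P {x, c, d} = {x, c}"
      using 1(2) form_fmark(1)[OF 1(1)] form_faces(1)[OF 1(1)] by blast+
    have su: "\<not> insert y ({a, b} \<union> {x, c}) \<subseteq> {a, b}" "\<not> insert y ({a, b} \<union> {y, d}) \<subseteq> {a, b}"
       "\<not> insert d ({a, b} \<union> {y, d}) \<subseteq> {a, b}"
      using dist by blast+
    have sb: "insert y ({a, b} \<union> {x, c}) \<subseteq> verts P"
       "insert y ({a, b} \<union> {y, d}) \<subseteq> verts P" "insert d ({a, b} \<union> {y, d}) \<subseteq> verts P"
      using 1(2,3) unfolding v by blast+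
    have eqs: "insert y ({x, c} \<union> {y, d}) = {x, c, d}" "insert d ({x, c} \<union> {y, d}) = {x, c, d}"
      "insert d ({x, c} \<union> {a, b}) = verts P"
      using 1(2,3) unfolding v by blast+
    note g = super[OF _ su(1) sb(1)] super[OF _ su(2) sb(2)] super[OF _ su(3) sb(3)]
    show ?thesis
      using 1(10)
    proof
      assume K: "z = y \<and> P_form False (child3 P x y z) y m m2 m3"
      note K' = K[THEN conjunct2]
      have "F \<in> {{y, m, m2}, {y, m, m3}, {y, m2, m3}, {m, m2, m3}}" using F form_faces(1)[OF K']
        by simp
      then consider "F = {y, m, m2}" | "F = {y, m, m3}" | "F = {y, m2, m3}" | "F = {m, m2, m3}"
        by blast
      then show ?thesis
      proof cases
        case 4 then show ?thesis using full by simp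
      next
        case c: 1 show ?thesis using aux[of y "{a, b}"
          "{x, c}"] cm cy nm e g xcd form_fmark(1)[OF K'] c K unfolding mids eqs
          by (simp add: edges_def)
      next
        case c: 2 show ?thesis using aux[of y "{a, b}"
          "{y, d}"] cm cy nm e g xcd form_fmark(1)[OF K'] c K unfolding mids eqs
          by (simp add: edges_def)
      next
        case c: 3 show ?thesis using aux[of y "{x, c}"
          "{y, d}"] cm cy nm e g xcd form_fmark(1)[OF K'] c K unfolding mids eqs
          by (simp add: edges_def)
      qed
    next
      assume K: "z = d \<and> P_form False (child3 P x y z) d m2 m m3"
      note K' = K[THEN conjunct2]
      have "F \<in> {{d, m2, m}, {d, m2, m3}, {d, m, m3}, {m2, m, m3}}" using F form_faces(1)[OF K']
        by simp
      then consider "F = {d, m2, m}" | "F = {d, m2, m3}" | "F = {d, m, m3}" | "F = {m2, m, m3}"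
        by blast
      then show ?thesis
      proof cases
        case 4 then show ?thesis using full by (simp add: insert_commute Un_commute Un_left_commute)
      next
        case c: 1 show ?thesis using aux[of d "{x, c}"
          "{a, b}"] cm cy nm e g xcd form_fmark(1)[OF K'] c K unfolding mids eqs
          by (simp add: edges_def)
      next
        case c: 2 show ?thesis using aux[of d "{x, c}"
          "{y, d}"] cm cy nm e g xcd form_fmark(1)[OF K'] c K unfolding mids eqs
          by (simp add: edges_def)
      next
        case c: 3 show ?thesis using aux[of d "{a, b}"
          "{y, d}"] cm cy nm e g xcd form_fmark(1)[OF K'] c K unfolding mids eqs
          by (simp add: edges_def)
      qed
    qed
  next
    case (2 o' c d p q r m m2 m3)
    have v: "verts P = {x, o', c, d}" using form_verts(3)[OF 2(1)] .
    have dist: "x \<noteq> o'" "x \<noteq> c" "x \<noteq> d" "o' \<noteq> c" "o' \<noteq> d" "c \<noteq> d" using form_distinct(3)[OF 2(1)]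
      by auto
    have sub: "{p, q, r} \<subseteq> verts P" using 2(2) v by auto
    have pqr: "p \<noteq> q" "p \<noteq> r" "q \<noteq> r" using form_distinct(1)[OF 2(8)] by auto
    have mids: "mid {x, o'} = m" "mid {p, q} = m2" "mid {y, r} = m3" using 2
      by (simp_all add: mid_pair)
    have e: "{x, o'} \<in> edges (verts P)" "{p, q} \<in> edges (verts P)" "{y, r} \<in> edges (verts P)"
      using 2(3) dist pqr sub v by (auto intro!: edge_pair)
    have cm: "car m = {x, o'}" "car m2 = {p, q}" "car m3 = {y, r}"
      using car(2)[OF e(1)] car(2)[OF e(2)] car(2)[OF e(3)] mids by auto
    have nm: "m \<notin> verts P" "m2 \<notin> verts P" "m3 \<notin> verts P"
      using mid_notin_verts[OF tet e(1)] mid_notin_verts[OF tet e(2)] mid_notin_verts[OF tet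
        e(3)] mids by auto
    have cz: "z \<in> verts P" "car z = {z}" using car(1)[of z] 2(3,4) sub by auto
    note aux = face_mark_carrier_aux[where V = "verts P" and g = "fmark P" and F = F
      and f = "fmark (child3 P x y z)" and car = car]
    have "{x, c, d} \<union> {x, o'} = verts P" by (auto simp: v)
    moreover have u: "{p, q} \<union> {y, r} = {x, c, d}" using 2(2,3) by auto
    ultimately have full: "\<Union> (car ` {m, m2, m3}) = verts P" by (auto simp: cm)
    note face = node_superset[OF macro_node[OF mac], unfolded form_redge(3)[OF 2(1)]]
    have fP: "{x, c, d} \<in> faces (verts P)" using form_faces(3)[OF 2(1)] by simp
    moreover have "{x, c, d} \<subseteq> verts (child P x)" using 2(2) form_verts(1)[OF 2(8)] by auto
    ultimately have "fmark P {x, c, d} = fmark (child P x) {p, q, r}"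
      using node_child_inherit(2)[OF macro_node[OF mac], of x "{x, c, d}"] descent 2(2)
        by (simp add: descent_def)
    then have fm: "fmark P {x, c, d} = {p, q}" using form_fmark(1)[OF 2(8)] by simp
    have zu: "insert z ({p, q} \<union> {y, r}) = {x, c, d}" using u 2(4) by auto
    have onot: "o' \<notin> {p, q, r}" unfolding 2(2) using dist by blast
    have st: "\<not> insert z ({x, o'} \<union> {p, q}) \<subseteq> {x, o'}" "\<not> insert z ({x, o'} \<union> {y, r}) \<subseteq> {x, o'}"
      using onot pqr 2(3) by auto
    note K' = 2(10)
    have "F \<in> {{z, m, m3}, {z, m, m2}, {z, m3, m2}, {m, m3, m2}}" using F form_faces(2)[OF K']
      by simp
    then consider "F = {z, m, m3}" | "F = {z, m, m2}" | "F = {z, m2, m3}" | "F = {m, m2, m3}"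
      by (auto simp: insert_commute)
    then show ?thesis
    proof cases
      case 4 then show ?thesis using full by simp
    next
      case c: 1
      have sub: "insert z ({x, o'} \<union> {y, r}) \<subseteq> verts P" using cz e by (auto simp: edges_def)
      then show ?thesis using aux[of z "{x, o'}"
        "{y, r}"] cm cz nm e face[OF _ st(2) sub] form_fmark(2)[OF K'] c unfolding mids
        by (simp add: edges_def)
    next
      case c: 2
      have sub: "insert z ({x, o'} \<union> {p, q}) \<subseteq> verts P" using cz e by (auto simp: edges_def)
      then show ?thesis using aux[of z "{x, o'}"
        "{p, q}"] cm cz nm e face[OF _ st(1) sub] form_fmark(2)[OF K'] c unfolding mids
        by (simp add: edges_def)
    next
      case c: 3
      have "{z, m3, m2} = {z, m2, m3}" by auto
      then show ?thesis using aux[of z "{p, q}" "{y, r}"] cm cz nm e fP fm form_fmark(2)[OF K'] c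
        unfolding mids zu by (simp add: edges_def)
    qed
  qed
qed

text \<open>A formula in F alone, independent of the descent, so great-grandchildren of the same P
  agree on a common face. \<open>N2\<close> and \<open>N3\<close> collect the possible second and
  third midpoints over all choices of x and y.\<close>

lemma face_mark_Pu:
  assumes P: "P_form False P a b c d" and descent: "descent P x y z"
    and F: "F \<in> faces (verts (child3 P x y z))"
  defines "m \<equiv> mid {a, b}" and "N2 \<equiv> {mid {a, c}, mid {b, c}}"
    and "N3 \<equiv> {mid {a, d}, mid {b, d}, mid {c, d}}"
  shows "fmark (child3 P x y z) F = (if F \<inter> N3 \<noteq> {} then F - N3 else if d \<in> F then F - {m} else F - N2)"
proof -
  note pth = descent_Pu[OF P descent, folded mid_pair]
  have v: "verts P = {a, b, c, d}" using form_verts(1)[OF P] .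
  have tet: "tetrahedron (verts P)" using form_node(1)[OF P] node_tetrahedron(1) by blast
  have dist: "a \<noteq> b" "a \<noteq> c" "a \<noteq> d" "b \<noteq> c" "b \<noteq> d" "c \<noteq> d" using form_distinct(1)[OF P] by auto
  have e: "{a, b} \<in> edges (verts P)" "{a, c} \<in> edges (verts P)" "{b, c} \<in> edges (verts P)"
    "{a, d} \<in> edges (verts P)" "{b, d} \<in> edges (verts P)" "{c, d} \<in> edges (verts P)"
    using dist v by (auto intro!: edge_pair)
  have nv: "m \<notin> verts P" "N2 \<inter> verts P = {}" "N3 \<inter> verts P = {}"
    using e mid_notin_verts[OF tet] unfolding m_def N2_def N3_def by blast+
  have ne: "mid f \<noteq> mid g" if "f \<noteq> g" "f \<in> edges (verts P)" "g \<in> edges (verts P)" for f g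
    using mid_inj[OF tet that(2,3)] that(1) by blast
  have neq: "{a, b} \<noteq> {a, c}" "{a, b} \<noteq> {b, c}" "{a, b} \<noteq> {a, d}" "{a, b} \<noteq> {b, d}"
    "{a, b} \<noteq> {c, d}"
    "{a, c} \<noteq> {a, d}" "{a, c} \<noteq> {b, d}" "{a, c} \<noteq> {c, d}" "{b, c} \<noteq> {a, d}" "{b, c} \<noteq> {b, d}"
      "{b, c} \<noteq> {c, d}"
    using dist by (auto simp: doubleton_eq_iff)
  have disj: "m \<notin> N2" "m \<notin> N3" "N2 \<inter> N3 = {}" unfolding m_def N2_def N3_def
    using ne[OF neq(1) e(1) e(2)] ne[OF neq(2) e(1) e(3)] ne[OF neq(3) e(1) e(4)] ne[OF neq(4) e(1)
      e(5)] ne[OF neq(5) e(1) e(6)]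
     ne[OF neq(6) e(2) e(4)] ne[OF neq(7) e(2) e(5)] ne[OF neq(8) e(2) e(6)] ne[OF neq(9) e(3) e(4)]
       ne[OF neq(10) e(3) e(5)] ne[OF neq(11) e(3) e(6)]
    by auto
  define m2 where "m2 = mid {x, c}"
  define m3 where "m3 = mid {y, d}"
  have m2: "m2 \<in> N2" and m3: "m3 \<in> N3" and y: "y \<in> verts P" "y \<noteq> d" and d: "d \<in> verts P"
    using pth(1,2) dist unfolding m2_def m3_def N2_def N3_def v by auto
  have mem: "m2 \<notin> N3" "m3 \<notin> N2" "y \<notin> N2" "y \<notin> N3" "d \<notin> N2" "d \<notin> N3" "m2 \<noteq> m" "m3 \<noteq> m" "m2 \<noteq> m3"
    "m \<noteq> d" "m2 \<noteq> d" "m3 \<noteq> d" "m \<noteq> y" "m2 \<noteq> y" "m3 \<noteq> y"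
    using m2 m3 y d nv disj by auto
  from pth(6) show ?thesis unfolding m_def[symmetric] m2_def[symmetric] m3_def[symmetric]
  proof
    assume K: "z = y \<and> P_form False (child3 P x y z) y m m2 m3"
    note K' = K[THEN conjunct2]
    have "F \<in> {{y, m, m2}, {y, m, m3}, {y, m2, m3}, {m, m2, m3}}" using F form_faces(1)[OF K']
      by simp
    then consider "F = {y, m, m2}" | "F = {y, m, m3}" | "F = {y, m2, m3}" | "F = {m, m2, m3}"
      by blast
    then show ?thesis by cases (use form_fmark(1)[OF K'] m2 m3 y mem disj in auto)
  next
    assume K: "z = d \<and> P_form False (child3 P x y z) d m2 m m3"
    note K' = K[THEN conjunct2]
    have "F \<in> {{d, m2, m}, {d, m2, m3}, {d, m, m3}, {m2, m, m3}}" using F form_faces(1)[OF K']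
      by simp
    then consider "F = {d, m2, m}" | "F = {d, m2, m3}" | "F = {d, m, m3}" | "F = {m2, m, m3}"
      by blast
    then show ?thesis by cases (use form_fmark(1)[OF K'] m2 m3 mem disj in auto)
  qed
qed

text \<open>Faces through both z and m are settled by m and the old vertices V. For the other two, F
  determines only the unordered pair {m2, m3}, while the mark depends on which point is
  which.\<close>

lemma face_mark_A:
  assumes A: "A_form K z m3 m2 m" and F: "F \<in> faces (verts K)"
    and z: "z \<in> V" "m \<notin> V" "m2 \<notin> V" "m3 \<notin> V"
  shows "m \<in> F \<and> F \<inter> V \<noteq> {} \<and> F \<inter> V = {z} \<and> fmark K F = insert m (F \<inter> V) \<or>
    (m \<notin> F \<or> F \<inter> V = {}) \<and> m2 \<in> F \<and> m3 \<in> F \<and> F - insert m V = {m2, m3} \<and>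
      fmark K F = (if m \<in> F then {m, m3} else insert m2 (F \<inter> V))"
proof -
  have "F \<in> {{z, m, m3}, {z, m, m2}, {z, m3, m2}, {m, m3, m2}}" using F form_faces(2)[OF A] by simp
  then consider "F = {z, m, m3}" | "F = {z, m, m2}" | "F = {z, m3, m2}" | "F = {m, m3, m2}" by blast
  then show ?thesis by cases (use form_fmark(2)[OF A] z form_distinct(2)[OF A] in auto)
qed

lemma face_mark_unique:
  assumes mac: "macro P" and descent: "descent P x y z" "descent P x' y' z'"
    and F: "F \<in> faces (verts (child3 P x y z))" "F \<in> faces (verts (child3 P x' y' z'))"
  shows "fmark (child3 P x y z) F = fmark (child3 P x' y' z') F"
proof -
  obtain a b c d where U: "U_form P a b c d" using mac unfolding macro_def by blast
  show ?thesis
  proof (cases rule: U_form_cases[OF U])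
    case (1 c' d')
    then show ?thesis
      using face_mark_Pu[OF 1(2) descent(1) F(1)] face_mark_Pu[OF 1(2) descent(2) F(2)] by simp
  next
    case 2
    define V where "V = verts P"
    define m where "m = midpoint a b"
    have v: "V = {a, b, c, d}" and r: "redge P = {a, b}"
      using form_verts(3)[OF U] form_redge(3)[OF U] by (auto simp: V_def)
    have tet: "tetrahedron V" using macro_node[OF mac] node_tetrahedron(1) V_def by blast
    have dist: "a \<noteq> b" "a \<noteq> c" "a \<noteq> d" "b \<noteq> c" "b \<noteq> d" "c \<noteq> d" using form_distinct(3)[OF U] by auto
    have mV: "m \<notin> V" using mid_notin_verts[OF tet edge_pair[of a b]] dist v
      by (auto simp: m_def mid_pair)
    have *: "\<exists>p q r. {p, q, r} = {x, c, d} \<and> P_form False (child P x) p q r m \<and> y \<in> {p, q} \<and> z \<in> V \<and>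
        A_form (child3 P x y z) z (mid {y, r}) (mid {p, q}) m \<and> {p, q} \<in> edges V \<and> {y, r} \<in> edges V"
      if descent: "descent P x y z" for x y z
    proof -
      have x: "x \<in> {a, b}" using descent r by (simp add: descent_def)
      then have "{x, if x = a then b else a} = {a, b}" by auto
      from 2[OF this] obtain p q r where pqr: "{p, q, r} = {x, c, d}"
        "P_form False (child P x) p q r m"
        unfolding m_def by blast
      note pA = descent_A[OF pqr(2) descent, folded mid_pair]
      have "{p, q, r} \<subseteq> V" unfolding pqr(1) v using x by blast
      moreover have "p \<noteq> q" "p \<noteq> r" "q \<noteq> r" using form_distinct(1)[OF pqr(2)] by auto
      ultimately have ed: "{p, q} \<in> edges V" "{y, r} \<in> edges V" "z \<in> V" using pA(1,3)
        by (auto intro!: edge_pair)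
      show ?thesis by (intro exI[of _ p] exI[of _ q] exI[of _ r] conjI pqr pA ed)
    qed
    obtain p q r where h: "{p, q, r} = {x, c, d}" "P_form False (child P x) p q r m" "y \<in> {p, q}"
      "z \<in> V"
      "A_form (child3 P x y z) z (mid {y, r}) (mid {p, q}) m" "{p, q} \<in> edges V" "{y, r} \<in> edges V"
        using *[OF descent(1)] by blast
    obtain p' q' r' where h': "{p', q', r'} = {x', c, d}" "P_form False (child P x') p' q' r' m"
      "y' \<in> {p', q'}" "z' \<in> V"
      "A_form (child3 P x' y' z') z' (mid {y', r'}) (mid {p', q'}) m" "{p', q'} \<in> edges V"
        "{y', r'} \<in> edges V" using *[OF descent(2)] by blast
    note nV = mid_notin_verts[OF tet]
    note f = face_mark_A[OF h(5) F(1) h(4) mV nV[OF h(6)] nV[OF h(7)]]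
    note f' = face_mark_A[OF h'(5) F(2) h'(4) mV nV[OF h'(6)] nV[OF h'(7)]]
    show ?thesis
    proof (cases "m \<in> F \<and> F \<inter> V \<noteq> {}")
      case True
      then show ?thesis using f f' by auto
    next
      case False
      then have "{mid {p, q}, mid {y, r}} = {mid {p', q'}, mid {y', r'}}" using f f' by argo
      then have "{{p, q}, {y, r}} = {{p', q'}, {y', r'}}"
        using mid_inj[OF tet] h(6,7) h'(6,7) by (metis (no_types, opaque_lifting) doubleton_eq_iff)
      \<comment> \<open>The union of the two cut edges is {x, c, d} and determines x. The refinement
        edge of \<open>child P x\<close> then tells which midpoint was created second.\<close>
      then have "\<Union> {{p, q}, {y, r}} = \<Union> {{p', q'}, {y', r'}}" by simp
      moreover have "\<Union> {{p, q}, {y, r}} = {p, q, r}" using h(3) by auto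
      moreover have "\<Union> {{p', q'}, {y', r'}} = {p', q', r'}" using h'(3) by auto
      ultimately have "{x, c, d} = {x', c, d}" using h(1) h'(1) by simp
      moreover have "x \<in> {a, b}" "x' \<in> {a, b}" using descent r by (simp_all add: descent_def)
      ultimately have "x = x'" using dist by blast
      then have "{p, q} = {p', q'}" using form_redge(1)[OF h(2)] form_redge(1)[OF h'(2)] by simp
      moreover have "mid {y, r} = mid {y', r'}"
        using \<open>{mid {p, q}, mid {y, r}} = {mid {p', q'}, mid {y', r'}}\<close> calculation
          by (metis doubleton_eq_iff)
      ultimately show ?thesis using f f' False by (metis (no_types, lifting))
    qed
  qed
qed

section \<open>Conformity of the uniform meshes\<close>

lemma node_coords_child:
  assumes K: "node K" and x: "x \<in> redge K" and w: "w \<in> coords (verts (child K x))"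
  obtains u where "u \<in> coords (verts K)" "pt u = pt w" "bcut (redge K) u = w"
    "(\<forall>v\<in>verts (child K x). 0 < w v) \<longrightarrow> (\<forall>v\<in>verts K. 0 < u v)"
proof -
  obtain b c d where t: "tet4 K x b c d" using K x by (rule node_tet4_at)
  have v: "verts K = {x, b, c, d}" "redge K = {x, b}" "tetrahedron {x, b, c, d}" using t
    by (auto simp: tet4_def)
  have vc: "verts (child K x) = {x, midpoint x b, c, d}" by (rule child_tet4(1)[OF t refl])
  show ?thesis using coords_halve[OF v(3) w[unfolded vc]] that unfolding v vc by metis
qed

text \<open>An edge between old vertices cannot lie in a support with at most one old vertex, so all
  these cuts are void.\<close>

lemma fold_bcut_single:
  assumes "\<And>e. e \<in> set es \<Longrightarrow> card e = 2 \<and> e \<subseteq> Old" "\<And>v. 0 \<le> u v" "supp u \<inter> Old \<subseteq> {s}"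
  shows "fold bcut es u = u"
  using assms
proof (induction es)
  case (Cons e es)
  have e: "card e = 2" "e \<subseteq> Old" using Cons.prems(1) by auto
  have "\<not> e \<subseteq> supp u"
  proof
    assume "e \<subseteq> supp u"
    then have "e \<subseteq> {s}" using e Cons.prems(3) by blast
    then have "card e \<le> card {s}" by (rule card_mono[rotated]) simp
    then show False using e by simp
  qed
  then have "bcut e u = u" using e Cons.prems(2) by (intro bcut_eq_self) auto
  then show ?case using Cons by simp
qed simp

text \<open>Only {c, d} can be an effective cut, and after it one of c, d has left the support. The
  condition on the final support excludes that both survive. Hence different cut sequences on the
  two sides have the same effect.\<close>

lemma fold_bcut_pair:
  assumes "\<And>e. e \<in> set es \<Longrightarrow> card e = 2 \<and> e \<subseteq> Old \<and> mid e \<notin> Old" "\<And>v. 0 \<le> u v"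
    "supp u \<inter> Old \<subseteq> {c, d}" "c \<noteq> d" "supp (fold bcut es u) \<inter> Old \<subseteq> {s}" "{c, d} \<subseteq> Old"
  shows "fold bcut es u = bcut {c, d} u"
  using assms
proof (induction es)
  case Nil
  then have "\<not> {c, d} \<subseteq> supp u" by auto
  then show ?case using Nil by (simp add: bcut_eq_self)
next
  case (Cons e es)
  have e: "card e = 2" "e \<subseteq> Old" "mid e \<notin> Old" using Cons.prems(1) by auto
  show ?case
  proof (cases "e = {c, d}")
    case True
    obtain t where t: "t \<in> e" "supp (bcut e u) \<subseteq> insert (mid e) (supp u - {t})"
      by (rule supp_bcut[OF e(1) Cons.prems(2)])
    have "\<exists>s. {c, d} - {t} = {s}" using t(1) True \<open>c \<noteq> d\<close> by auto
    then obtain s where s: "{c, d} - {t} = {s}" by blast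
    have "supp (bcut e u) \<inter> Old \<subseteq> {c, d} - {t}"
      using t(2) e(3) Cons.prems(3) by blast
    then have "fold bcut es (bcut e u) = bcut e u"
      unfolding s using Cons.prems(1) bcut_nonneg[OF e(1) Cons.prems(2)]
      by (intro fold_bcut_single) auto
    then show ?thesis using True by simp
  next
    case False
    have "\<not> e \<subseteq> supp u"
    proof
      assume "e \<subseteq> supp u"
      then have "e \<subseteq> {c, d}" using e Cons.prems(3) by blast
      moreover have "card e = card {c, d}" using e(1) \<open>c \<noteq> d\<close> by simp
      ultimately show False using False card_subset_eq[of "{c, d}" e] by simp
    qed
    then have "bcut e u = u" using e Cons.prems(2) by (intro bcut_eq_self) auto
    then show ?thesis using Cons by simp
  qed
qed

lemma descent_coords:
  assumes mac: "macro P" and descent: "descent P x y z" and w: "w \<in> coords (verts (child3 P x y z))"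
  obtains u u1 u2 where "u \<in> coords (verts P)" "u1 \<in> coords (verts (child P x))"
    "u2 \<in> coords (verts (child (child P x) y))" "u1 = bcut (redge P) u"
      "u2 = bcut (redge (child P x)) u1"
    "w = bcut (redge (child (child P x) y)) u2" "pt u = pt w"
proof -
  obtain u2 where u2: "u2 \<in> coords (verts (child (child P x) y))" "pt u2 = pt w"
      "bcut (redge (child (child P x) y)) u2 = w"
    using node_coords_child[OF descent_redge(2)[OF mac descent] _ w] descent unfolding descent_def
      by blast
  obtain u1 where u1: "u1 \<in> coords (verts (child P x))" "pt u1 = pt u2"
    "bcut (redge (child P x)) u1 = u2"
    using node_coords_child[OF descent_redge(1)[OF mac descent] _ u2(1)] descent
      unfolding descent_def by blast
  obtain u where u: "u \<in> coords (verts P)" "pt u = pt u1" "bcut (redge P) u = u1"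
    using node_coords_child[OF macro_node[OF mac] _ u1(1)] descent unfolding descent_def by blast
  show ?thesis using that[OF u(1) u1(1) u2(1)] u u1 u2 by simp
qed

text \<open>A point common to two elements has the same coordinates in both, and their support then
  consists of common vertices; this is the intersection property of conforming meshes.\<close>

definition embedded :: "mtet set \<Rightarrow> bool" where
  "embedded \<T> \<longleftrightarrow> inj_on pt (\<Union>S\<in>verts ` \<T>. coords S)"

definition marks_agree :: "mtet set \<Rightarrow> bool" where
  "marks_agree \<T> \<longleftrightarrow> (\<forall>K\<in>\<T>. \<forall>L\<in>\<T>. \<forall>F\<in>faces (verts K) \<inter> faces (verts L). fmark K F = fmark L F)"

text \<open>The invariant that passes from one uniform mesh to the next. Injectivity of
  \<open>verts\<close> turns equality of vertex sets into equality of marked tetrahedra.\<close>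

locale macro_mesh =
  fixes \<T> :: "mtet set"
  assumes mac: "K \<in> \<T> \<Longrightarrow> macro K"
    and emb: "embedded \<T>"
    and agree: "marks_agree \<T>"
    and inj_verts: "inj_on verts \<T>"
begin

lemma fin_verts: "S \<in> verts ` \<T> \<Longrightarrow> finite S"
  using mac macro_node node_tetrahedron(2) by blast

lemma edge_mid_notin: "e \<in> mesh_edges \<T> \<Longrightarrow> mid e \<notin> mesh_verts \<T>"
  using mid_notin[OF emb[unfolded embedded_def] fin_verts] unfolding mesh_edges_def mesh_verts_def
    by blast

lemma edge_mid_inj: "e \<in> mesh_edges \<T> \<Longrightarrow> e' \<in> mesh_edges \<T> \<Longrightarrow> mid e = mid e' \<Longrightarrow> e = e'"
  using mid_inj_on[OF emb[unfolded embedded_def] fin_verts] unfolding mesh_edges_def by blast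

lemma descent_edges:
  assumes P: "P \<in> \<T>" and descent: "descent P x y z"
    and e: "e \<in> {redge P, redge (child P x), redge (child (child P x) y)}"
  shows "e \<in> mesh_edges \<T>" "card e = 2" "e \<subseteq> mesh_verts \<T>" "mid e \<notin> mesh_verts \<T>" "e \<subseteq> verts P"
proof -
  have *: "e \<in> edges (verts P)"
    using e descent_redge(4,5)[OF mac[OF P] descent] node_redge(1)[OF macro_node[OF mac[OF P]]]
      by auto
  then show "e \<in> mesh_edges \<T>" using P by (auto simp: mesh_edges_def)
  then show "card e = 2" "e \<subseteq> mesh_verts \<T>" "mid e \<notin> mesh_verts \<T>" "e \<subseteq> verts P"
    using * P edge_mid_notin by (auto simp: mesh_verts_def edges_def)
qed

text \<open>Each bisection trades one old vertex for a midpoint, which by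
  \<open>edge_mid_notin\<close> is not a vertex of any element of the mesh.\<close>

lemma descent_old:
  assumes P: "P \<in> \<T>" and descent: "descent P x y z"
  shows "verts (child3 P x y z) \<inter> mesh_verts \<T> = {z}" "z \<in> verts P"
    "verts (child P x) \<inter> mesh_verts \<T> \<subseteq> verts P - (redge P - {x})"
    "verts (child (child P x) y) \<inter> mesh_verts \<T>
      \<subseteq> verts P - (redge P - {x}) - (redge (child P x) - {y})"
proof -
  note e = descent_edges(4)[OF P descent]
  have z: "z \<in> verts P" "verts (child3 P x y z) =
    {z, mid (redge P), mid (redge (child P x)), mid (redge (child (child P x) y))}"
    by (rule descent_old_vertex[OF mac[OF P] descent], assumption)+
  then show "z \<in> verts P" "verts (child3 P x y z) \<inter> mesh_verts \<T> = {z}"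
    using e P by (auto simp: mesh_verts_def)
  show *: "verts (child P x) \<inter> mesh_verts \<T> \<subseteq> verts P - (redge P - {x})"
    using e[of "redge P"] by (auto simp: child_def Let_def)
  have "verts (child (child P x) y) \<inter> mesh_verts \<T>
    \<subseteq> verts (child P x) \<inter> mesh_verts \<T> - (redge (child P x) - {y})"
    using e[of "redge (child P x)"] by (auto simp: child_def[of "child P x"] Let_def)
  then show "verts (child (child P x) y) \<inter> mesh_verts \<T>
    \<subseteq> verts P - (redge P - {x}) - (redge (child P x) - {y})"
    using * by blast
qed

text \<open>The first cut that affects a point in the relative interior of a face is along the mark of the face.\<close>

lemma descent_face:
  assumes P: "P \<in> \<T>" and descent: "descent P x y z" and w: "supp w \<subseteq> verts (child3 P x y z)"
    and u: "u \<in> coords (verts P)" "u1 \<in> coords (verts (child P x))"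
    "u2 \<in> coords (verts (child (child P x) y))" "u1 = bcut (redge P) u"
      "u2 = bcut (redge (child P x)) u1"
    "w = bcut (redge (child (child P x) y)) u2"
    and S: "supp u \<in> faces (verts P)"
  defines "g \<equiv> fmark P (supp u)"
  shows "g \<in> mesh_edges \<T>" "g \<subseteq> supp u"
    and "\<And>c d. c \<noteq> d \<Longrightarrow> {c, d} \<subseteq> mesh_verts \<T> \<Longrightarrow> supp (bcut g u) \<inter> mesh_verts \<T> \<subseteq> {c, d} \<Longrightarrow>
      w = bcut {c, d} (bcut g u)"
proof -
  define e1 where "e1 = redge P"
  define e2 where "e2 = redge (child P x)"
  define e3 where "e3 = redge (child (child P x) y)"
  have e: "card e = 2 \<and> e \<subseteq> mesh_verts \<T> \<and> mid e \<notin> mesh_verts \<T>" "e \<in> mesh_edges \<T>"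
    if "e \<in> {e1, e2, e3}" for e
    using descent_edges(1-4)[OF P descent that[unfolded e1_def e2_def e3_def]] by simp_all
  have x: "x \<in> redge P" "y \<in> redge (child P x)" using descent by (simp_all add: descent_def)
  have nodes: "node P" "node (child P x)" "node (child (child P x) y)"
    using descent_redge(1,2)[OF mac[OF P] descent] macro_node[OF mac[OF P]] by auto
  have w1: "supp w \<inter> mesh_verts \<T> \<subseteq> {z}" using w descent_old(1)[OF P descent] by blast
  have u': "u1 = bcut e1 u" "u2 = bcut e2 u1" "w = bcut e3 u2" using u
    by (auto simp: e1_def e2_def e3_def)
  have "\<exists>es. set es \<subseteq> {e1, e2, e3} \<and> g \<in> {e1, e2, e3} \<and> g \<subseteq> supp u \<and> w = fold bcut es (bcut g u)"
  proof (cases "e1 \<subseteq> supp u")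
    case True
    then have "g = e1" using node_face_mark[OF nodes(1) S] by (simp add: g_def e1_def)
    then show ?thesis using True u' by (intro exI[of _ "[e2, e3]"]) simp
  next
    case False
    then have u1: "u1 = u" unfolding u' using e(1)[of e1] coordsD(1)[OF u(1)]
      by (intro bcut_eq_self) auto
    have "supp u \<subseteq> verts (child P x)" using coordsD(2)[OF u(2)] u1 by simp
    note inh = node_child_inherit[OF nodes(1) x(1) S this]
    show ?thesis
    proof (cases "e2 \<subseteq> supp u")
      case True
      then have "g = e2" using node_face_mark[OF nodes(2) inh(1)] inh(2) by (simp add: g_def e2_def)
      then show ?thesis using True u' u1 by (intro exI[of _ "[e3]"]) simp
    next
      case False
      then have u2: "u2 = u" unfolding u' u1[unfolded u'] using e(1)[of e2] coordsD(1)[OF u(1)]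
        by (intro bcut_eq_self) auto
      have "supp u \<subseteq> verts (child (child P x) y)" using coordsD(2)[OF u(3)] u2 by simp
      note inh2 = node_child_inherit[OF nodes(2) x(2) inh(1) this]
      show ?thesis
      proof (cases "e3 \<subseteq> supp u")
        case True
        then have "g = e3" using node_face_mark[OF nodes(3) inh2(1)] inh(2) inh2(2)
          by (simp add: g_def e3_def)
        then show ?thesis using True u' u2 by (intro exI[of _ "[]"]) simp
      next
        case False
        then have "w = u" unfolding u'(3) u2 using e(1)[of e3] coordsD(1)[OF u(1)]
          by (intro bcut_eq_self) auto
        \<comment> \<open>If no cut had an effect, three old vertices would remain in the support,
          while w can have only z.\<close>
        moreover have "supp u \<subseteq> mesh_verts \<T>" using S P by (auto simp: faces_def mesh_verts_def)
        ultimately have "supp u \<subseteq> {z}" using w1 by blast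
        then have "card (supp u) \<le> card {z}" by (rule card_mono[rotated]) simp
        then show ?thesis using S by (simp add: faces_def)
      qed
    qed
  qed
  then obtain es where es: "set es \<subseteq> {e1, e2, e3}" "g \<in> {e1, e2, e3}" "g \<subseteq> supp u"
    "w = fold bcut es (bcut g u)" by blast
  show "g \<in> mesh_edges \<T>" "g \<subseteq> supp u" using es e(2)[of g] by auto
  show "w = bcut {c, d} (bcut g u)" if "c \<noteq> d" "{c, d} \<subseteq> mesh_verts \<T>"
    "supp (bcut g u) \<inter> mesh_verts \<T> \<subseteq> {c, d}" for c d
  proof -
    have fe: "card f = 2 \<and> f \<subseteq> mesh_verts \<T> \<and> mid f \<notin> mesh_verts \<T>" if "f \<in> set es" for f
      by (rule e(1)[OF subsetD[OF es(1) that]])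
    have "card g = 2" using e(1)[OF es(2)] by simp
    then have nn: "0 \<le> bcut g u v" for v by (rule bcut_nonneg[OF _ coordsD(1)[OF u(1)]])
    show ?thesis unfolding es(4)
      by (rule fold_bcut_pair[OF fe nn that(3,1) w1[unfolded es(4)] that(2)])
  qed
qed

text \<open>Both coordinate vectors arise from the same coarse vector u, and the size of its support
  decides. On an edge at most one cut is effective. On a face the common mark is cut first, which
  leaves two old vertices. In the interior both elements descend from the same macro, and the cuts
  agree until the descents separate; from then on too few old vertices are left for the descents to
  differ.\<close>

lemma refine_unique:
  assumes P: "P \<in> \<T>" "descent P x y z" and w: "w \<in> coords (verts (child3 P x y z))"
    and Q: "Q \<in> \<T>" "descent Q x' y' z'" and w': "w' \<in> coords (verts (child3 Q x' y' z'))"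
    and eq: "pt w = pt w'"
  shows "w = w'"
proof -
  let ?O = "mesh_verts \<T>"
  obtain u u1 u2 where u: "u \<in> coords (verts P)" "u1 \<in> coords (verts (child P x))"
    "u2 \<in> coords (verts (child (child P x) y))" "u1 = bcut (redge P) u"
      "u2 = bcut (redge (child P x)) u1"
    "w = bcut (redge (child (child P x) y)) u2" "pt u = pt w"
    using descent_coords[OF mac[OF P(1)] P(2) w] .
  obtain u' u1' u2' where v: "u' \<in> coords (verts Q)" "u1' \<in> coords (verts (child Q x'))"
    "u2' \<in> coords (verts (child (child Q x') y'))" "u1' = bcut (redge Q) u'"
      "u2' = bcut (redge (child Q x')) u1'"
    "w' = bcut (redge (child (child Q x') y')) u2'" "pt u' = pt w'"
    using descent_coords[OF mac[OF Q(1)] Q(2) w'] .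
  have "u' = u"
    by (rule inj_onD[OF emb[unfolded embedded_def]]) (use u(1,7) v(1,7) eq P(1) Q(1) in auto)
  note v = v[unfolded this]
  have old: "verts P \<subseteq> ?O" using P by (auto simp: mesh_verts_def)
  have fin: "finite (verts P)" and card4: "card (verts P) = 4" "card (verts Q) = 4"
    "finite (verts Q)"
    using macro_node[OF mac] P(1) Q(1) node_card(1) node_tetrahedron(2) by blast+
  have nn: "0 \<le> u v" for v using coordsD(1)[OF u(1)] .
  have su: "supp u \<subseteq> verts P" "supp u \<subseteq> verts Q" using coordsD(2) u(1) v(1) by auto
  have sw: "supp w \<inter> ?O \<subseteq> {z}" "supp w' \<inter> ?O \<subseteq> {z'}"
    using coordsD(2)[OF w] coordsD(2)[OF w'] descent_old(1)[OF P] descent_old(1)[OF Q] by blast+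
  have eP: "card e = 2 \<and> e \<subseteq> ?O \<and> mid e \<notin> ?O"
    if "e \<in> {redge P, redge (child P x), redge (child (child P x) y)}" for e
    using descent_edges(2-4)[OF P that] by simp
  have eQ: "card e = 2 \<and> e \<subseteq> ?O \<and> mid e \<notin> ?O"
    if "e \<in> {redge Q, redge (child Q x'), redge (child (child Q x') y')}" for e
    using descent_edges(2-4)[OF Q that] by simp
  have wf: "w = fold bcut [redge P, redge (child P x), redge (child (child P x) y)] u" using u
    by simp
  have wf': "w' = fold bcut [redge Q, redge (child Q x'), redge (child (child Q x') y')] u" using v
    by simp
  have "card (supp u) \<le> 4" using card_mono[OF fin su(1)] card4 by simp
  then consider "card (supp u) \<le> 2" | "card (supp u) = 3" | "card (supp u) = card (verts P)"
    using card4 by linarith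
  then show ?thesis
  proof cases
    case 1
    \<comment> \<open>The support is padded to exactly two vertices, the form required by
      \<open>fold_bcut_pair\<close>.\<close>
    then have "\<exists>T. supp u \<subseteq> T \<and> T \<subseteq> verts P \<and> card T = 2"
      using su(1) fin card4(1) by (intro exists_subset_between) simp_all
    then obtain T where T: "supp u \<subseteq> T" "T \<subseteq> verts P" "card T = 2" by blast
    then obtain c d where cd: "T = {c, d}" "c \<noteq> d" by (auto simp: card_2_iff)
    have sub: "supp u \<inter> ?O \<subseteq> {c, d}" "{c, d} \<subseteq> ?O" using T old unfolding cd by blast+
    have "w = bcut {c, d} u"
      unfolding wf by (rule fold_bcut_pair[OF eP nn sub(1) cd(2) sw(1)[unfolded wf] sub(2)]) simp
    moreover have "w' = bcut {c, d} u"
      unfolding wf' by (rule fold_bcut_pair[OF eQ nn sub(1) cd(2) sw(2)[unfolded wf'] sub(2)]) simp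
    ultimately show ?thesis by simp
  next
    case 2
    then have S: "supp u \<in> faces (verts P)" "supp u \<in> faces (verts Q)" using su
      by (auto simp: faces_def)
    then have g: "fmark P (supp u) = fmark Q (supp u)" using agree P(1) Q(1)
      unfolding marks_agree_def by blast
    note pP = descent_face[OF P coordsD(2)[OF w] u(1-6) S(1)]
      and pQ = descent_face[OF Q coordsD(2)[OF w'] v(1-6) S(2), folded g]
    let ?g = "fmark P (supp u)"
    have cg: "card ?g = 2" using pP(1) by (auto simp: mesh_edges_def edges_def)
    obtain t where t: "t \<in> ?g" "supp (bcut ?g u) \<subseteq> insert (mid ?g) (supp u - {t})"
      by (rule supp_bcut[OF cg nn])
    have "card (supp u - {t}) = 2" using 2 t pP(2) by (subst card_Diff_singleton) auto
    then obtain c d where cd: "supp u - {t} = {c, d}" "c \<noteq> d" by (auto simp: card_2_iff)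
    have cd': "{c, d} \<subseteq> ?O" using cd su old by blast
    have sub: "supp (bcut ?g u) \<inter> ?O \<subseteq> {c, d}" using t(2) edge_mid_notin[OF pP(1)] cd(1) by blast
    show ?thesis using pP(3)[OF cd(2) cd' sub] pQ(3)[OF cd(2) cd' sub] by simp
  next
    case 3
    have "supp u = verts P" "supp u = verts Q"
      using card_subset_eq[OF _ su(1)] card_subset_eq[OF _ su(2)] 3 card4 fin by auto
    then have QP: "Q = P" by (intro inj_onD[OF inj_verts]) (use P(1) Q(1) in auto)
    note v = v[unfolded QP] note Q = Q[unfolded QP] note eQ = eQ[unfolded QP]
    have u1: "u1' = u1" using u v by simp
    have s1: "supp u1 \<inter> ?O \<subseteq> verts P - (redge P - {x})" "supp u1 \<inter> ?O \<subseteq> verts P - (redge P - {x'})"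
      using coordsD(2)[OF u(2)] coordsD(2)[OF v(2)] descent_old(3)[OF P] descent_old(3)[OF Q] u1
        by blast+
    show ?thesis
    proof (cases "x = x'")
      case False
      have "card (verts P - redge P) = 2" using card_Diff_subset[of "redge P"
        "verts P"] node_redge(2) node_card macro_node[OF mac[OF P(1)]]
        by (metis add_diff_cancel_left' card_ge_0_finite numeral_Bit0 zero_less_numeral)
      then obtain c d where cd: "verts P - redge P = {c, d}" "c \<noteq> d" by (auto simp: card_2_iff)
      have "x \<in> redge P" "x' \<in> redge P" using P(2) Q(2) by (auto simp: descent_def)
      \<comment> \<open>The vector lives in both children of P, so both endpoints of the refinement
        edge have left the support.\<close>
      then have sub: "supp u1 \<inter> ?O \<subseteq> {c, d}" "{c, d} \<subseteq> ?O" using s1 False old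
        unfolding cd(1)[symmetric] by blast+
      have nn1: "0 \<le> u1 v" for v using coordsD(1)[OF u(2)] .
      have wf1: "w = fold bcut [redge (child P x), redge (child (child P x) y)] u1"
        "w' = fold bcut [redge (child P x'), redge (child (child P x') y')] u1" using u v u1
          by simp_all
      have "w = bcut {c, d} u1" unfolding wf1(1)
        by (rule fold_bcut_pair[OF eP nn1 sub(1) cd(2) sw(1)[unfolded wf1(1)] sub(2)]) auto
      moreover have "w' = bcut {c, d} u1" unfolding wf1(2)
        by (rule fold_bcut_pair[OF eQ nn1 sub(1) cd(2) sw(2)[unfolded wf1(2)] sub(2)]) auto
      ultimately have "w = w'" by simp
      then show ?thesis by simp
    next
      case True
      note v = v[unfolded True[symmetric]] note Q = Q[unfolded True[symmetric]] note eQ = eQ[unfolded True[symmetric]]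
      have u2: "u2' = u2" using u v by simp
      show ?thesis
      proof (cases "y = y'")
        case True
        then show ?thesis using u v u2 by simp
      next
        case False
        let ?e1 = "redge P" and ?e2 = "redge (child P x)"
        have m: "y \<in> ?e2" "y' \<in> ?e2" "x \<in> ?e1" using P(2) Q(2) by (auto simp: descent_def)
        have "supp u2 \<inter> ?O \<subseteq> verts P - (?e1 - {x}) - ?e2"
          using coordsD(2)[OF u(3)] coordsD(2)[OF v(3)] descent_old(4)[OF P]
            descent_old(4)[OF Q] u2 False m by blast
        \<comment> \<open>Three old vertices survive the first cut, and separation at the second one
          removes both endpoints of its edge.\<close>
        moreover have "card (verts P - (?e1 - {x}) - ?e2) \<le> 1"
        proof -
          have c2: "card ?e1 = 2" "card ?e2 = 2" "?e1 \<subseteq> verts P" "?e2 \<subseteq> verts P"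
            using descent_edges(2,5)[OF P] by simp_all
          have "node (child P x)" using descent_redge(1)[OF mac[OF P(1)] P(2)] .
          then have "?e2 \<subseteq> verts (child P x) \<inter> ?O" using node_redge(2) eP[of ?e2] by blast
          then have s: "?e2 \<subseteq> verts P - (?e1 - {x})" using descent_old(3)[OF P] by blast
          have f: "finite ?e1" "finite ?e2" using c2 fin by (auto intro: finite_subset)
          have "card (?e1 - {x}) = 1" using c2 m f by simp
          then have "card (verts P - (?e1 - {x})) = 3" using card4 c2 f
            by (subst card_Diff_subset) auto
          then show ?thesis using s f c2 by (subst card_Diff_subset) auto
        qed
        then obtain s where "verts P - (?e1 - {x}) - ?e2 \<subseteq> {s}"
          using fin
            by (metis card_1_singletonE card_eq_0_iff finite_Diff le_Suc_eq One_nat_def le_zero_eq subset_refl empty_subsetI)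
        ultimately have s2: "supp u2 \<inter> ?O \<subseteq> {s}" by blast
        have nn2: "0 \<le> u2 v" for v using coordsD(1)[OF u(3)] .
        have "redge (child (child P x) y) \<in> {redge P, redge (child P x), redge (child (child P x) y)}"
          "redge (child (child P x) y') \<in> {redge P, redge (child P x), redge (child (child P x) y')}" by simp_all
        note e3 = eP[OF this(1)] eQ[OF this(2)]
        have "bcut (redge (child (child P x) y)) u2 = u2"
          using fold_bcut_single[of "[redge (child (child P x) y)]" ?O u2 s] e3 s2 nn2 by simp
        moreover have "bcut (redge (child (child P x) y')) u2 = u2"
          using fold_bcut_single[of "[redge (child (child P x) y')]" ?O u2 s] e3 s2 nn2 by simp
        ultimately have "w = w'" using u(6) v(6) u2 by simp
        then show ?thesis by simp
      qed
    qed
  qed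
qed

definition refined :: "mtet set" where
  "refined = {child3 P x y z | P x y z. P \<in> \<T> \<and> descent P x y z}"

lemma embedded_refined: "embedded refined"
  unfolding embedded_def
proof (rule inj_onI)
  fix w w' assume "w \<in> \<Union> (coords ` verts ` refined)" "w' \<in> \<Union> (coords ` verts ` refined)"
    "pt w = pt w'"
  then show "w = w'" using refine_unique unfolding refined_def by blast
qed

text \<open>A realisation of \<open>car\<close> that depends on the mesh alone and not on the
  element. The description is unique because distinct edges of the mesh have distinct
  midpoints.\<close>

definition carrier :: "point \<Rightarrow> point set" where
  "carrier v = (if v \<in> mesh_verts \<T> then {v} else (THE e. e \<in> mesh_edges \<T> \<and> mid e = v))"

text \<open>The carrier of F is the same seen from both sides. If it is a whole macro, both elements
  descend from this macro and \<open>face_mark_unique\<close> applies; otherwise it is a common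
  coarse face, whose marks agree, and the old vertex is the same.\<close>

lemma marks_agree_refined: "marks_agree refined"
proof -
  have old: "carrier v = {v}" if "v \<in> verts P" "P \<in> \<T>" for v P
    using that by (auto simp: carrier_def mesh_verts_def)
  have new: "carrier (mid e) = e" if "e \<in> edges (verts P)" "P \<in> \<T>" for e P
  proof -
    have e: "e \<in> mesh_edges \<T>" using that by (auto simp: mesh_edges_def)
    then show ?thesis using edge_mid_notin[OF e] edge_mid_inj e unfolding carrier_def
      by (auto intro!: the_equality)
  qed
  have "fmark (child3 P x y z) F = fmark (child3 Q x' y' z') F"
    if P: "P \<in> \<T>" "descent P x y z" and Q: "Q \<in> \<T>" "descent Q x' y' z'"
      and F: "F \<in> faces (verts (child3 P x y z))" "F \<in> faces (verts (child3 Q x' y' z'))"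
    for P Q x y z x' y' z' F
  proof -
    let ?S = "\<Union>v\<in>F. carrier v"
    have cP: "?S \<subseteq> verts P \<and> (?S = verts P \<or> ?S \<in> faces (verts P) \<and> verts P \<inter> F = {z} \<and>
        fmark (child3 P x y z) F = {z, mid (fmark P ?S)})"
      using old new P(1) by (intro face_mark_carrier[OF mac[OF P(1)] P(2) _ _ F(1)]) auto
    have cQ: "?S \<subseteq> verts Q \<and> (?S = verts Q \<or> ?S \<in> faces (verts Q) \<and> verts Q \<inter> F = {z'} \<and>
        fmark (child3 Q x' y' z') F = {z', mid (fmark Q ?S)})"
      using old new Q(1) by (intro face_mark_carrier[OF mac[OF Q(1)] Q(2) _ _ F(2)]) auto
    have c4: "card (verts P) = 4" "card (verts Q) = 4"
      using macro_node[OF mac] P(1) Q(1) node_card(1) by blast+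
    show ?thesis
    proof (cases "?S = verts P")
      case True
      then have "?S = verts Q" using cQ c4 by (auto simp: faces_def)
      then have "Q = P" using True by (intro inj_onD[OF inj_verts]) (use P(1) Q(1) in auto)
      then show ?thesis using face_mark_unique[OF mac[OF P(1)] P(2) _ F(1)] Q(2) F(2) by blast
    next
      case False
      then have fP: "?S \<in> faces (verts P)" "verts P \<inter> F = {z}"
        "fmark (child3 P x y z) F = {z, mid (fmark P ?S)}" using cP by auto
      then have "?S \<noteq> verts Q" using c4 by (auto simp: faces_def)
      then have fQ: "?S \<in> faces (verts Q)" "verts Q \<inter> F = {z'}"
        "fmark (child3 Q x' y' z') F = {z', mid (fmark Q ?S)}" using cQ by auto
      have "fmark P ?S = fmark Q ?S" using agree P(1) Q(1) fP(1) fQ(1) unfolding marks_agree_def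
        by blast
      moreover have "z = z'"
      proof -
        have "z \<in> F" "z \<in> verts P" using fP(2) by auto
        then have "z \<in> ?S" using old[OF _ P(1)] by auto
        then have "z \<in> verts Q" using cQ by blast
        then show ?thesis using fQ(2) \<open>z \<in> F\<close> by blast
      qed
      ultimately show ?thesis using fP fQ by simp
    qed
  qed
  then show ?thesis unfolding marks_agree_def refined_def by blast
qed

end

section \<open>The tree of uniform refinements\<close>

text \<open>The open simplex in coordinates. Cells are nested along the bisection tree and disjoint
  across branches, so they express the tree order without reference to paths.\<close>

definition cell :: "mtet \<Rightarrow> point set" where
  "cell K = pt ` {u \<in> coords (verts K). \<forall>v\<in>verts K. 0 < u v}"

lemma cellI: "u \<in> coords (verts K) \<Longrightarrow> \<forall>v\<in>verts K. 0 < u v \<Longrightarrow> pt u \<in> cell K"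
  unfolding cell_def by blast

lemma cellE:
  assumes "p \<in> cell K" obtains u where "u \<in> coords (verts K)" "\<forall>v\<in>verts K. 0 < u v" "p = pt u"
  using assms unfolding cell_def by blast

lemma cell_nonempty:
  assumes "node K" shows "cell K \<noteq> {}"
proof -
  define u :: "point \<Rightarrow> real" where "u = (\<lambda>v. of_bool (v \<in> verts K) / 4)"
  have "supp u \<subseteq> verts K" by (auto simp: supp_def u_def)
  moreover have "sum u (verts K) = 1" using node_card(1)[OF assms] by (simp add: u_def)
  ultimately have "u \<in> coords (verts K)" by (auto simp: coords_def u_def)
  moreover have "\<forall>v\<in>verts K. 0 < u v" by (simp add: u_def)
  ultimately show ?thesis unfolding cell_def by blast
qed

lemma cell_child:
  assumes "node K" "x \<in> redge K" shows "cell (child K x) \<subseteq> cell K"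
proof
  fix p assume "p \<in> cell (child K x)"
  then obtain w where w: "w \<in> coords (verts (child K x))" "\<forall>v\<in>verts (child K x). 0 < w v" "p = pt w"
    by (rule cellE)
  obtain u where "u \<in> coords (verts K)" "pt u = pt w" "bcut (redge K) u = w"
      "(\<forall>v\<in>verts (child K x). 0 < w v) \<longrightarrow> (\<forall>v\<in>verts K. 0 < u v)"
    using node_coords_child[OF assms w(1)] .
  then show "p \<in> cell K" using w(2,3) cellI[of u K] by simp
qed

lemma coords_pos_supp:
  assumes "u \<in> coords S" "\<forall>v\<in>S. 0 < u v" shows "supp u = S"
  using coordsD(2)[OF assms(1)] assms(2) by (force simp: supp_def)

text \<open>A common point has one coordinate vector in K, hence one after the cut. Its support
  would be the vertex set of both children, but x is missing from the child keeping the other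
  endpoint.\<close>

lemma cell_children_disjoint:
  assumes K: "node K" and x: "x \<in> redge K" and x': "x' \<in> redge K"
    and ne: "cell (child K x) \<inter> cell (child K x') \<noteq> {}"
  shows "x = x'"
proof (rule ccontr)
  assume xx: "x \<noteq> x'"
  obtain p where p: "p \<in> cell (child K x)" "p \<in> cell (child K x')" using ne by blast
  obtain w where w: "w \<in> coords (verts (child K x))" "\<forall>v\<in>verts (child K x). 0 < w v" "p = pt w"
    by (rule cellE[OF p(1)])
  obtain w' where w': "w' \<in> coords (verts (child K x'))" "\<forall>v\<in>verts (child K x'). 0 < w' v"
    "p = pt w'"
    by (rule cellE[OF p(2)])
  obtain u where u: "u \<in> coords (verts K)" "pt u = pt w" "bcut (redge K) u = w"
    by (rule node_coords_child[OF K x w(1)])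
  obtain u' where u': "u' \<in> coords (verts K)" "pt u' = pt w'" "bcut (redge K) u' = w'"
    by (rule node_coords_child[OF K x' w'(1)])
  have "inj_on pt (coords (verts K))"
    using node_tetrahedron[OF K] inj_on_pt_coords by (simp add: tetrahedron_def)
  then have "u = u'" by (rule inj_onD) (use u u' w w' in auto)
  then have "w = w'" using u u' by simp
  then have eq: "verts (child K x) = verts (child K x')"
    using coords_pos_supp[OF w(1,2)] coords_pos_supp[OF w'(1,2)] by simp
  have "mid (redge K) \<notin> verts K" using mid_notin_verts node_tetrahedron(1)[OF K] node_redge(1)[OF K]
    by blast
  then have "x \<notin> verts (child K x')" using x xx node_redge(2)[OF K]
    by (auto simp: child_def Let_def)
  moreover have "x \<in> verts (child K x)" using x node_redge(2)[OF K]
    by (auto simp: child_def Let_def)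
  ultimately show False using eq by simp
qed

lemma redge_other:
  assumes "node K" "x \<in> redge K" obtains x' where "x' \<in> redge K" "x' \<noteq> x"
proof -
  obtain a b where "redge K = {a, b}" "a \<noteq> b" using node_card(2)[OF assms(1)] by (rule card2E)
  then show ?thesis using assms(2) that[of a] that[of b] by auto
qed

definition cell_disjoint :: "mtet set \<Rightarrow> bool" where
  "cell_disjoint \<T> \<longleftrightarrow> (\<forall>K\<in>\<T>. node K \<and> (\<forall>x\<in>redge K. node (child K x))) \<and>
    (\<forall>K\<in>\<T>. \<forall>L\<in>\<T>. cell K \<inter> cell L \<noteq> {} \<longrightarrow> K = L)"

text \<open>The sibling has a nonempty cell inside that of K and disjoint from the cell of this
  child.\<close>

lemma cell_child_strict:
  assumes "node K" "x \<in> redge K" "\<And>x. x \<in> redge K \<Longrightarrow> node (child K x)"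
    shows "\<not> cell K \<subseteq> cell (child K x)"
proof
  assume sub: "cell K \<subseteq> cell (child K x)"
  obtain x' where x': "x' \<in> redge K" "x' \<noteq> x" by (rule redge_other[OF assms(1,2)])
  have "cell (child K x') \<subseteq> cell (child K x)" using sub cell_child[OF assms(1) x'(1)] by blast
  then show False
    using cell_nonempty[OF assms(3)[OF x'(1)]] cell_children_disjoint[OF assms(1,2) x'(1)] x'(2)
    by blast
qed

lemma cell_disjoint_children:
  assumes "cell_disjoint \<T>" "K \<in> \<T>" "x \<in> redge K" "L \<in> \<T>" "x' \<in> redge L"
    "cell (child K x) \<inter> cell (child L x') \<noteq> {}"
  shows "K = L" "child K x = child L x'"
proof -
  have n: "node K" "node L" using assms by (auto simp: cell_disjoint_def)
  have "cell K \<inter> cell L \<noteq> {}"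
    using cell_child[OF n(1) assms(3)] cell_child[OF n(2) assms(5)] assms(6) by blast
  then show KL: "K = L" using assms unfolding cell_disjoint_def by blast
  then show "child K x = child L x'"
    using cell_children_disjoint[OF n(1) assms(3)] assms(5,6) by auto
qed

lemma macro_child_P:
  assumes "macro P" "x \<in> redge P" obtains f p q r s where "P_form f (child P x) p q r s"
proof -
  obtain a b c d where U: "U_form P a b c d" using assms(1) unfolding macro_def by blast
  have x: "x = a \<or> x = b" using assms(2) form_redge(3)[OF U] by simp
  show ?thesis
  proof (cases rule: U_form_cases[OF U])
    case (1 c' d')
    then show ?thesis using x child_Pu that P_form_swap by metis
  next
    case 2
    have "{x, if x = a then b else a} = {a, b}" using x by auto
    from 2[OF this] show ?thesis using that by blast
  qed
qed

lemma P_form_child: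
  assumes K: "P_form f K p q r s" and y: "y \<in> redge K" shows "node (child K y)"
proof -
  have *: "node (child K y)" if "P_form f K y q r s" for q
    using that form_node(1)[OF child_Pu] form_node(2)[OF child_Pf] by (cases f) simp_all
  have "y = p \<or> y = q" using y form_redge(1)[OF K] by simp
  then show ?thesis using * K P_form_swap by metis
qed

lemma macro_child_node: "macro P \<Longrightarrow> x \<in> redge P \<Longrightarrow> node (child P x)"
  using macro_child_P form_node(1) by metis

lemma macro_grandchild_node:
  "macro P \<Longrightarrow> x \<in> redge P \<Longrightarrow> y \<in> redge (child P x) \<Longrightarrow> node (child (child P x) y)"
  using macro_child_P P_form_child by metis

section \<open>Levels of the tree and the macro-generation of edges\<close>

locale initial_macros = macro_mesh \<T>\<^sub>0 for \<T>\<^sub>0 +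
  assumes fin: "finite \<T>\<^sub>0"
begin

definition lev :: "nat \<Rightarrow> mtet set" where
  "lev n = ((\<lambda>\<T>. bisect \<T> \<T>) ^^ n) \<T>\<^sub>0"

lemma uniform_mesh_lev: "uniform_mesh \<T>\<^sub>0 q = lev (3 * q)"
  by (simp add: uniform_mesh_def lev_def)

lemma lev_0: "lev 0 = \<T>\<^sub>0"
  by (simp add: lev_def)

lemma lev_Suc: "lev (Suc n) = (\<Union>K\<in>lev n. children K)"
  by (simp add: lev_def bisect_def)

lemma lev_SucE:
  assumes "K \<in> lev (Suc n)" obtains P x where "P \<in> lev n" "x \<in> redge P" "K = child P x"
  using assms by (auto simp: lev_Suc children_def)

lemma lev_SucI: "P \<in> lev n \<Longrightarrow> x \<in> redge P \<Longrightarrow> child P x \<in> lev (Suc n)"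
  by (auto simp: lev_Suc children_def)

lemma lev_3:
  "K \<in> lev (3 * Suc q) \<longleftrightarrow> (\<exists>P x y z. P \<in> lev (3 * q) \<and> descent P x y z \<and> K = child3 P x y z)"
proof -
  have "3 * Suc q = Suc (Suc (Suc (3 * q)))" by simp
  then show ?thesis unfolding descent_def by (simp only: lev_Suc children_def) blast
qed

lemma lev_macro: "K \<in> lev (3 * q) \<Longrightarrow> macro K"
proof (induction q arbitrary: K)
  case 0 then show ?case using mac by (simp add: lev_0)
next
  case (Suc q) then show ?case unfolding lev_3 using descent_redge(3) by blast
qed

lemma lev_node: "K \<in> lev n \<Longrightarrow> node K"
proof -
  have "(\<forall>K\<in>lev (3 * q). node K) \<and> (\<forall>K\<in>lev (Suc (3 * q)). node K)
    \<and> (\<forall>K\<in>lev (Suc (Suc (3 * q))). node K)" for q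
    using lev_macro macro_node macro_child_node macro_grandchild_node by (metis lev_SucE)
  moreover have "n = 3 * (n div 3) \<or> n = Suc (3 * (n div 3)) \<or> n = Suc (Suc (3 * (n div 3)))"
    by arith
  ultimately show "K \<in> lev n \<Longrightarrow> node K" by metis
qed

lemma cell_disjoint_lev: "cell_disjoint (lev n)"
proof (induction n)
  case 0
  have "K = L" if KL: "K \<in> \<T>\<^sub>0" "L \<in> \<T>\<^sub>0" "cell K \<inter> cell L \<noteq> {}" for K L
  proof -
    obtain p where p: "p \<in> cell K" "p \<in> cell L" using KL(3) by blast
    obtain u where u: "u \<in> coords (verts K)" "\<forall>v\<in>verts K. 0 < u v" "p = pt u"
      by (rule cellE[OF p(1)])
    obtain w where w: "w \<in> coords (verts L)" "\<forall>v\<in>verts L. 0 < w v" "p = pt w"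
      by (rule cellE[OF p(2)])
    have "u = w" by (rule inj_onD[OF emb[unfolded embedded_def]]) (use u w KL in auto)
    then have "verts K = verts L" using coords_pos_supp[OF u(1,2)] coords_pos_supp[OF w(1,2)]
      by simp
    then show "K = L" by (rule inj_onD[OF inj_verts]) (use KL in auto)
  qed
  then show ?case using lev_node[of _ 0] lev_node[of _ "Suc 0"] lev_SucI[of _ 0]
    unfolding cell_disjoint_def lev_0 by blast
next
  case (Suc n)
  have "K = L" if KL: "K \<in> lev (Suc n)" "L \<in> lev (Suc n)" "cell K \<inter> cell L \<noteq> {}" for K L
  proof -
    obtain P x where P: "P \<in> lev n" "x \<in> redge P" "K = child P x" by (rule lev_SucE[OF KL(1)])
    obtain Q y where Q: "Q \<in> lev n" "y \<in> redge Q" "L = child Q y" by (rule lev_SucE[OF KL(2)])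
    show ?thesis using cell_disjoint_children(2)[OF Suc P(1,2) Q(1,2)] KL(3) unfolding P(3) Q(3)
      by blast
  qed
  then show ?case using lev_node[of _ "Suc n"] lev_node[of _ "Suc (Suc n)"] lev_SucI[of _ "Suc n"]
    unfolding cell_disjoint_def by blast
qed

lemma inj_verts_lev: "inj_on verts (lev n)"
proof (rule inj_onI)
  fix K L assume KL: "K \<in> lev n" "L \<in> lev n" "verts K = verts L"
  then have "cell K = cell L" by (simp add: cell_def)
  then show "K = L" using cell_disjoint_lev[of n] cell_nonempty[OF lev_node[OF KL(1)]] KL
    unfolding cell_disjoint_def by blast
qed

lemma macro_mesh_lev: "macro_mesh (lev (3 * q))"
proof (induction q)
  case 0 then show ?case using macro_mesh_axioms by (simp add: lev_0)
next
  case (Suc q)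
  interpret U: macro_mesh "lev (3 * q)" by (rule Suc)
  have "lev (3 * Suc q) = U.refined" unfolding U.refined_def using lev_3 by blast
  then show ?case using U.embedded_refined U.marks_agree_refined lev_macro inj_verts_lev
    by unfold_locales metis+
qed

lemma mesh_verts_Suc: "mesh_verts (lev n) \<subseteq> mesh_verts (lev (Suc n))"
proof
  fix v assume "v \<in> mesh_verts (lev n)"
  then obtain K where K: "K \<in> lev n" "v \<in> verts K" by (auto simp: mesh_verts_def)
  \<comment> \<open>If v is an endpoint of the refinement edge, the child that keeps v is
    taken.\<close>
  obtain x where x: "x \<in> redge K" "v \<in> redge K \<longrightarrow> x = v"
    using node_card(2)[OF lev_node[OF K(1)]] by (metis card.empty equals0I zero_neq_numeral)
  then have "v \<in> verts (child K x)" using K(2) by (auto simp: child_def Let_def)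
  then show "v \<in> mesh_verts (lev (Suc n))" using lev_SucI[OF K(1) x(1)]
    by (auto simp: mesh_verts_def)
qed

lemma mesh_verts_mono: "n \<le> n' \<Longrightarrow> mesh_verts (lev n) \<subseteq> mesh_verts (lev n')"
  using mesh_verts_Suc by (rule lift_Suc_mono_le)

lemma old_vertex:
  assumes "K \<in> lev (3 * Suc q)" obtains z where "verts K \<inter> mesh_verts (lev (3 * q)) = {z}"
proof -
  obtain P x y z where "P \<in> lev (3 * q)" "descent P x y z" "K = child3 P x y z" using assms
    unfolding lev_3 by blast
  then show ?thesis using macro_mesh.descent_old(1)[OF macro_mesh_lev] that by blast
qed

text \<open>An edge has two vertices of its own mesh, but an element of a later uniform mesh has
  only one vertex from any earlier one. This makes \<open>mgen\<close> well defined.\<close>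

lemma mesh_edges_disjoint:
  assumes "e \<in> mesh_edges (lev (3 * q))" "e \<in> mesh_edges (lev (3 * q'))" shows "q = q'"
proof -
  have False if e: "e \<in> mesh_edges (lev (3 * q))" "e \<in> mesh_edges (lev (3 * q'))" "q < q'" for q q'
  proof -
    obtain r where r: "q' = Suc r" using e(3) by (cases q') auto
    obtain K where K: "K \<in> lev (3 * Suc r)" "e \<subseteq> verts K" "card e = 2" using e(2) unfolding r
      by (auto simp: mesh_edges_def edges_def)
    obtain z where z: "verts K \<inter> mesh_verts (lev (3 * r)) = {z}" by (rule old_vertex[OF K(1)])
    have "e \<subseteq> mesh_verts (lev (3 * q))" using e(1)
      by (auto simp: mesh_edges_def mesh_verts_def edges_def)
    also have "\<dots> \<subseteq> mesh_verts (lev (3 * r))" using e(3) r by (intro mesh_verts_mono) simp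
    finally have "e \<subseteq> {z}" using K(2) z by blast
    then have "card e \<le> card {z}" by (rule card_mono[rotated]) simp
    then show False using K(3) by simp
  qed
  then show ?thesis using assms by (metis linorder_neqE_nat)
qed

lemma mgen_eq: "e \<in> mesh_edges (lev (3 * q)) \<Longrightarrow> mgen \<T>\<^sub>0 e = q"
  unfolding mgen_def uniform_mesh_lev using mesh_edges_disjoint by (intro the_equality) blast+

definition below :: "mtet \<Rightarrow> mtet set" where
  "below A = {A} \<union> children A \<union> (\<Union>K\<in>children A. children K)"

lemma lev_below:
  assumes "K \<in> lev n" obtains A where "A \<in> lev (3 * (n div 3))" "K \<in> below A"
proof -
  have "n = 3 * (n div 3) \<or> n = Suc (3 * (n div 3)) \<or> n = Suc (Suc (3 * (n div 3)))" by arith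
  then consider "K \<in> lev (3 * (n div 3))" | "K \<in> lev (Suc (3 * (n div 3)))"
    | "K \<in> lev (Suc (Suc (3 * (n div 3))))"
    using assms by metis
  then show ?thesis
  proof cases
    case 1 then show ?thesis using that by (auto simp: below_def)
  next
    case 2 then show ?thesis using that unfolding below_def lev_Suc by blast
  next
    case 3 then show ?thesis using that unfolding below_def lev_Suc by blast
  qed
qed

text \<open>The path to K is extended to a full descent of three bisections, so that the results on
  great-grandchildren apply to elements at intermediate levels.\<close>

lemma below_path:
  assumes A: "macro A" and K: "K \<in> below A"
  obtains x y z where "descent A x y z" "K \<in> {A, child A x, child (child A x) y}"
proof -
  have ne: "\<exists>x. x \<in> redge K" if "node K" for K
    using node_card(2)[OF that] by (metis card.empty equals0I zero_neq_numeral)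
  have *: thesis if "x \<in> redge A" "y \<in> redge (child A x)" "K \<in> {A, child A x, child (child A x) y}"
    for x y
    using ne[OF macro_grandchild_node[OF A that(1,2)]] that \<open>\<And>z y x. descent A x y z \<Longrightarrow>
      K \<in> {A, child A x, child (child A x) y} \<Longrightarrow> thesis\<close>
    unfolding descent_def by blast
  obtain x0 where x0: "x0 \<in> redge A" using ne[OF macro_node[OF A]] by blast
  consider "K = A" | x where "x \<in> redge A" "K = child A x" | x y where "x \<in> redge A"
    "y \<in> redge (child A x)" "K = child (child A x) y"
    using K unfolding below_def children_def by blast
  then show thesis
  proof cases
    case 1 then show ?thesis using *[of x0] ne[OF macro_child_node[OF A x0]] x0 by blast
  next
    case (2 x) then show ?thesis using *[of x] ne[OF macro_child_node[OF A]] by blast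
  next
    case (3 x y) then show ?thesis using * by blast
  qed
qed

lemma redge_below:
  assumes "A \<in> lev (3 * q)" "K \<in> below A" shows "redge K \<in> mesh_edges (lev (3 * q))"
proof -
  obtain x y z where "descent A x y z" "K \<in> {A, child A x, child (child A x) y}"
    by (rule below_path[OF lev_macro[OF assms(1)] assms(2)])
  then show ?thesis using macro_mesh.descent_edges(1)[OF macro_mesh_lev assms(1)] by blast
qed

end

section \<open>Causal chains\<close>

text \<open>Makes the mesh results available inside one macro, with its own vertices in the role of
  the old vertices.\<close>

lemma macro_mesh_singleton: "macro A \<Longrightarrow> macro_mesh {A}"
  using node_tetrahedron[OF macro_node] inj_on_pt_coords
  by unfold_locales (auto simp: embedded_def marks_agree_def tetrahedron_def)

text \<open>In the following lemma \<open>z\<close> is the vertex that \<open>A\<close> shares with its macro parent \<open>P\<close>.\<close>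

lemma redge_below_old:
  assumes P: "macro P" "descent P x y z" and A: "A = child3 P x y z" and K: "descent A x1 y1 z1"
    "K \<in> {A, child A x1, child (child A x1) y1}"
    and f: "f \<subseteq> verts A" "f \<subseteq> verts K" "card f = 2"
  shows "z \<in> f \<Longrightarrow> z \<in> redge K" and "z \<notin> redge K \<Longrightarrow> redge K = f \<or> mid (redge P) \<in> redge K"
proof -
  let ?n1 = "mid (redge P)" and ?n2 = "mid (redge (child P x))"
    and ?n3 = "mid (redge (child (child P x) y))"
  have vA: "verts A = {z, ?n1, ?n2, ?n3}" and zr: "z \<in> redge A"
    and zF: "\<And>F. F \<in> faces (verts A) \<Longrightarrow> z \<in> F \<Longrightarrow> z \<in> fmark A F"
      and n1: "?n1 \<in> fmark A {?n1, ?n2, ?n3}"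
    unfolding A by (rule descent_old_vertex[OF P], assumption)+
  have mA: "macro A" using descent_redge(3)[OF P] A by simp
  have nA: "node A" by (rule macro_node[OF mA])
  have x1: "x1 \<in> redge A" "y1 \<in> redge (child A x1)" using K(1) by (auto simp: descent_def)
  interpret S: macro_mesh "{A}" by (rule macro_mesh_singleton[OF mA])
  have mv: "mesh_verts {A} = verts A" by (simp add: mesh_verts_def)
  note old = S.descent_old(3,4)[OF singletonI K(1), unfolded mv]
    and ed = S.descent_edges[OF singletonI K(1), unfolded mv]
  define F where "F = verts A - (redge A - {x1})"
  have cA: "card (verts A) = 4" "finite (verts A)" "card (redge A) = 2" "redge A \<subseteq> verts A"
    using node_card[OF nA] node_tetrahedron(2)[OF nA] node_redge(2)[OF nA] by auto
  have fr: "finite (redge A)" using cA by (auto intro: finite_subset)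
  \<comment> \<open>F is the face of A inherited by its child; its mark is the refinement edge of
    that child.\<close>
  have "card F = 3" unfolding F_def using cA fr x1 by (subst card_Diff_subset) auto
  then have F: "F \<in> faces (verts A)" by (auto simp: faces_def F_def)
  have m: "mid (redge A) \<notin> verts A" by (rule ed(4)) simp
  then have "insert (mid (redge A)) F - {mid (redge A)} = F" by (auto simp: F_def)
  then have r1: "redge (child A x1) = fmark A F" by (simp add: child_def Let_def F_def)
  consider "K = A" | "K = child A x1" | "K = child (child A x1) y1" using K(2) by blast
  then have "(z \<in> f \<longrightarrow> z \<in> redge K) \<and> (z \<in> redge K \<or> redge K = f \<or> ?n1 \<in> redge K)"
  proof cases
    case 1 then show ?thesis using zr by simp
  next
    case 2
    have fF: "f \<subseteq> F" using f(1,2) old(1) unfolding 2 F_def by blast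
    show ?thesis
    proof (cases "z \<in> F")
      case True then show ?thesis using zF[OF F] unfolding 2 r1 by blast
    next
      case False
      have "F \<subseteq> {?n1, ?n2, ?n3}" using False F unfolding faces_def vA by blast
      moreover have "card {?n1, ?n2, ?n3} \<le> card F" using \<open>card F = 3\<close> by (simp add: card_insert_if)
      \<comment> \<open>If z has been bisected away, the inherited face is the one opposite z, whose
        mark contains the first midpoint.\<close>
      ultimately have "F = {?n1, ?n2, ?n3}" by (intro card_seteq) auto
      then show ?thesis using False fF n1 unfolding 2 r1 by auto
    qed
  next
    case 3
    let ?e2 = "redge (child A x1)"
    let ?R = "F - (?e2 - {y1})"
    have e2: "card ?e2 = 2" "?e2 \<subseteq> verts A" and e3: "card (redge K) = 2" "redge K \<subseteq> verts A"
      using ed(2,5)[of ?e2] ed(2,5)[of "redge K"] 3 by auto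
    have sub: "f \<subseteq> ?R" "redge K \<subseteq> ?R"
      using f(1,2) old(2) e3 node_redge(2)[OF descent_redge(2)[OF mA K(1)]] unfolding 3 F_def
        by blast+
    have "?e2 \<subseteq> F" using old(1) e2 node_redge(2)[OF descent_redge(1)[OF mA K(1)]] unfolding F_def
      by blast
    moreover have "finite ?e2" using e2 cA by (auto intro: finite_subset)
    ultimately have "card ?R = 2" using \<open>card F = 3\<close> e2 x1 cA by (subst card_Diff_subset) auto
    moreover have "finite ?R" using cA by (simp add: F_def)
    \<comment> \<open>After two bisections only two vertices of A remain, so both edges equal this
      pair.\<close>
    ultimately have "f = ?R" "redge K = ?R"
      using card_subset_eq[of ?R f] card_subset_eq[of ?R "redge K"] sub f(3) e3 by simp_all
    then show ?thesis by simp
  qed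
  then show "z \<in> f \<Longrightarrow> z \<in> redge K" and "z \<notin> redge K \<Longrightarrow> redge K = f \<or> mid (redge P) \<in> redge K"
    by blast+
qed

section \<open>Meshes of a refinement call as antichains of the tree\<close>

lemma run_Suc: "run \<T> \<M> (Suc n) = bisect (run \<T> \<M> n) (batch \<T> \<M> n)"
  by (simp add: batch_def)

lemma batch_run: "\<M> \<subseteq> \<T> \<Longrightarrow> batch \<T> \<M> n \<subseteq> run \<T> \<M> n"
  by (auto simp: batch_def pending_def)

context initial_macros
begin

definition tree_mesh :: "mtet set \<Rightarrow> bool" where
  "tree_mesh \<T> \<longleftrightarrow> \<T> \<subseteq> (\<Union>n. lev n) \<and> (\<forall>K\<in>\<T>. \<forall>L\<in>\<T>. cell K \<inter> cell L \<noteq> {} \<longrightarrow> K = L)"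

lemma tree_node: "K \<in> lev n \<Longrightarrow> x \<in> redge K \<Longrightarrow> node (child K x)"
  using lev_node lev_SucI by blast

lemma tree_mesh_cell_disjoint:
  assumes "tree_mesh \<T>" shows "cell_disjoint \<T>"
  unfolding cell_disjoint_def
proof (intro conjI ballI)
  fix K assume "K \<in> \<T>"
  then obtain n where "K \<in> lev n" using assms unfolding tree_mesh_def by blast
  then show "node K" "\<And>x. x \<in> redge K \<Longrightarrow> node (child K x)" using lev_node tree_node by blast+
next
  fix K L assume "K \<in> \<T>" "L \<in> \<T>"
  then show "cell K \<inter> cell L \<noteq> {} \<longrightarrow> K = L" using assms unfolding tree_mesh_def by blast
qed

lemma tree_meshD:
  assumes "tree_mesh \<T>" "K \<in> \<T>" shows "node K" "x \<in> redge K \<Longrightarrow> node (child K x)"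
  using tree_mesh_cell_disjoint[OF assms(1)] assms(2) unfolding cell_disjoint_def by blast+

text \<open>The cell of a child lies in that of its parent, so a meeting of new cells is reduced to
  one in the old mesh.\<close>

lemma tree_mesh_bisect:
  assumes T: "tree_mesh \<T>" and S: "\<S> \<subseteq> \<T>" shows "tree_mesh (bisect \<T> \<S>)"
proof -
  have d: "K = L" if "K \<in> \<T>" "L \<in> \<T>" "cell K \<inter> cell L \<noteq> {}" for K L using T that
    unfolding tree_mesh_def by blast
  have lev: "bisect \<T> \<S> \<subseteq> (\<Union>n. lev n)"
  proof
    fix K assume "K \<in> bisect \<T> \<S>"
    then consider "K \<in> \<T>" | P x where "P \<in> \<T>" "x \<in> redge P" "K = child P x" using S
      by (auto simp: bisect_def children_def)
    then show "K \<in> (\<Union>n. lev n)"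
    proof cases
      case 1 then show ?thesis using T unfolding tree_mesh_def by blast
    next
      case (2 P x)
      obtain n where "P \<in> lev n" using T 2(1) unfolding tree_mesh_def by blast
      from lev_SucI[OF this 2(2)] show ?thesis unfolding 2(3) by blast
    qed
  qed
  have mixed: False if "K \<in> \<T> - \<S>" "P \<in> \<S>" "x \<in> redge P" "cell K \<inter> cell (child P x) \<noteq> {}" for K P x
  proof -
    have P: "P \<in> \<T>" using that(2) S by blast
    have "cell (child P x) \<subseteq> cell P" by (rule cell_child[OF tree_meshD(1)[OF T P] that(3)])
    then have "K = P" using d[of K P] P that(1,4) by blast
    then show False using that by blast
  qed
  have "K = L" if KL: "K \<in> bisect \<T> \<S>" "L \<in> bisect \<T> \<S>" "cell K \<inter> cell L \<noteq> {}" for K L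
  proof -
    consider "K \<in> \<T> - \<S>" | P x where "P \<in> \<S>" "x \<in> redge P" "K = child P x" using KL(1)
      by (auto simp: bisect_def children_def)
    then show ?thesis
    proof cases
      case K: 1
      consider "L \<in> \<T> - \<S>" | P x where "P \<in> \<S>" "x \<in> redge P" "L = child P x" using KL(2)
        by (auto simp: bisect_def children_def)
      then show ?thesis
      proof cases
        case 1 then show ?thesis using d K KL(3) by blast
      next
        case (2 P x) then show ?thesis using mixed[OF K 2(1,2)] KL(3) unfolding 2(3) by blast
      qed
    next
      case K: (2 P x)
      consider "L \<in> \<T> - \<S>" | Q y where "Q \<in> \<S>" "y \<in> redge Q" "L = child Q y" using KL(2)
        by (auto simp: bisect_def children_def)
      then show ?thesis
      proof cases
        case 1 then show ?thesis using mixed[OF 1 K(1,2)] KL(3) unfolding K(3) by blast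
      next
        case (2 Q y)
        have "P \<in> \<T>" "Q \<in> \<T>" using S K(1) 2(1) by blast+
        from cell_disjoint_children(2)[OF tree_mesh_cell_disjoint[OF T] this(1) K(2) this(2) 2(2)]
        show ?thesis using KL(3) unfolding K(3) 2(3) by blast
      qed
    qed
  qed
  then show ?thesis using lev unfolding tree_mesh_def by blast
qed

lemma descendant_tree_mesh: "descendant_mesh \<T>\<^sub>0 \<T> \<Longrightarrow> tree_mesh \<T>"
proof (induction rule: descendant_mesh.induct)
  case initial
  have "\<T>\<^sub>0 \<subseteq> (\<Union>n. lev n)" using lev_0 by blast
  then show ?case using cell_disjoint_lev[of 0] unfolding tree_mesh_def cell_disjoint_def lev_0
    by blast
next
  case (step \<T> K)
  then show ?case by (intro tree_mesh_bisect) auto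
qed

lemma run_tree_mesh: "tree_mesh \<T> \<Longrightarrow> \<M> \<subseteq> \<T> \<Longrightarrow> tree_mesh (run \<T> \<M> n)"
  by (induction n) (auto simp only: run.simps(1) run_Suc intro!: tree_mesh_bisect dest: batch_run)

lemma run_cell:
  assumes "tree_mesh \<T>" "\<M> \<subseteq> \<T>" "L \<in> run \<T> \<M> (n + k)"
  shows "\<exists>L0\<in>run \<T> \<M> n. cell L \<subseteq> cell L0"
  using assms(3)
proof (induction k arbitrary: L)
  case (Suc k)
  have "L \<in> bisect (run \<T> \<M> (n + k)) (batch \<T> \<M> (n + k))"
    using Suc.prems by (simp only: add_Suc_right run_Suc)
  then consider "L \<in> run \<T> \<M> (n + k)" | P x where "P \<in> batch \<T> \<M> (n + k)" "x \<in> redge P"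
    "L = child P x"
    by (auto simp: bisect_def children_def)
  then show ?case
  proof cases
    case 1 then show ?thesis by (rule Suc.IH)
  next
    case (2 P x)
    then have P: "P \<in> run \<T> \<M> (n + k)" using batch_run[OF assms(2)] by blast
    have "cell L \<subseteq> cell P"
      using cell_child[OF tree_meshD(1)[OF run_tree_mesh[OF assms(1,2)] P] 2(2)] 2(3) by simp
    then show ?thesis using Suc.IH[OF P] by blast
  qed
qed auto

text \<open>After its batch, K is replaced by children with strictly smaller cells, and cells only
  shrink afterwards. Every event thus has a definite time.\<close>

lemma batch_unique:
  assumes T: "tree_mesh \<T>" "\<M> \<subseteq> \<T>" and K: "K \<in> batch \<T> \<M> n" "K \<in> batch \<T> \<M> n'"
  shows "n = n'"
proof -
  have False if K: "K \<in> batch \<T> \<M> n" "K \<in> batch \<T> \<M> n'" and n: "n < n'" for n n'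
  proof -
    note tm = run_tree_mesh[OF T, of n] and br = batch_run[OF T(2)]
    have Kr: "K \<in> run \<T> \<M> n" using K br by blast
    have d: "L = L'" if "L \<in> run \<T> \<M> n" "L' \<in> run \<T> \<M> n" "cell L \<inter> cell L' \<noteq> {}" for L L'
      using tm that unfolding tree_mesh_def by blast
    have nK: "node K" using tree_meshD(1)[OF tm Kr] .
    have ne: "cell K \<noteq> {}" by (rule cell_nonempty[OF nK])
    have "n' = Suc n + (n' - Suc n)" using n by simp
    then have "K \<in> run \<T> \<M> (Suc n + (n' - Suc n))" using K(2) batch_run[OF T(2)] by (metis subsetD)
    then obtain L where L: "L \<in> run \<T> \<M> (Suc n)" "cell K \<subseteq> cell L" using run_cell[OF T] by blast
    then consider "L \<in> run \<T> \<M> n - batch \<T> \<M> n" | P x where "P \<in> batch \<T> \<M> n" "x \<in> redge P"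
      "L = child P x"
      unfolding run_Suc by (auto simp: bisect_def children_def)
    then show False
    proof cases
      case 1
      then have "K = L" using d[OF Kr] L(2) ne by blast
      then show False using 1 K(1) by blast
    next
      case (2 P x)
      then have P: "P \<in> run \<T> \<M> n" using br by blast
      have "cell L \<subseteq> cell P" using cell_child[OF tree_meshD(1)[OF tm P] 2(2)] 2(3) by simp
      then have "K = P" using d[OF Kr P] L(2) ne by blast
      then show False using cell_child_strict[OF nK] 2 L(2) tree_meshD(2)[OF tm P] by blast
    qed
  qed
  then show ?thesis using K by (metis linorder_neqE_nat)
qed

text \<open>Batch numbers increase strictly along a chain, so its entries are distinct and the
  length of a block is a number of tetrahedra. Of the causal relation only the incidence of edges is
  kept.\<close>

lemma chain_facts:
  assumes T: "tree_mesh \<T>" "\<M> \<subseteq> \<T>" and G: "causal_forest \<T> \<M> G" "causal_chain \<T> \<M> G Ks"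
  shows "inj_on ((!) Ks) {..<length Ks}"
    and "j < length Ks \<Longrightarrow> Ks ! j \<in> (\<Union>n. lev n)"
    and "Suc j < length Ks \<Longrightarrow> redge (Ks ! j) \<in> edges (verts (Ks ! Suc j))"
proof -
  obtain par where par: "\<forall>K\<in>nonroot_events \<T> \<M>. admissible_parent \<T> \<M> (par K) K"
    "G = {(par K, K) | K. K \<in> nonroot_events \<T> \<M>}" using G(1) unfolding causal_forest_def by blast
  have ev: "\<exists>n. Ks ! j \<in> batch \<T> \<M> n" if "j < length Ks" for j
  proof -
    have "Ks ! j \<in> events \<T> \<M>" using G(2) nth_mem[OF that] unfolding causal_chain_def by blast
    then show ?thesis unfolding events_def by blast
  qed
  then obtain b where b: "\<And>j. j < length Ks \<Longrightarrow> Ks ! j \<in> batch \<T> \<M> (b j)" by metis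
  have arc: "b j < b (Suc j) \<and> redge (Ks ! j) \<in> edges (verts (Ks ! Suc j))"
    if j: "Suc j < length Ks" for j
  proof -
    have "(Ks ! j, Ks ! Suc j) \<in> G" using G(2) j unfolding causal_chain_def by blast
    then have "admissible_parent \<T> \<M> (Ks ! j) (Ks ! Suc j)" using par by auto
    then obtain n i where "Ks ! Suc j \<in> batch \<T> \<M> n" "Ks ! j \<in> batch \<T> \<M> i" "i < n"
      "redge (Ks ! j) \<in> edges (verts (Ks ! Suc j))"
      unfolding admissible_parent_def by blast
    \<comment> \<open>Each arc merely asserts that suitable batch numbers exist; uniqueness
      identifies them with one numbering of the whole chain.\<close>
    moreover have "b (Suc j) = n" "b j = i" using batch_unique[OF T] b j calculation(1,2)
      by (meson Suc_lessD)+
    ultimately show ?thesis by simp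
  qed
  then show "Suc j < length Ks \<Longrightarrow> redge (Ks ! j) \<in> edges (verts (Ks ! Suc j))" by blast
  show "j < length Ks \<Longrightarrow> Ks ! j \<in> (\<Union>n. lev n)"
    using b batch_run[OF T(2)] run_tree_mesh[OF T] unfolding tree_mesh_def by blast
  have mono: "i < k \<Longrightarrow> k < length Ks \<Longrightarrow> b i < b k" for i k
  proof (induction k)
    case (Suc k)
    then show ?case using arc[of k] by (cases "i = k") auto
  qed simp
  show "inj_on ((!) Ks) {..<length Ks}"
  proof (rule inj_onI)
    fix i k assume ik: "i \<in> {..<length Ks}" "k \<in> {..<length Ks}" "Ks ! i = Ks ! k"
    then have "b i = b k" using batch_unique[OF T] b by (metis lessThan_iff)
    then show "i = k" using mono[of i k] mono[of k i] ik
      by (metis lessThan_iff less_irrefl linorder_neqE_nat)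
  qed
qed

end

section \<open>Counting tree elements\<close>

lemma card_UN_le_mult:
  assumes "finite I" "\<And>i. i \<in> I \<Longrightarrow> card (B i) \<le> k"
  shows "card (\<Union>i\<in>I. B i) \<le> card I * k"
proof -
  have "card (\<Union>i\<in>I. B i) \<le> (\<Sum>i\<in>I. card (B i))" by (rule card_UN_le[OF assms(1)])
  also have "\<dots> \<le> (\<Sum>i\<in>I. k)" by (rule sum_mono) (rule assms(2))
  finally show ?thesis by simp
qed

lemma card_children:
  assumes "node K" shows "card (children K) \<le> 2" "finite (children K)"
proof -
  have "finite (redge K)" using node_card(2)[OF assms] by (intro card_ge_0_finite) simp
  then show "card (children K) \<le> 2" "finite (children K)"
    using node_card(2)[OF assms] card_image_le[of "redge K" "child K"]
      by (simp_all add: children_def)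
qed

context initial_macros
begin

lemma finite_lev: "finite (lev n)"
  by (induction n) (auto simp: lev_0 lev_Suc fin intro: card_children(2) lev_node)

lemma card_lev: "card (lev n) \<le> 2 ^ n * card \<T>\<^sub>0"
proof (induction n)
  case (Suc n)
  have "card (lev (Suc n)) \<le> card (lev n) * 2"
    unfolding lev_Suc using card_children(1) lev_node by (intro card_UN_le_mult finite_lev) blast
  then show ?case using Suc by simp
qed (simp add: lev_0)

lemma card_below:
  assumes "A \<in> lev (3 * q)" shows "card (below A) \<le> 7" "finite (below A)"
proof -
  have nA: "node A" using assms by (rule lev_node)
  have nc: "node K" if "K \<in> children A" for K using that assms tree_node
    by (auto simp: children_def)
  note cA = card_children[OF nA]
  have "card (\<Union>K\<in>children A. children K) \<le> card (children A) * 2"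
    using cA card_children(1)[OF nc] by (intro card_UN_le_mult) auto
  then have "card (\<Union>K\<in>children A. children K) \<le> 4" using cA(1) by linarith
  moreover have "card ({A} \<union> children A) \<le> 3" using card_Un_le[of "{A}" "children A"] cA(1) by simp
  ultimately show "card (below A) \<le> 7" unfolding below_def
    using card_Un_le[of "{A} \<union> children A" "\<Union>K\<in>children A. children K"] by linarith
  show "finite (below A)" unfolding below_def using cA card_children(2)[OF nc] by auto
qed

lemma card_Union_below:
  assumes "\<A> \<subseteq> lev (3 * q)" shows "card (\<Union>A\<in>\<A>. below A) \<le> card \<A> * 7" "finite (\<Union>A\<in>\<A>. below A)"
proof -
  have "finite \<A>" using assms finite_lev by (rule finite_subset)
  then show "card (\<Union>A\<in>\<A>. below A) \<le> card \<A> * 7" "finite (\<Union>A\<in>\<A>. below A)"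
    using card_below assms by (auto intro!: card_UN_le_mult)
qed

definition great_grandchildren :: "mtet \<Rightarrow> mtet set" where
  "great_grandchildren P = {child3 P x y z | x y z. descent P x y z}"

lemma card_great_grandchildren:
  assumes "P \<in> lev (3 * q)" shows "card (great_grandchildren P) \<le> 8"
proof -
  have eq: "great_grandchildren P = (\<Union>K\<in>children P. \<Union>L\<in>children K. children L)"
    unfolding great_grandchildren_def descent_def children_def by blast
  have n: "node P" using assms by (rule lev_node)
  have n1: "node K" if "K \<in> children P" for K using that assms tree_node
    by (auto simp: children_def)
  have n2: "node L" if "K \<in> children P" "L \<in> children K" for K L
    using that assms tree_node[OF lev_SucI] by (auto simp: children_def)
  have "card (\<Union>L\<in>children K. children L) \<le> 4" if "K \<in> children P" for K
  proof -
    have "card (\<Union>L\<in>children K. children L) \<le> card (children K) * 2"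
      using card_children[OF n1[OF that]] card_children(1)[OF n2[OF that]]
        by (intro card_UN_le_mult)
    then show ?thesis using card_children(1)[OF n1[OF that]] by linarith
  qed
  then have "card (great_grandchildren P) \<le> card (children P) * 4"
    unfolding eq using card_children[OF n] by (intro card_UN_le_mult)
  then show ?thesis using card_children(1)[OF n] by linarith
qed

lemma lev_3_great_grandchildren: "P \<in> lev (3 * q) \<Longrightarrow> great_grandchildren P \<subseteq> lev (3 * Suc q)"
  using lev_3[of _ q] unfolding great_grandchildren_def by blast

text \<open>Here f is the edge cut by the preceding event. It joins vertices of the mesh containing
  A, and the midpoints created inside A are not such vertices, so f is an edge of A itself even if
  it was cut from another macro. \<open>redge_below_old\<close> then applies.\<close>

lemma causal_step:
  assumes P: "P \<in> lev (3 * q)" "descent P x y z" and A: "A = child3 P x y z" and K: "K \<in> below A"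
    and f: "f \<in> edges (verts K)" "f \<in> mesh_edges (lev (3 * Suc q))"
  shows "f \<subseteq> verts A" "redge K \<subseteq> verts A"
    and "v \<in> f \<Longrightarrow> v \<in> mesh_verts (lev (3 * q)) \<Longrightarrow> v \<in> redge K"
    and "redge K \<inter> mesh_verts (lev (3 * q)) = {} \<Longrightarrow> redge K = f \<or> mid (redge P) \<in> redge K"
proof -
  have AU: "A \<in> lev (3 * Suc q)" using P A lev_3 by blast
  have mA: "macro A" by (rule lev_macro[OF AU])
  obtain x1 y1 z1 where descent: "descent A x1 y1 z1"
    and KA: "K \<in> {A, child A x1, child (child A x1) y1}"
    by (rule below_path[OF mA K])
  interpret U: macro_mesh "lev (3 * Suc q)" by (rule macro_mesh_lev)
  interpret V: macro_mesh "lev (3 * q)" by (rule macro_mesh_lev)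
  have "f \<subseteq> mesh_verts (lev (3 * Suc q))" using f(2)
    by (auto simp: mesh_edges_def mesh_verts_def edges_def)
  moreover have "verts K \<inter> mesh_verts (lev (3 * Suc q)) \<subseteq> verts A"
    using KA U.descent_old(3,4)[OF AU descent] by blast
  ultimately show fA: "f \<subseteq> verts A" using f(1) by (auto simp: edges_def)
  show rA: "redge K \<subseteq> verts A" using U.descent_edges(5)[OF AU descent, of "redge K"] KA by blast
  have z: "verts A \<inter> mesh_verts (lev (3 * q)) = {z}" unfolding A by (rule V.descent_old(1)[OF P])
  have zz: "v \<in> verts A \<Longrightarrow> v \<in> mesh_verts (lev (3 * q)) \<Longrightarrow> v = z" "z \<in> mesh_verts (lev (3 * q))" for v
    using z by auto
  note old = redge_below_old[OF lev_macro[OF P(1)] P(2) A descent KA fA]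
  have fK: "f \<subseteq> verts K" "card f = 2" using f(1) by (auto simp: edges_def)
  show "v \<in> f \<Longrightarrow> v \<in> mesh_verts (lev (3 * q)) \<Longrightarrow> v \<in> redge K" using old(1)[OF fK] zz(1)[of v] fA
    by blast
  show "redge K \<inter> mesh_verts (lev (3 * q)) = {} \<Longrightarrow> redge K = f \<or> mid (redge P) \<in> redge K"
    using old(2)[OF fK] zz(2) by blast
qed

text \<open>The new vertices of A are midpoints of edges of P, and a midpoint belongs to only one
  edge of the mesh. An edge is thus passed on to whichever macro produced A.\<close>

lemma parent_of_mid:
  assumes P: "P \<in> lev (3 * q)" "descent P x y z" and A: "A = child3 P x y z"
    and g: "g \<in> mesh_edges (lev (3 * q))" "mid g \<in> verts A"
  shows "g \<subseteq> verts P"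
proof -
  interpret V: macro_mesh "lev (3 * q)" by (rule macro_mesh_lev)
  have v: "verts A = {z, mid (redge P), mid (redge (child P x)), mid (redge (child (child P x) y))}"
    and z: "z \<in> verts P"
    unfolding A by (rule descent_old_vertex[OF lev_macro[OF P(1)] P(2)], assumption)+
  have "mid g \<noteq> z" using V.edge_mid_notin[OF g(1)] z P(1) by (auto simp: mesh_verts_def)
  then obtain e where e: "e \<in> {redge P, redge (child P x), redge (child (child P x) y)}"
    "mid g = mid e" using g(2) v by blast
  then have "g = e" using V.edge_mid_inj[OF g(1) V.descent_edges(1)[OF P e(1)]] by blast
  then show ?thesis using V.descent_edges(5)[OF P e(1)] by blast
qed

lemma old_in_redge:
  assumes "P \<in> lev (3 * Suc q)" "v \<in> verts P" "v \<in> mesh_verts (lev (3 * q))" shows "v \<in> redge P"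
proof -
  obtain Q x y z where Q: "Q \<in> lev (3 * q)" "descent Q x y z" "P = child3 Q x y z" using assms(1)
    unfolding lev_3 by blast
  have "verts P \<inter> mesh_verts (lev (3 * q)) = {z}" unfolding Q(3)
    by (rule macro_mesh.descent_old(1)[OF macro_mesh_lev Q(1,2)])
  moreover have "z \<in> redge P" unfolding Q(3)
    by (rule descent_old_vertex[OF lev_macro[OF Q(1)] Q(2)])
  ultimately show ?thesis using assms(2,3) by (metis IntI singletonD)
qed

text \<open>The three phases of a horizontal block: the bisected edge stays the same; it then contains the
  midpoint of a parent edge through a fixed vertex \<open>b\<close>; finally it contains a fixed old vertex \<open>c\<close>.\<close>

lemma block_localized:
  fixes K A P :: "nat \<Rightarrow> mtet"
  assumes rs: "r \<le> s"
    and P: "\<And>j. j \<in> {r..s} \<Longrightarrow> P j \<in> lev (3 * Suc q) \<and> A j \<in> great_grandchildren (P j)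
      \<and> K j \<in> below (A j)"
    and chain: "\<And>j. r \<le> j \<Longrightarrow> Suc j \<le> s \<Longrightarrow> redge (K j) \<in> edges (verts (K (Suc j)))"
  obtains a b c where "\<forall>j\<in>{r..s}. a \<in> verts (A j) \<or> b \<in> verts (P j) \<or> c \<in> verts (A j)"
proof -
  \<comment> \<open>The block has macro-generation \<open>Suc (Suc q)\<close>: the edges
    \<open>?f j\<close> live there, \<open>?V\<close> and \<open>?E\<close> belong to the parent
    macros, and \<open>?W\<close> to the generation before these.\<close>
  let ?V = "mesh_verts (lev (3 * Suc q))" and ?W = "mesh_verts (lev (3 * q))"
    and ?E = "mesh_edges (lev (3 * Suc q))"
  let ?f = "\<lambda>j. redge (K j)"
  have AU: "A j \<in> lev (3 * Suc (Suc q))" if "j \<in> {r..s}" for j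
    using P[OF that] lev_3_great_grandchildren by blast
  have fE: "?f j \<in> mesh_edges (lev (3 * Suc (Suc q)))" if "j \<in> {r..s}" for j
    using redge_below[OF AU[OF that]] P[OF that] by blast
  have descent: "\<exists>x y z. descent (P j) x y z \<and> A j = child3 (P j) x y z" if "j \<in> {r..s}" for j
    using P[OF that] unfolding great_grandchildren_def by blast
  have fA: "?f j \<subseteq> verts (A j)" if j: "j \<in> {r..s}" for j
  proof -
    have "K j \<in> below (A j)" using P[OF j] by blast
    then obtain x1 y1 z1 where p: "descent (A j) x1 y1 z1"
      "K j \<in> {A j, child (A j) x1, child (child (A j) x1) y1}"
      by (rule below_path[OF lev_macro[OF AU[OF j]]])
    then show ?thesis using macro_mesh.descent_edges(5)[OF macro_mesh_lev AU[OF j] p(1), of "?f j"]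
      by auto
  qed
  have causal: "?f j \<subseteq> verts (A (Suc j)) \<and> (\<forall>v\<in>?f j \<inter> ?V. v \<in> ?f (Suc j)) \<and>
      (?f (Suc j) \<inter> ?V = {} \<longrightarrow> ?f (Suc j) = ?f j \<or> mid (redge (P (Suc j))) \<in> ?f (Suc j))"
    if j: "r \<le> j" "Suc j \<le> s" for j
  proof -
    have j': "j \<in> {r..s}" "Suc j \<in> {r..s}" using j by auto
    obtain x y z where "descent (P (Suc j)) x y z" "A (Suc j) = child3 (P (Suc j)) x y z"
      using descent[OF j'(2)] by blast
    note cs = causal_step[OF _ this _ chain[OF j] fE[OF j'(1)]]
    show ?thesis using cs P[OF j'(2)] by blast
  qed
  obtain a where a: "a \<in> ?f r" using node_card(2)[OF lev_node] fE[of r] rs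
    by (fastforce simp: mesh_edges_def edges_def card_2_iff)
  \<comment> \<open>Each phase records that all indices so far are covered, together with the
    incidence that lets the next step continue.\<close>
  define S1 where "S1 j \<longleftrightarrow> (\<forall>i\<in>{r..j}. a \<in> verts (A i)) \<and> a \<in> ?f j \<and> ?f j = ?f r" for j
  define S2
    where "S2 b j \<longleftrightarrow> (\<forall>i\<in>{r..j}. a \<in> verts (A i) \<or> b \<in> verts (P i)) \<and> b \<in> ?W \<and> (\<exists>g\<in>?E. b \<in> g
    \<and> mid g \<in> ?f j)" for b j
  define S3
    where "S3 b c j \<longleftrightarrow> (\<forall>i\<in>{r..j}. a \<in> verts (A i) \<or> b \<in> verts (P i) \<or> c \<in> verts (A i)) \<and> c \<in> ?V
    \<and> c \<in> ?f j" for b c j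
  have "j \<le> s \<Longrightarrow> S1 j \<or> (\<exists>b. S2 b j) \<or> (\<exists>b c. S3 b c j)" if "r \<le> j" for j
    using that
  proof (induction j rule: dec_induct)
    case base
    then show ?case using a fA[of r] rs by (auto simp: S1_def)
  next
    case (step j)
    have ins: "{r..Suc j} = insert (Suc j) {r..j}" using step.hyps by auto
    have j: "Suc j \<in> {r..s}" using step by simp
    note st = causal[OF step.hyps(1) step.prems]
    have fA': "?f (Suc j) \<subseteq> verts (A (Suc j))" by (rule fA[OF j])
    have enter3: "\<exists>b c. S3 b c (Suc j)" if h: "\<forall>i\<in>{r..j}. a \<in> verts (A i) \<or> b \<in> verts (P i)"
      "?f (Suc j) \<inter> ?V \<noteq> {}" for b
    proof -
      obtain c where "c \<in> ?f (Suc j)" "c \<in> ?V" using h(2) by blast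
      then have "S3 b c (Suc j)" using h(1) fA' unfolding S3_def ins by blast
      then show ?thesis by blast
    qed
    have Pj: "P (Suc j) \<in> lev (3 * Suc q)" using P[OF j] by blast
    have rP: "redge (P (Suc j)) \<in> ?E" "redge (P (Suc j)) \<subseteq> verts (P (Suc j))"
      using node_redge[OF lev_node[OF Pj]] Pj by (auto simp: mesh_edges_def)
    consider "S1 j" | b where "S2 b j" | b c where "S3 b c j" using step by auto
    then show ?case
    proof cases
      case 1
      show ?thesis
      proof (cases "?f (Suc j) = ?f j")
        case True
        then have "S1 (Suc j)" using 1 st unfolding S1_def ins by auto
        then show ?thesis by blast
      next
        case False
        show ?thesis
        proof (cases "?f (Suc j) \<inter> ?V = {}")
          case True
          then have m: "mid (redge (P (Suc j))) \<in> ?f (Suc j)" using st False by blast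
          obtain b where "verts (P (Suc j)) \<inter> ?W = {b}" by (rule old_vertex[OF Pj])
          then have b: "b \<in> verts (P (Suc j))" "b \<in> ?W" by auto
          have "b \<in> redge (P (Suc j))" by (rule old_in_redge[OF Pj b])
          then have "S2 b (Suc j)" using 1 b m rP(1) unfolding S1_def S2_def ins by blast
          then show ?thesis by blast
        next
          case False
          \<comment> \<open>The second phase was skipped, so no vertex b has been chosen and any
            value serves.\<close>
          then show ?thesis using enter3[of undefined] 1 unfolding S1_def by blast
        qed
      qed
    next
      case (2 b)
      then obtain g where g: "g \<in> ?E" "b \<in> g" "mid g \<in> ?f j" unfolding S2_def by blast
      obtain x y z where "descent (P (Suc j)) x y z" "A (Suc j) = child3 (P (Suc j)) x y z"
        using descent[OF j] by blast
      \<comment> \<open>The midpoint of g is a vertex of the next macro, so g, and b with it, lies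
        in the next parent.\<close>
      from parent_of_mid[OF Pj this g(1)] have b: "b \<in> verts (P (Suc j))" using g st by blast
      have bW: "b \<in> ?W" using 2 unfolding S2_def by blast
      show ?thesis
      proof (cases "?f (Suc j) \<inter> ?V = {}")
        case True
        have "b \<in> redge (P (Suc j))" by (rule old_in_redge[OF Pj b bW])
        moreover have "?f (Suc j) = ?f j \<or> mid (redge (P (Suc j))) \<in> ?f (Suc j)" using st True
          by blast
        \<comment> \<open>If the bisected edge is unchanged, the old g serves; otherwise the
          refinement edge of the new parent does, which contains b because b is its old
          vertex.\<close>
        ultimately have "\<exists>g\<in>?E. b \<in> g \<and> mid g \<in> ?f (Suc j)" using g rP(1) by metis
        then have "S2 b (Suc j)" using 2 b unfolding S2_def ins by blast
        then show ?thesis by blast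
      next
        case False
        then show ?thesis using enter3[of b] 2 unfolding S2_def by blast
      qed
    next
      case (3 b c)
      then have "c \<in> ?f (Suc j)" using st unfolding S3_def by blast
      then have "S3 b c (Suc j)" using 3 fA' unfolding S3_def ins by blast
      then show ?thesis by blast
    qed
  qed
  then have "S1 s \<or> (\<exists>b. S2 b s) \<or> (\<exists>b c. S3 b c s)" using rs by blast
  then show ?thesis using that unfolding S1_def S2_def S3_def by metis
qed

end

section \<open>Finiteness of the valence and the block bound\<close>

text \<open>In suitable affine coordinates the macros are Kuhn simplices or halves of them; the three vectors
  below are, up to sign and order, the axes of the cube.\<close>

definition P_frame :: "bool \<Rightarrow> point set \<Rightarrow> mtet \<Rightarrow> bool" where
  "P_frame f X K \<longleftrightarrow> (\<exists>a b c d. P_form f K a b c d \<and>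
     (if f then {b - a, 2 *\<^sub>R d - a - b, 2 *\<^sub>R c - 2 *\<^sub>R d} else {c - a, b - c, 2 *\<^sub>R d - a - b})
       \<subseteq> X)"

definition A_frame :: "point set \<Rightarrow> mtet \<Rightarrow> bool" where
  "A_frame X K \<longleftrightarrow> (\<exists>w0 w1 w2 w3. A_form K w0 w1 w2 w3 \<and> {w1 - w0, w2 - w1, w3 - w2} \<subseteq> X)"

lemma two_midpoint: "2 *\<^sub>R midpoint a b = a + b"
  by (simp add: midpoint_def)

text \<open>The second child arises by swapping a and b, which reverses signs; closure of X under
  negation absorbs this.\<close>

lemma P_frame_child:
  assumes K: "P_frame False X K" and x: "x \<in> redge K" and X: "\<And>v. v \<in> X \<Longrightarrow> - v \<in> X"
  shows "P_frame True X (child K x)"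
proof -
  have *: "P_frame True X (child K a)" if "P_form False K a b c d"
    "{c - a, b - c, 2 *\<^sub>R d - a - b} \<subseteq> X" for a b c d
    unfolding P_frame_def using child_Pu[OF that(1)] that(2)
    by (intro exI[of _ a] exI[of _ c] exI[of _ d] exI[of _ "midpoint a b"]) (simp add: two_midpoint algebra_simps)
  obtain a b c d where ab: "P_form False K a b c d" "{c - a, b - c, 2 *\<^sub>R d - a - b} \<subseteq> X"
    using K unfolding P_frame_def by auto
  have "{c - b, a - c, 2 *\<^sub>R d - b - a} \<subseteq> X" using ab(2) X[of "b - c"] X[of "c - a"]
    by (simp add: algebra_simps)
  then show ?thesis using *[OF ab] *[of b a c d] ab(1) x form_redge(1)[OF ab(1)] P_form_swap by auto
qed

text \<open>The only step of the cycle that halves the axes: the path vectors of the new type A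
  tetrahedron are half the frame vectors of type Pf.\<close>

lemma P_frame_child':
  assumes K: "P_frame True X K" and x: "x \<in> redge K" and X: "\<And>v. v \<in> X \<Longrightarrow> - v \<in> X"
  shows "A_frame ((\<lambda>v. (1 / 2) *\<^sub>R v) ` X) (child K x)"
proof -
  have *: "A_frame ((\<lambda>v. (1 / 2) *\<^sub>R v) ` X) (child K a)"
    if "P_form True K a b c d" "{b - a, 2 *\<^sub>R d - a - b, 2 *\<^sub>R c - 2 *\<^sub>R d} \<subseteq> X" for a b c d
  proof -
    have "midpoint a b - a = (1 / 2) *\<^sub>R (b - a)" "d - midpoint a b = (1 / 2) *\<^sub>R (2 *\<^sub>R d - a - b)"
      "c - d = (1 / 2) *\<^sub>R (2 *\<^sub>R c - 2 *\<^sub>R d)"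
      by (simp_all add: vec_eq_iff midpoint_def field_simps)
    then show ?thesis unfolding A_frame_def using child_Pf[OF that(1)] that(2) by blast
  qed
  obtain a b c d where ab: "P_form True K a b c d" "{b - a, 2 *\<^sub>R d - a - b, 2 *\<^sub>R c - 2 *\<^sub>R d} \<subseteq> X"
    using K unfolding P_frame_def by auto
  have "{a - b, 2 *\<^sub>R d - b - a, 2 *\<^sub>R c - 2 *\<^sub>R d} \<subseteq> X" using ab(2) X[of "b - a"]
    by (simp add: algebra_simps)
  then show ?thesis using *[OF ab] *[of b a c d] ab(1) x form_redge(1)[OF ab(1)] P_form_swap by auto
qed

lemma A_frame_child:
  assumes K: "A_frame X K" and x: "x \<in> redge K" and X: "\<And>v. v \<in> X \<Longrightarrow> - v \<in> X"
  shows "P_frame False X (child K x)"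
proof -
  have *: "P_frame False X (child K w0)" if "A_form K w0 w1 w2 w3" "{w1 - w0, w2 - w1, w3 - w2} \<subseteq> X"
    for w0 w1 w2 w3
    unfolding P_frame_def using child_A[OF that(1)] that(2)
    by (intro exI[of _ w0] exI[of _ w2] exI[of _ w1] exI[of _ "midpoint w0 w3"]) (simp add: two_midpoint algebra_simps)
  obtain w0 w1 w2 w3 where w: "A_form K w0 w1 w2 w3" "{w1 - w0, w2 - w1, w3 - w2} \<subseteq> X"
    using K unfolding A_frame_def by blast
  have "{w2 - w3, w1 - w2, w0 - w1} \<subseteq> X" using w(2) X[of "w1 - w0"] X[of "w2 - w1"] X[of "w3 - w2"]
    by simp
  then show ?thesis using *[OF w] *[of w3 w2 w1 w0] w(1) x form_redge(2)[OF w(1)] A_form_rev by auto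
qed

text \<open>Every edge vector of a framed macro is a sum of at most three frame vectors or half of
  such a sum. The inserted 0 allows shorter sums.\<close>

definition differences :: "point set \<Rightarrow> point set" where
  "differences X = (\<lambda>(t, a, b, c). t *\<^sub>R (a + b + c)) ` ({1, 1 / 2} \<times> insert 0 X \<times> insert 0 X \<times> insert 0 X)"

lemma card_differences:
  assumes "finite X" shows "finite (differences X)" "card (differences X) \<le> 2 * (card X + 1) ^ 3"
proof -
  let ?S = "{1, 1 / 2 :: real} \<times> insert 0 X \<times> insert 0 X \<times> insert 0 X"
  show "finite (differences X)" unfolding differences_def using assms by simp
  have c: "card (insert 0 X) \<le> card X + 1" using assms by (simp add: card_insert_if)
  have "card (differences X) \<le> card ?S" unfolding differences_def using assms
    by (intro card_image_le) simp
  also have "\<dots> = 2 * card (insert 0 X) ^ 3"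
    by (simp only: card_cartesian_product power3_eq_cube) (simp add: mult.assoc)
  also have "\<dots> \<le> 2 * (card X + 1) ^ 3" using c by (intro mult_left_mono power_mono) auto
  finally show "card (differences X) \<le> 2 * (card X + 1) ^ 3" .
qed

lemma differencesI:
  "a \<in> insert 0 X \<Longrightarrow> b \<in> insert 0 X \<Longrightarrow> c \<in> insert 0 X \<Longrightarrow> x = a + b + c \<Longrightarrow> x \<in> differences X"
  "a \<in> insert 0 X \<Longrightarrow> b \<in> insert 0 X \<Longrightarrow> c \<in> insert 0 X \<Longrightarrow> 2 *\<^sub>R x = a + b + c \<Longrightarrow> x \<in> differences X"
proof -
  assume *: "a \<in> insert 0 X" "b \<in> insert 0 X" "c \<in> insert 0 X"
  {
    assume "x = a + b + c"
    then show "x \<in> differences X" unfolding differences_def using *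
      by (intro image_eqI[of _ _ "(1, a, b, c)"]) auto
  next
    assume "2 *\<^sub>R x = a + b + c"
    then have "x = (1 / 2) *\<^sub>R (a + b + c)"
      by (metis div_self scaleR_one scaleR_scaleR times_divide_eq_left zero_neq_numeral mult_1)
    then show "x \<in> differences X" unfolding differences_def using *
      by (intro image_eqI[of _ _ "(1 / 2, a, b, c)"]) auto
  }
qed

lemma differences_uminus:
  assumes "\<And>v. v \<in> X \<Longrightarrow> - v \<in> X" "x \<in> differences X" shows "- x \<in> differences X"
proof -
  obtain y where y: "y \<in> {1, 1 / 2} \<times> insert 0 X \<times> insert 0 X \<times> insert 0 X"
    "x = (\<lambda>(t, a, b, c). t *\<^sub>R (a + b + c)) y" using assms(2) unfolding differences_def by blast
  obtain t a b c where "y = (t, a, b, c)" by (cases y)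
  then have x: "x = t *\<^sub>R (a + b + c)" "t \<in> {1, 1 / 2}" "a \<in> insert 0 X" "b \<in> insert 0 X"
    "c \<in> insert 0 X"
    using y by (simp_all only: mem_Sigma_iff prod.case)
  have "- x = t *\<^sub>R (- a + - b + - c)" using x(1) by (simp add: algebra_simps)
  moreover have "- a \<in> insert 0 X" "- b \<in> insert 0 X" "- c \<in> insert 0 X" using x assms(1) by auto
  ultimately show ?thesis unfolding differences_def using x(2)
    by (intro image_eqI[of _ _ "(t, - a, - b, - c)"]) auto
qed

lemma frame_differences:
  assumes K: "P_frame False X K \<or> A_frame X K" and X: "\<And>v. v \<in> X \<Longrightarrow> - v \<in> X" and vw: "v \<in> verts K"
    "w \<in> verts K"
  shows "w - v \<in> differences X"
proof -
  have four: "\<forall>v\<in>{p, q, r, s}. \<forall>w\<in>{p, q, r, s}. w - v \<in> differences X"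
    if "q - p \<in> differences X" "r - p \<in> differences X" "s - p \<in> differences X"
      "r - q \<in> differences X"
       "s - q \<in> differences X" "s - r \<in> differences X" for p q r s
  proof -
    have "p - q \<in> differences X" "p - r \<in> differences X" "p - s \<in> differences X"
      "q - r \<in> differences X"
       "q - s \<in> differences X" "r - s \<in> differences X"
      using that differences_uminus[OF X] by (metis minus_diff_eq)+
    moreover have "0 \<in> differences X" by (rule differencesI(1)[of 0 X 0 0]) auto
    ultimately show ?thesis using that by simp
  qed
  from K show ?thesis
  proof
    assume "P_frame False X K"
    then obtain a b c d where P: "P_form False K a b c d" and "{c - a, b - c, 2 *\<^sub>R d - a - b} \<subseteq> X"
      unfolding P_frame_def by auto
    then have m: "c - a \<in> insert 0 X" "b - c \<in> insert 0 X" "2 *\<^sub>R d - a - b \<in> insert 0 X"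
      "a - c \<in> insert 0 X" "c - b \<in> insert 0 X" "0 \<in> insert 0 X"
      using X[of "c - a"] X[of "b - c"] by auto
    have "\<forall>v\<in>{a, b, c, d}. \<forall>w\<in>{a, b, c, d}. w - v \<in> differences X"
    proof (rule four)
      show "b - a \<in> differences X" by (rule differencesI(1)[OF m(1,2,6)]) simp
      show "c - a \<in> differences X" by (rule differencesI(1)[OF m(1,6,6)]) simp
      show "d - a \<in> differences X" by (rule differencesI(2)[OF m(1,2,3)]) (simp add: vec_eq_iff)
      show "c - b \<in> differences X" by (rule differencesI(1)[OF m(5,6,6)]) simp
      show "d - b \<in> differences X" by (rule differencesI(2)[OF m(4,5,3)]) (simp add: vec_eq_iff)
      show "d - c \<in> differences X" by (rule differencesI(2)[OF m(4,2,3)]) (simp add: vec_eq_iff)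
    qed
    then show ?thesis using vw unfolding form_verts(1)[OF P] by blast
  next
    assume "A_frame X K"
    then obtain w0 w1 w2 w3 where A: "A_form K w0 w1 w2 w3" and "{w1 - w0, w2 - w1, w3 - w2} \<subseteq> X"
      unfolding A_frame_def by blast
    then have m: "w1 - w0 \<in> insert 0 X" "w2 - w1 \<in> insert 0 X" "w3 - w2 \<in> insert 0 X"
      "0 \<in> insert 0 X" by auto
    have "\<forall>v\<in>{w0, w1, w2, w3}. \<forall>w\<in>{w0, w1, w2, w3}. w - v \<in> differences X"
    proof (rule four)
      show "w1 - w0 \<in> differences X" by (rule differencesI(1)[OF m(1,4,4)]) simp
      show "w2 - w0 \<in> differences X" by (rule differencesI(1)[OF m(1,2,4)]) simp
      show "w3 - w0 \<in> differences X" by (rule differencesI(1)[OF m(1,2,3)]) simp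
      show "w2 - w1 \<in> differences X" by (rule differencesI(1)[OF m(2,4,4)]) simp
      show "w3 - w1 \<in> differences X" by (rule differencesI(1)[OF m(2,3,4)]) simp
      show "w3 - w2 \<in> differences X" by (rule differencesI(1)[OF m(3,4,4)]) simp
    qed
    then show ?thesis using vw unfolding form_verts(2)[OF A] by blast
  qed
qed

section \<open>Axes of all generations and finiteness of the valence\<close>

context initial_macros
begin

text \<open>A finite stock of frame vectors closed under negation. Level 1 is included because an
  initial macro that is not of type Pu acquires a Pu frame only in its children.\<close>

definition axes :: "point set" where
  "axes = (let W = mesh_verts (lev 0) \<union> mesh_verts (lev 1);
      X = (\<lambda>(a, b). a - b) ` (W \<times> W) \<union> (\<lambda>(a, b, c). 2 *\<^sub>R a - b - c) ` (W \<times> W \<times> W)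
    in X \<union> uminus ` X)"

definition scaled_axes :: "nat \<Rightarrow> point set" where
  "scaled_axes q = ((`) (\<lambda>v. (1 / 2) *\<^sub>R v) ^^ q) axes"

lemma finite_axes: "finite axes"
proof -
  have "finite (mesh_verts (lev n))" for n
    unfolding mesh_verts_def using finite_lev lev_node node_tetrahedron(2) by blast
  then show ?thesis by (simp add: axes_def Let_def)
qed

lemma axes_uminus: "v \<in> axes \<Longrightarrow> - v \<in> axes"
proof -
  have "- v \<in> X \<union> uminus ` X" if "v \<in> X \<union> uminus ` X" for v :: point and X
    using that by auto
  then show "v \<in> axes \<Longrightarrow> - v \<in> axes" unfolding axes_def Let_def by blast
qed

lemma scaled_axes: "v \<in> scaled_axes q \<Longrightarrow> - v \<in> scaled_axes q" "finite (scaled_axes q)"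
  "card (scaled_axes q) \<le> card axes"
proof -
  have "(\<forall>v\<in>scaled_axes q. - v \<in> scaled_axes q) \<and> finite (scaled_axes q)
    \<and> card (scaled_axes q) \<le> card axes"
  proof (induction q)
    case 0
    then show ?case using axes_uminus finite_axes by (simp add: scaled_axes_def)
  next
    case (Suc q)
    have eq: "scaled_axes (Suc q) = (\<lambda>v. (1 / 2) *\<^sub>R v) ` scaled_axes q"
      by (simp add: scaled_axes_def)
    have "card (scaled_axes (Suc q)) \<le> card axes" unfolding eq using Suc card_image_le le_trans
      by blast
    moreover have "- v \<in> scaled_axes (Suc q)" if v: "v \<in> scaled_axes (Suc q)" for v
    proof -
      obtain w where "w \<in> scaled_axes q" "v = (1 / 2) *\<^sub>R w" using v unfolding eq by blast
      then show ?thesis unfolding eq using Suc by (intro image_eqI[of _ _ "- w"]) auto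
    qed
    ultimately show ?case using Suc unfolding eq by simp
  qed
  then show "v \<in> scaled_axes q \<Longrightarrow> - v \<in> scaled_axes q" "finite (scaled_axes q)"
    "card (scaled_axes q) \<le> card axes" by auto
qed

lemma P_frame_axes:
  assumes "P_form False K a b c d" "K \<in> lev 0 \<union> lev 1" shows "P_frame False axes K"
proof -
  have "verts K \<subseteq> mesh_verts (lev 0) \<union> mesh_verts (lev 1)" using assms(2) unfolding mesh_verts_def
    by blast
  then have m: "{a, b, c, d} \<subseteq> mesh_verts (lev 0) \<union> mesh_verts (lev 1)"
    using form_verts(1)[OF assms(1)] by simp
  define W where "W = mesh_verts (lev 0) \<union> mesh_verts (lev 1)"
  have "x - y \<in> axes" if "x \<in> W" "y \<in> W" for x y
  proof -
    have "x - y \<in> (\<lambda>(a, b). a - b) ` (W \<times> W)"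
      by (rule image_eqI[of _ _ "(x, y)"]) (use that in auto)
    then show ?thesis by (simp add: axes_def Let_def W_def)
  qed
  moreover have "2 *\<^sub>R x - y - z \<in> axes" if "x \<in> W" "y \<in> W" "z \<in> W" for x y z
  proof -
    have "2 *\<^sub>R x - y - z \<in> (\<lambda>(a, b, c). 2 *\<^sub>R a - b - c) ` (W \<times> W \<times> W)"
      by (rule image_eqI[of _ _ "(x, y, z)"]) (use that in auto)
    then show ?thesis by (simp add: axes_def Let_def W_def)
  qed
  ultimately have "{c - a, b - c, 2 *\<^sub>R d - a - b} \<subseteq> axes" using m[folded W_def] by simp
  then show ?thesis using assms(1) unfolding P_frame_def by auto
qed

text \<open>The statement starts with the first refined mesh, since initial macros of type M or O
  have no frame. There the frame comes from the initial macro or from its child; afterwards each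
  macro step contains exactly one halving.\<close>

lemma lev_frame: "K \<in> lev (3 * Suc q) \<Longrightarrow> P_frame False (scaled_axes (Suc q)) K
  \<or> A_frame (scaled_axes (Suc q)) K"
proof (induction q arbitrary: K)
  have S: "scaled_axes (Suc q) = (\<lambda>v. (1 / 2) *\<^sub>R v) ` scaled_axes q" for q
    by (simp add: scaled_axes_def)
  have from_P: "P_frame False (scaled_axes (Suc q)) (child3 P x y z)"
    if F: "P_frame False (scaled_axes q) P" and p: "descent P x y z" for P x y z q
  proof -
    have x: "x \<in> redge P" "y \<in> redge (child P x)" "z \<in> redge (child (child P x) y)" using p
      by (simp_all add: descent_def)
    have "P_frame True (scaled_axes q) (child P x)"
      by (rule P_frame_child[OF F x(1) scaled_axes(1)])
    then have "A_frame (scaled_axes (Suc q)) (child (child P x) y)"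
      unfolding S by (rule P_frame_child'[OF _ x(2) scaled_axes(1)])
    then show ?thesis by (rule A_frame_child[OF _ x(3) scaled_axes(1)])
  qed
  have from_A: "A_frame (scaled_axes (Suc q)) (child3 P x y z)"
    if F: "P_frame False (scaled_axes q) (child P x)" and p: "descent P x y z" for P x y z q
  proof -
    have x: "y \<in> redge (child P x)" "z \<in> redge (child (child P x) y)" using p
      by (simp_all add: descent_def)
    have "P_frame True (scaled_axes q) (child (child P x) y)"
      by (rule P_frame_child[OF F x(1) scaled_axes(1)])
    then show ?thesis unfolding S by (rule P_frame_child'[OF _ x(2) scaled_axes(1)])
  qed
  {
    case 0
    then obtain P x y z where P: "P \<in> lev (3 * 0)" "descent P x y z" "K = child3 P x y z"
      unfolding lev_3 by blast
    have s0: "scaled_axes 0 = axes" by (simp add: scaled_axes_def)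
    show ?case
    proof (cases rule: descent_cases[OF lev_macro[OF P(1)] P(2)])
      case (1 a b c d m m2 m3)
      then have "P_frame False axes P" using P(1) by (intro P_frame_axes) auto
      then show ?thesis using from_P[of 0 P x y z] P s0 by simp
    next
      case (2 o' c d p q r m m2 m3)
      have "child P x \<in> lev 1" using lev_SucI[of P 0 x] P(1,2) by (simp add: descent_def)
      then have "P_frame False axes (child P x)" using 2(8) by (intro P_frame_axes) auto
      then show ?thesis using from_A[of 0 P x y z] P s0 by simp
    qed
  next
    case (Suc q)
    then obtain P x y z where P: "P \<in> lev (3 * Suc q)" "descent P x y z" "K = child3 P x y z"
      unfolding lev_3[of _ "Suc q"] by blast
    from Suc.IH[OF P(1)] show ?case
    proof
      assume "P_frame False (scaled_axes (Suc q)) P"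
      then show ?thesis using from_P P by blast
    next
      assume "A_frame (scaled_axes (Suc q)) P"
      then have "P_frame False (scaled_axes (Suc q)) (child P x)"
        using P(2) by (intro A_frame_child scaled_axes(1)) (simp_all add: descent_def)
      then show ?thesis using from_A P by blast
    qed
  }
qed

text \<open>All vertices of the macros at z lie in z plus a set of edge vectors of bounded size, and
  a macro is determined by its vertex set; hence the exponential bound. At q = 0 the size of the
  initial mesh suffices.\<close>

lemma card_valence:
  "card {K \<in> lev (3 * q). z \<in> verts K} \<le> max (card \<T>\<^sub>0) (2 ^ (2 * (card axes + 1) ^ 3))"
proof (cases q)
  case 0
  then show ?thesis using card_mono[of "\<T>\<^sub>0" "{K \<in> \<T>\<^sub>0. z \<in> verts K}"] fin
    by (simp add: lev_0 le_max_iff_disj)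
next
  case (Suc q')
  let ?D = "differences (scaled_axes q)" and ?U = "{K \<in> lev (3 * q). z \<in> verts K}"
  have D: "finite ?D" "card ?D \<le> 2 * (card axes + 1) ^ 3"
  proof -
    show "finite ?D" using card_differences(1) scaled_axes(2) by blast
    have "card ?D \<le> 2 * (card (scaled_axes q) + 1) ^ 3" using card_differences(2) scaled_axes(2)
      by blast
    also have "\<dots> \<le> 2 * (card axes + 1) ^ 3" using scaled_axes(3)
      by (intro mult_left_mono power_mono) auto
    finally show "card ?D \<le> 2 * (card axes + 1) ^ 3" .
  qed
  have "verts ` ?U \<subseteq> Pow ((\<lambda>d. z + d) ` ?D)"
  proof clarify
    fix K v assume K: "K \<in> lev (3 * q)" "z \<in> verts K" "v \<in> verts K"
    have "v - z \<in> ?D"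
      using frame_differences[OF lev_frame[of K q'] _ K(2,3)] scaled_axes(1) K(1) Suc by blast
    then show "v \<in> (\<lambda>d. z + d) ` ?D" by (intro image_eqI[of _ _ "v - z"]) auto
  qed
  then have "card (verts ` ?U) \<le> card (Pow ((\<lambda>d. z + d) ` ?D))" using D(1) by (intro card_mono) auto
  also have "\<dots> = 2 ^ card ((\<lambda>d. z + d) ` ?D)" using D(1) by (simp add: card_Pow)
  also have "\<dots> \<le> 2 ^ (2 * (card axes + 1) ^ 3)"
    by (rule power_increasing[OF le_trans[OF card_image_le[OF D(1)] D(2)]]) simp
  finally have "card (verts ` ?U) \<le> 2 ^ (2 * (card axes + 1) ^ 3)" .
  moreover have "card (verts ` ?U) = card ?U"
    by (intro card_image inj_on_subset[OF inj_verts_lev]) auto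
  ultimately show ?thesis by simp
qed

lemma macro_valence_finite: "macro_valence \<T>\<^sub>0 < \<infinity>"
proof -
  have "macro_valence \<T>\<^sub>0 \<le> enat (max (card \<T>\<^sub>0) (2 ^ (2 * (card axes + 1) ^ 3)))"
    unfolding macro_valence_def uniform_mesh_lev using card_valence
      by (intro SUP_least) (simp only: enat_ord_simps)
  then show ?thesis by (rule le_less_trans) simp
qed

section \<open>The bound for one block\<close>

lemma card_le_valence:
  assumes "macro_valence \<T>\<^sub>0 = enat \<nu>" shows "card {K \<in> lev (3 * q). z \<in> verts K} \<le> \<nu>"
proof (cases "z \<in> mesh_verts (lev (3 * q))")
  case True
  have "enat (card {K \<in> lev (3 * q). z \<in> verts K}) \<le> macro_valence \<T>\<^sub>0"
    unfolding macro_valence_def uniform_mesh_lev using True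
    by (intro SUP_upper2[of q] SUP_upper2[of z]) auto
  then show ?thesis using assms by simp
next
  case False
  then have "{K \<in> lev (3 * q). z \<in> verts K} = {}" by (auto simp: mesh_verts_def)
  then show ?thesis by (metis card.empty le0)
qed

lemma block_bound:
  assumes T: "tree_mesh \<T>" "\<M> \<subseteq> \<T>" and G: "causal_forest \<T> \<M> G" "causal_chain \<T> \<M> G Ks"
    and block: "horizontal_block \<T>\<^sub>0 Ks r s" and \<nu>: "macro_valence \<T>\<^sub>0 = enat \<nu>"
  shows "card {r..s} \<le> 448 * card \<T>\<^sub>0 \<or> card {r..s} \<le> 630 * \<nu>"
proof -
  note ch = chain_facts[OF T G]
  define q where "q = mgen \<T>\<^sub>0 (redge (Ks ! r))"
  have rs: "r \<le> s" "s < length Ks" and mg: "\<And>j. j \<in> {r..s} \<Longrightarrow> mgen \<T>\<^sub>0 (redge (Ks ! j)) = q"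
    using block unfolding horizontal_block_def Let_def q_def by blast+
  have A: "\<exists>A\<in>lev (3 * q). Ks ! j \<in> below A" if j: "j \<in> {r..s}" for j
  proof -
    obtain n where n: "Ks ! j \<in> lev n" using ch(2)[of j] rs j by auto
    obtain A where A: "A \<in> lev (3 * (n div 3))" "Ks ! j \<in> below A" by (rule lev_below[OF n])
    \<comment> \<open>The bisected edge belongs to the macro A above the event, so the common
      macro-generation of the block is the generation of A.\<close>
    have "n div 3 = q" using mgen_eq[OF redge_below[OF A]] mg[OF j] by simp
    then show ?thesis using A by blast
  qed
  have inj: "inj_on ((!) Ks) {r..s}" using ch(1) by (rule inj_on_subset) (use rs in auto)
  have bound: "card {r..s} \<le> card \<A> * 7" if "\<A> \<subseteq> lev (3 * q)"
    "\<And>j. j \<in> {r..s} \<Longrightarrow> \<exists>A\<in>\<A>. Ks ! j \<in> below A" for \<A>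
  proof -
    have "card {r..s} = card ((!) Ks ` {r..s})" using inj by (simp add: card_image)
    also have "\<dots> \<le> card (\<Union>A\<in>\<A>. below A)" using that(2) card_Union_below(2)[OF that(1)]
      by (intro card_mono) auto
    also have "\<dots> \<le> card \<A> * 7" by (rule card_Union_below(1)[OF that(1)])
    finally show ?thesis .
  qed
  show ?thesis
  proof (cases "q \<le> 2")
    case True
    have "card {r..s} \<le> card (lev (3 * q)) * 7" using A by (intro bound) auto
    also have "\<dots> \<le> (2 ^ (3 * q) * card \<T>\<^sub>0) * 7" using card_lev by simp
    \<comment> \<open>With q at most 2 there are at most six levels of bisection, and 7 * 64 =
      448.\<close>
    also have "\<dots> \<le> (2 ^ 6 * card \<T>\<^sub>0) * 7" using True
      by (intro mult_right_mono power_increasing) auto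
    finally show ?thesis by simp
  next
    case False
    \<comment> \<open>Two earlier macro generations are available: one for the parents, one for
      their old vertices.\<close>
    then obtain p where p: "q = Suc (Suc p)" using not_less_eq_eq
      by (metis Suc_leD Suc_le_D numeral_2_eq_2)
    have "\<exists>A P. P \<in> lev (3 * Suc p) \<and> A \<in> great_grandchildren P \<and> Ks ! j \<in> below A" if "j \<in> {r..s}"
      for j
      using A[OF that] lev_3[of _ "Suc p"] unfolding p great_grandchildren_def by blast
    then obtain A P
      where AP: "\<And>j. j \<in> {r..s} \<Longrightarrow> P j \<in> lev (3 * Suc p) \<and> A j \<in> great_grandchildren (P j)
      \<and> Ks ! j \<in> below (A j)"
      by metis
    have step: "r \<le> j \<Longrightarrow> Suc j \<le> s \<Longrightarrow> redge (Ks ! j) \<in> edges (verts (Ks ! Suc j))" for j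
      using ch(3) rs by simp
    obtain a b c where abc: "\<forall>j\<in>{r..s}. a \<in> verts (A j) \<or> b \<in> verts (P j) \<or> c \<in> verts (A j)"
      by (rule block_localized[where K = "\<lambda>j. Ks ! j", OF rs(1) AP step])
    let ?a = "{A \<in> lev (3 * q). a \<in> verts A}" and ?c = "{A \<in> lev (3 * q). c \<in> verts A}"
      and ?b = "\<Union>P\<in>{P \<in> lev (3 * Suc p). b \<in> verts P}. great_grandchildren P"
    have gg: "great_grandchildren P \<subseteq> lev (3 * q)" if "P \<in> lev (3 * Suc p)" for P
      using lev_3_great_grandchildren[OF that] p by simp
    have "\<exists>B\<in>?a \<union> ?c \<union> ?b. Ks ! j \<in> below B" if "j \<in> {r..s}" for j
      using abc that AP[OF that] gg by blast
    moreover have "?a \<union> ?c \<union> ?b \<subseteq> lev (3 * q)" using gg by blast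
    ultimately have "card {r..s} \<le> card (?a \<union> ?c \<union> ?b) * 7" by (intro bound) blast+
    moreover have "card (?a \<union> ?c \<union> ?b) \<le> card ?a + card ?c + card ?b"
      using card_Un_le[of "?a \<union> ?c" ?b] card_Un_le[of ?a ?c] by linarith
    moreover have "card ?b \<le> card {P \<in> lev (3 * Suc p). b \<in> verts P} * 8"
      using finite_lev card_great_grandchildren[of _ "Suc p"] by (intro card_UN_le_mult) simp_all
    moreover have "n \<le> 70 * \<nu>" if "n \<le> u * 7" "u \<le> i + j + k" "k \<le> l * 8" "i \<le> \<nu>" "j \<le> \<nu>" "l \<le> \<nu>"
      for n u i j k l
      using that by linarith
    ultimately have "card {r..s} \<le> 70 * \<nu>" using card_le_valence[OF \<nu>] by meson
    then show ?thesis by simp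
  qed
qed

end

text \<open>Conformity puts a point common to two elements into the hull of common vertices; its
  coordinates there are its coordinates in both elements. Disjoint interiors exclude two elements
  with the same vertices but different marks.\<close>

lemma initial_AMP_mesh_macros:
  assumes "initial_AMP_mesh \<Omega> \<T>\<^sub>0" shows "initial_macros \<T>\<^sub>0"
proof -
  have mesh: "AMP_mesh \<Omega> \<T>\<^sub>0" "conformingly_marked \<T>\<^sub>0" "\<forall>K\<in>\<T>\<^sub>0. \<not> flag K"
    using assms unfolding initial_AMP_mesh_def by blast+
  have T: "finite \<T>\<^sub>0" "\<forall>K\<in>\<T>\<^sub>0. marked_tet K"
    "\<forall>K\<in>\<T>\<^sub>0. \<forall>L\<in>\<T>\<^sub>0. K \<noteq> L \<longrightarrow> interior (body K) \<inter> interior (body L) = {}"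
    using mesh(1) unfolding AMP_mesh_def by blast+
  have conf: "conforming \<T>\<^sub>0" and agree: "marks_agree \<T>\<^sub>0"
    using mesh(2) unfolding conformingly_marked_def marks_agree_def by blast+
  have mac: "macro K" if "K \<in> \<T>\<^sub>0" for K
    using T(2) mesh(3) that marked_U_form[of K] unfolding macro_def by blast
  note tet = node_tetrahedron[OF macro_node[OF mac]]
  have emb: "u = w" if u: "K \<in> \<T>\<^sub>0" "u \<in> coords (verts K)" and w: "L \<in> \<T>\<^sub>0" "w \<in> coords (verts L)"
    and eq: "pt u = pt w" for K L u w
  proof -
    have inj: "inj_on pt (coords (verts K))" if "K \<in> \<T>\<^sub>0" for K
      using inj_on_pt_coords tet[OF that] by (simp add: tetrahedron_def)
    have "\<exists>S. S \<subseteq> verts K \<inter> verts L \<and> body K \<inter> body L \<subseteq> convex hull S"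
    proof (cases "K = L")
      case True then show ?thesis by (auto simp: body_def)
    next
      case False
      then consider "body K \<inter> body L = {}" | z where "z \<in> verts K \<inter> verts L" "body K \<inter> body L = {z}"
        | e where "e \<in> edges (verts K) \<inter> edges (verts L)" "body K \<inter> body L = convex hull e"
        | F where "F \<in> faces (verts K) \<inter> faces (verts L)" "body K \<inter> body L = convex hull F"
        using conf u(1) w(1) unfolding conforming_def by blast
      then show ?thesis
      proof cases
        case 1 then show ?thesis by blast
      next
        case (2 z) then show ?thesis by (intro exI[of _ "{z}"]) auto
      next
        case (3 e) then show ?thesis by (intro exI[of _ e]) (auto simp: edges_def)
      next
        case (4 F) then show ?thesis by (intro exI[of _ F]) (auto simp: faces_def)
      qed
    qed
    then obtain S where S: "S \<subseteq> verts K" "S \<subseteq> verts L" "body K \<inter> body L \<subseteq> convex hull S" by blast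
    have "pt u \<in> body K" "pt w \<in> body L"
      using u w body_coords tet(2) unfolding body_def by blast+
    then have "pt u \<in> convex hull S" using S(3) eq by auto
    \<comment> \<open>Coordinates with respect to the common vertices, extended by 0, are
      coordinates in both tetrahedra.\<close>
    then obtain t where t: "t \<in> coords S" "pt t = pt u"
      using body_coords[OF finite_subset[OF S(1) tet(2)[OF u(1)]]] by auto
    have "t \<in> coords (verts K)" "t \<in> coords (verts L)"
      using t(1) coords_mono[OF S(1) tet(2)[OF u(1)]] coords_mono[OF S(2) tet(2)[OF w(1)]] by auto
    then have "t = u" "t = w"
      using inj_onD[OF inj[OF u(1)], of t u] inj_onD[OF inj[OF w(1)], of t w] t u w eq by auto
    then show "u = w" by simp
  qed
  have "inj_on verts \<T>\<^sub>0"
  proof (rule inj_onI, rule ccontr)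
    fix K L assume KL: "K \<in> \<T>\<^sub>0" "L \<in> \<T>\<^sub>0" "verts K = verts L" "K \<noteq> L"
    have t: "card (verts K) = 4" "\<not> affine_dependent (verts K)" using tet(1)[OF KL(1)]
      by (auto simp: tetrahedron_def)
    have "interior (convex hull (verts K)) \<noteq> {}"
      using interior_convex_hull_eq_empty[of "verts K"] t by simp
    moreover have "interior (body K) \<inter> interior (body L) = {}" using T(3) KL by blast
    ultimately show False using KL(3) by (simp add: body_def)
  qed
  moreover have "embedded \<T>\<^sub>0" unfolding embedded_def by (rule inj_onI) (use emb in blast)
  ultimately show ?thesis using mac agree T(1) by unfold_locales auto
qed

theorem proposition4p1:
  fixes \<Omega> :: "point set" and \<T>\<^sub>0 :: "mtet set"
  assumes "polyhedral_domain \<Omega>" and "initial_AMP_mesh \<Omega> \<T>\<^sub>0"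
  shows "macro_valence \<T>\<^sub>0 < \<infinity> \<and>
    (\<forall>\<T> \<M> G Ks r s.
       descendant_mesh \<T>\<^sub>0 \<T> \<and> conformingly_marked \<T> \<and> \<M> \<subseteq> \<T> \<and>
       causal_forest \<T> \<M> G \<and> causal_chain \<T> \<M> G Ks \<and> horizontal_block \<T>\<^sub>0 Ks r s \<longrightarrow>
       enat (card {r..s}) \<le> max (448 * enat (card \<T>\<^sub>0)) (630 * macro_valence \<T>\<^sub>0))"
proof -
  interpret initial_macros \<T>\<^sub>0 by (rule initial_AMP_mesh_macros[OF assms(2)])
  obtain \<nu> where \<nu>: "macro_valence \<T>\<^sub>0 = enat \<nu>" using macro_valence_finite by auto
  have "enat (card {r..s}) \<le> max (448 * enat (card \<T>\<^sub>0)) (630 * enat \<nu>)"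
    if "descendant_mesh \<T>\<^sub>0 \<T>" "\<M> \<subseteq> \<T>" "causal_forest \<T> \<M> G" "causal_chain \<T> \<M> G Ks"
      "horizontal_block \<T>\<^sub>0 Ks r s"
    for \<T> \<M> G Ks r s
    using block_bound[OF descendant_tree_mesh[OF that(1)] that(2-5) \<nu>]
    by (simp only: numeral_eq_enat times_enat_simps le_max_iff_disj enat_ord_simps)
  then show ?thesis using macro_valence_finite \<nu> by (metis (no_types, lifting))
qed

end
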